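(* Let $k$ be an algebraically closed field of characteristic zero and $S=k[y_1,y_2]$. Let $t,d,s$ be positive integers with $t\le s<d+1$, and let $$\Sigma_s=\{\Lambda\in G(t,S_d): \mathbf P\Lambda \text{ lies on some secant } (s-1)\text{-plane of } C_d\}.$$ Then $$\dim\Sigma_s=\min\{\,s+t(s-t),\ t(d-t+1)\,\}.$$
   Context: $S_d$ is the space of binary forms of degree $d$; $G(t,S_d)$ is the Grassmannian of $t$-dimensional subspaces of $S_d$; $\mathbf P W$ is the projective space of lines in $W$. $C_d=\{[L^d]: L\in S_1\setminus\{0\}\}\subseteq\mathbf P S_d\simeq\mathbf P^d$ is the rational normal curve. A linear subspace $\Pi\subseteq\mathbf P S_d$ of projective dimension $m$ is called a secant $m$-plane to $C_d$ if the scheme-theoretic intersection $C_d\cap\Pi$ has length $\ge m+1$ (so tangent and osculating positions are allowed). *)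

theory Defs
  imports
    "HOL-Analysis.Function_Topology"
    "HOL-Library.Poly_Mapping"
    "HOL-Library.Extended_Nat"
    "HOL-Library.Liminf_Limsup"
    "HOL-Computational_Algebra.Polynomial"
    "Jordan_Normal_Form.Determinant"
begin

section \<open>Polynomials over a field, with variables indexed by \<open>'v\<close>\<close>

type_synonym ('v, 'a) mpoly = "('v \<Rightarrow>\<^sub>0 nat) \<Rightarrow>\<^sub>0 'a"

definition mscale :: "'a::field \<Rightarrow> ('v, 'a) mpoly \<Rightarrow> ('v, 'a) mpoly" where
  "mscale c p = Poly_Mapping.single 0 c * p"

interpretation mp: vector_space "mscale :: 'a::field \<Rightarrow> ('v, 'a) mpoly \<Rightarrow> ('v, 'a) mpoly"
  by unfold_locales
    (simp_all add: mscale_def distrib_left distrib_right single_add mult_single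
      mult.assoc[symmetric] single_one)

definition mon_degree :: "('v \<Rightarrow>\<^sub>0 nat) \<Rightarrow> nat" where
  "mon_degree m = (\<Sum>v\<in>Poly_Mapping.keys m. Poly_Mapping.lookup m v)"

definition mpolys :: "'v set \<Rightarrow> ('v, 'a::field) mpoly set" where
  "mpolys V = {p. \<forall>m\<in>Poly_Mapping.keys p. Poly_Mapping.keys m \<subseteq> V}"

text \<open>The homogeneous part of degree \<open>n\<close> of \<open>k[x\<^sub>v : v \<in> V]\<close>; it contains \<open>0\<close>.\<close>

definition hpolys :: "'v set \<Rightarrow> nat \<Rightarrow> ('v, 'a::field) mpoly set" where
  "hpolys V n = {p \<in> mpolys V. \<forall>m\<in>Poly_Mapping.keys p. mon_degree m = n}"

definition meval :: "('v \<Rightarrow> 'a::field) \<Rightarrow> ('v, 'a) mpoly \<Rightarrow> 'a" where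
  "meval x p = (\<Sum>m\<in>Poly_Mapping.keys p. Poly_Mapping.lookup p m * (\<Prod>v\<in>Poly_Mapping.keys m. x v ^ Poly_Mapping.lookup m v))"


section \<open>Binary forms and projective spaces\<close>

text \<open>Binary forms of degree \<open>d\<close>, in the variables \<open>y\<^sub>1, y\<^sub>2\<close>.\<close>

definition binary_forms :: "nat \<Rightarrow> (nat, 'a::field) mpoly set" where
  "binary_forms d = hpolys {1, 2} d"

text \<open>The coordinates of a form of degree \<open>d\<close> in the basis \<open>y\<^sub>1\<^sup>i y\<^sub>2\<^sup>d\<^sup>-\<^sup>i\<close>, \<open>0 \<le> i \<le> d\<close>.\<close>

definition form_coeff :: "nat \<Rightarrow> (nat, 'a::field) mpoly \<Rightarrow> nat \<Rightarrow> 'a" where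
  "form_coeff d p i = Poly_Mapping.lookup p (Poly_Mapping.single 1 i + Poly_Mapping.single 2 (d - i))"

definition proj_space :: "(nat, 'a::field) mpoly set \<Rightarrow> (nat, 'a) mpoly set set" where
  "proj_space W = {mp.span {v} | v. v \<in> W \<and> v \<noteq> 0}"

definition rational_normal_curve :: "nat \<Rightarrow> (nat, 'a::field) mpoly set set" where
  "rational_normal_curve d = {mp.span {L ^ d} | L. L \<in> binary_forms 1 \<and> L \<noteq> 0}"

definition grassmannian :: "nat \<Rightarrow> (nat, 'a::field) mpoly set \<Rightarrow> (nat, 'a) mpoly set set" where
  "grassmannian t W = {\<Lambda>. mp.subspace \<Lambda> \<and> \<Lambda> \<subseteq> W \<and> mp.dim \<Lambda> = t}"


section \<open>Scheme-theoretic intersections and secant planes\<close>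

text \<open>
  The homogeneous coordinate ring of \<open>\<bbbP>S\<^sub>d\<close> is \<open>R = k[x\<^sub>0, \<dots>, x\<^sub>d]\<close>, where \<open>x\<^sub>i\<close> is the
  coordinate \<open>form_coeff d _ i\<close>. Over an infinite field, a polynomial vanishing at all vectors
  of all the lines in \<open>X\<close> has all its homogeneous components vanishing on \<open>X\<close>, so the
  following is the homogeneous ideal of \<open>X\<close>, i.e. of the reduced structure on \<open>X\<close> when \<open>X\<close>
  is closed.
\<close>

definition vanishing_ideal :: "nat \<Rightarrow> (nat, 'a::field) mpoly set set \<Rightarrow> (nat, 'a) mpoly set" where
  "vanishing_ideal d X =
     {f \<in> mpolys {0..d}. \<forall>l\<in>X. \<forall>v\<in>l. meval (form_coeff d v) f = 0}"

text \<open>The scheme-theoretic intersection of \<open>X\<close> and \<open>Y\<close> is \<open>Proj (R / (I(X) + I(Y)))\<close>.\<close>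

definition intersection_ideal ::
  "nat \<Rightarrow> (nat, 'a::field) mpoly set set \<Rightarrow> (nat, 'a) mpoly set set \<Rightarrow> (nat, 'a) mpoly set" where
  "intersection_ideal d X Y =
     {f + g | f g. f \<in> vanishing_ideal d X \<and> g \<in> vanishing_ideal d Y}"

text \<open>\<open>dim\<^sub>k (R/I)\<^sub>n\<close> for a homogeneous ideal \<open>I\<close> of \<open>R\<close>.\<close>

definition hilbert_function :: "nat \<Rightarrow> (nat, 'a::field) mpoly set \<Rightarrow> nat \<Rightarrow> nat" where
  "hilbert_function d I n =
     mp.dim (hpolys {0..d} n :: (nat, 'a) mpoly set) - mp.dim (I \<inter> hpolys {0..d} n)"

text \<open>
  The Hilbert function of \<open>R/I\<close> agrees with the Hilbert polynomial in large degrees. If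
  \<open>Proj (R/I)\<close> is finite this polynomial is constant, with value the length of the scheme;
  otherwise the Hilbert function tends to infinity, and the length is \<open>\<infinity>\<close>.
\<close>

definition scheme_length :: "nat \<Rightarrow> (nat, 'a::field) mpoly set \<Rightarrow> enat" where
  "scheme_length d I = liminf (\<lambda>n. enat (hilbert_function d I n))"

definition secant_plane :: "nat \<Rightarrow> nat \<Rightarrow> (nat, 'a::field) mpoly set set \<Rightarrow> bool" where
  "secant_plane d m P \<longleftrightarrow>
     (\<exists>W\<in>grassmannian (m + 1) (binary_forms d). P = proj_space W) \<and>
     scheme_length d (intersection_ideal d (rational_normal_curve d) P) \<ge> enat (m + 1)"

definition secant_locus :: "nat \<Rightarrow> nat \<Rightarrow> nat \<Rightarrow> (nat, 'a::field) mpoly set set" where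
  "secant_locus s t d =
     {\<Lambda> \<in> grassmannian t (binary_forms d). \<exists>P. secant_plane d (s - 1) P \<and> proj_space \<Lambda> \<subseteq> P}"


section \<open>The Zariski topology on the Grassmannian\<close>

definition ordered_basis :: "(nat, 'a::field) mpoly list \<Rightarrow> (nat, 'a) mpoly set \<Rightarrow> bool" where
  "ordered_basis bs \<Lambda> \<longleftrightarrow> distinct bs \<and> mp.independent (set bs) \<and> mp.span (set bs) = \<Lambda>"

text \<open>The maximal minor with columns \<open>J\<close> of the matrix whose rows are the coordinates of \<open>bs\<close>.\<close>

definition pluecker :: "nat \<Rightarrow> (nat, 'a::field) mpoly list \<Rightarrow> nat set \<Rightarrow> 'a" where
  "pluecker d bs J =
     Determinant.det (Matrix.mat (length bs) (length bs)
       (\<lambda>(i, j). form_coeff d (bs ! i) (sorted_list_of_set J ! j)))"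

definition pluecker_polys :: "nat \<Rightarrow> nat \<Rightarrow> (nat set, 'a::field) mpoly set" where
  "pluecker_polys t d = (\<Union>n. hpolys {J. J \<subseteq> {0..d} \<and> card J = t} n)"

text \<open>
  The locus where \<open>f\<close> does not vanish. Changing the basis multiplies all Pluecker coordinates
  by the same nonzero scalar, so for homogeneous \<open>f\<close> the choice of basis is irrelevant.
\<close>

definition pluecker_nonzeros ::
  "nat \<Rightarrow> nat \<Rightarrow> (nat set, 'a::field) mpoly \<Rightarrow> (nat, 'a) mpoly set set" where
  "pluecker_nonzeros t d f = {\<Lambda> \<in> grassmannian t (binary_forms d).
     \<exists>bs. ordered_basis bs \<Lambda> \<and> meval (pluecker d bs) f \<noteq> 0}"

text \<open>
  The nonvanishing loci are closed under finite intersections (multiply the polynomials), hence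
  form a base: the closed sets are the common zero loci in the Pluecker embedding.
\<close>

definition grassmann_zariski :: "nat \<Rightarrow> nat \<Rightarrow> (nat, 'a::field) mpoly set topology" where
  "grassmann_zariski t d = topology_generated_by (pluecker_nonzeros t d ` pluecker_polys t d)"


section \<open>Dimension\<close>

definition irreducible_space :: "'b topology \<Rightarrow> bool" where
  "irreducible_space X \<longleftrightarrow> topspace X \<noteq> {} \<and>
     (\<forall>A B. closedin X A \<longrightarrow> closedin X B \<longrightarrow> A \<union> B = topspace X \<longrightarrow>
        A = topspace X \<or> B = topspace X)"

text \<open>
  The supremum of the lengths of chains \<open>Z\<^sub>0 \<subset> \<dots> \<subset> Z\<^sub>n\<close> of irreducible closed subsets; by
  convention the empty space has dimension \<open>0\<close>.
\<close>

definition krull_dim :: "'b topology \<Rightarrow> enat" where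
  "krull_dim X = Sup {enat n | n. \<exists>Z :: nat \<Rightarrow> 'b set.
     (\<forall>i\<le>n. closedin X (Z i) \<and> irreducible_space (subtopology X (Z i))) \<and>
     (\<forall>i<n. Z i \<subset> Z (Suc i))}"

end

theory Submission
  imports Defs "HOL-Library.Function_Algebras"
begin

text \<open>
  The linear forms vanishing on a secant \<open>(s-1)\<close>-plane restrict to the curve as the multiples of one
  binary form \<open>g\<close> of degree \<open>s\<close>, so the plane is the space of forms apolar to \<open>g\<close>: in suitable
  coordinates, the solutions of the linear recurrence with characteristic polynomial \<open>g\<close>.
  Hence \<open>\<Lambda>\<close> is in the secant locus iff it is annihilated by some \<open>g \<noteq> 0\<close>. The pairs \<open>(g, \<Lambda>)\<close>
  have \<open>s + t (s - t)\<close> parameters, which bounds the dimension from above. From below, if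
  \<open>s \<ge> t (d - s + 1)\<close> then counting equations gives a \<open>g\<close> for every \<open>\<Lambda>\<close>; otherwise
  \<open>g\<close> can be recovered rationally from \<open>\<Lambda>\<close> near a coordinate subspace spanned by well-spread
  basis vectors. Both bounds for the Krull dimension are elementary: strict chains of irreducible
  sets force growth of Hilbert functions, and flags of parameters with rational inverses give chains.
\<close>

section \<open>Evaluation of multivariate polynomials\<close>

text \<open>Why length at least s yields a single g: let U consist of the restrictions to the curve
  of the linear forms vanishing on the plane, so that dim U \<ge> d + 1 - s. The products of U with
  all polynomials of degree at most m form spaces whose dimension grows by at least one with each m,
  hence at least as fast as the ambient space of polynomials of degree at most d + m. Their
  codimension therefore starts at no more than s and never increases, while the length keeps it at
  least s in large degree. So the very first step adds only one dimension, and a space U that grows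
  so slowly consists of the multiples of one polynomial. Multiplicities never enter, so tangent and
  osculating positions need no separate treatment. The case distinction for the lower bound compares
  the two entries of the minimum: after t (s - t) is subtracted they are s and t (d - s + 1). The
  latter is the number of linear equations that t basis vectors impose on the s + 1 coefficients of
  g.\<close>

abbreviation (input) "keys \<equiv> Poly_Mapping.keys"
abbreviation (input) "lookup \<equiv> Poly_Mapping.lookup"
abbreviation (input) "single \<equiv> Poly_Mapping.single"

abbreviation mon_eval :: "('v \<Rightarrow> 'a::field) \<Rightarrow> ('v \<Rightarrow>\<^sub>0 nat) \<Rightarrow> 'a" where
  "mon_eval x m \<equiv> (\<Prod>v\<in>keys m. x v ^ lookup m v)"

lemma mon_eval_superset:
  assumes "finite S" "keys m \<subseteq> S"
  shows "mon_eval x m = (\<Prod>v\<in>S. x v ^ lookup m v)"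
  by (rule prod.mono_neutral_left) (use assms in \<open>auto simp: in_keys_iff\<close>)

lemma mon_eval_add: "mon_eval x (m + n) = mon_eval x m * mon_eval x n"
proof -
  let ?S = "keys m \<union> keys n"
  have "mon_eval x (m + n) = (\<Prod>v\<in>?S. x v ^ lookup (m + n) v)"
    by (rule mon_eval_superset) (auto simp: Poly_Mapping.keys_add)
  also have "\<dots> = (\<Prod>v\<in>?S. x v ^ lookup m v) * (\<Prod>v\<in>?S. x v ^ lookup n v)"
    by (simp add: lookup_add power_add prod.distrib)
  also have "\<dots> = mon_eval x m * mon_eval x n"
    by (subst (1 2) mon_eval_superset[where S = ?S]) auto
  finally show ?thesis .
qed

lemma mon_degree_superset:
  assumes "finite S" "keys m \<subseteq> S"
  shows "mon_degree m = (\<Sum>v\<in>S. lookup m v)"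
  unfolding mon_degree_def
  by (rule sum.mono_neutral_left) (use assms in \<open>auto simp: in_keys_iff\<close>)

lemma mon_degree_add: "mon_degree (m + n) = mon_degree m + mon_degree n"
proof -
  let ?S = "keys m \<union> keys n"
  have "mon_degree (m + n) = (\<Sum>v\<in>?S. lookup (m + n) v)"
    by (rule mon_degree_superset) (auto simp: Poly_Mapping.keys_add)
  also have "\<dots> = (\<Sum>v\<in>?S. lookup m v) + (\<Sum>v\<in>?S. lookup n v)"
    by (simp add: lookup_add sum.distrib)
  also have "\<dots> = mon_degree m + mon_degree n"
    by (subst (1 2) mon_degree_superset[where S = ?S]) auto
  finally show ?thesis .
qed

lemma mon_degree_zero [simp]: "mon_degree 0 = 0"
  by (simp add: mon_degree_def)

lemma mon_degree_single [simp]: "mon_degree (single v n) = n"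
  by (simp add: mon_degree_def)

lemma meval_superset:
  assumes "finite S" "keys p \<subseteq> S"
  shows "meval x p = (\<Sum>m\<in>S. lookup p m * mon_eval x m)"
  unfolding meval_def
  by (rule sum.mono_neutral_left) (use assms in \<open>auto simp: in_keys_iff\<close>)

lemma meval_zero [simp]: "meval x 0 = 0"
  by (simp add: meval_def)

lemma meval_single: "meval x (single m c) = c * mon_eval x m"
  by (cases "c = 0") (simp_all add: meval_def)

lemma meval_one [simp]: "meval x 1 = 1"
  using meval_single[of x 0 1] by simp

lemma meval_add: "meval x (p + q) = meval x p + meval x q"
proof -
  let ?S = "keys p \<union> keys q"
  have "meval x (p + q) = (\<Sum>m\<in>?S. lookup (p + q) m * mon_eval x m)"
    by (rule meval_superset) (auto simp: Poly_Mapping.keys_add)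
  also have "\<dots> = (\<Sum>m\<in>?S. lookup p m * mon_eval x m)
      + (\<Sum>m\<in>?S. lookup q m * mon_eval x m)"
    by (simp add: lookup_add distrib_right sum.distrib)
  also have "\<dots> = meval x p + meval x q"
    by (subst (1 2) meval_superset[where S = ?S]) auto
  finally show ?thesis .
qed

lemma meval_sum: "meval x (sum f A) = (\<Sum>i\<in>A. meval x (f i))"
  by (induction A rule: infinite_finite_induct) (simp_all add: meval_add)

lemma sum_singles: "(\<Sum>m\<in>keys p. single m (lookup p m)) = p"
proof (rule poly_mapping_eqI)
  fix k
  have "(\<Sum>m\<in>keys p. lookup (single m (lookup p m)) k)
     = (\<Sum>m\<in>keys p. if m = k then lookup p m else 0)"
    by (rule sum.cong) (auto simp: lookup_single when_def)
  also have "\<dots> = lookup p k"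
    by (auto simp: in_keys_iff)
  finally show "lookup (\<Sum>m\<in>keys p. single m (lookup p m)) k
      = lookup p k"
    by (simp add: lookup_sum)
qed

lemma meval_mult: "meval x (p * q) = meval x p * meval x q"
proof -
  have "p * q = (\<Sum>m\<in>keys p. single m (lookup p m)) *
      (\<Sum>n\<in>keys q. single n (lookup q n))"
    by (simp only: sum_singles)
  also have "\<dots> = (\<Sum>m\<in>keys p. \<Sum>n\<in>keys q.
      single (m + n) (lookup p m * lookup q n))"
    by (simp add: sum_product mult_single)
  finally have "meval x (p * q) = (\<Sum>m\<in>keys p. \<Sum>n\<in>keys q.
      lookup p m * lookup q n * (mon_eval x m * mon_eval x n))"
    by (simp add: meval_sum meval_single mon_eval_add)
  also have "\<dots> = meval x p * meval x q"
    unfolding meval_def sum_product by (intro sum.cong refl) (simp add: mult_ac)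
  finally show ?thesis .
qed

lemma meval_mscale: "meval x (mscale c p) = c * meval x p"
  by (simp add: mscale_def meval_mult meval_single)

lemma lookup_mscale: "lookup (mscale c p) m = c * lookup p m"
proof -
  have "mscale c p = (\<Sum>k\<in>keys p. single k (c * lookup p k))"
    unfolding mscale_def
    by (subst (1) sum_singles[of p, symmetric]) (simp add: sum_distrib_left mult_single)
  also have "lookup \<dots> m
     = (\<Sum>k\<in>keys p. if k = m then c * lookup p k else 0)"
    unfolding lookup_sum by (rule sum.cong) (auto simp: lookup_single when_def)
  also have "\<dots> = c * lookup p m"
    by (auto simp: in_keys_iff)
  finally show ?thesis .
qed

lemma keys_mscale: "keys (mscale c p) \<subseteq> keys p"
  by (auto simp: in_keys_iff lookup_mscale)

lemma meval_cong:
  assumes "p \<in> mpolys V" "\<And>v. v \<in> V \<Longrightarrow> x v = y v"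
  shows "meval x p = meval y p"
  unfolding meval_def
proof (intro sum.cong prod.cong refl arg_cong2[where f = "(*)"])
  fix m v assume "m \<in> keys p" "v \<in> keys m"
  then have "v \<in> V"
    using assms(1) unfolding mpolys_def by blast
  then show "x v ^ lookup m v = y v ^ lookup m v"
    by (simp add: assms(2))
qed

section \<open>Homogeneous polynomials\<close>

lemma subspace_mpolys: "mp.subspace (mpolys V)"
proof (rule mp.subspaceI)
  show "p + q \<in> mpolys V" if "p \<in> mpolys V" "q \<in> mpolys V" for p q
    using that Poly_Mapping.keys_add[of p q] unfolding mpolys_def by blast
  show "mscale c p \<in> mpolys V" if "p \<in> mpolys V" for c p
    using that keys_mscale[of c p] unfolding mpolys_def by blast
qed (simp add: mpolys_def)

lemma hpolys_add: "p \<in> hpolys V n \<Longrightarrow> q \<in> hpolys V n \<Longrightarrow> p + q \<in> hpolys V n"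
  unfolding hpolys_def mpolys_def using Poly_Mapping.keys_add[of p q] by blast

lemma hpolys_mscale: "p \<in> hpolys V n \<Longrightarrow> mscale c p \<in> hpolys V n"
  unfolding hpolys_def mpolys_def using keys_mscale[of c p] by blast

lemma hpolys_zero [simp]: "0 \<in> hpolys V n"
  by (simp add: hpolys_def mpolys_def)

lemma subspace_hpolys: "mp.subspace (hpolys V n)"
  unfolding mp.subspace_def by (simp add: hpolys_add hpolys_mscale)

lemma hpolys_mpolys: "p \<in> hpolys V n \<Longrightarrow> p \<in> mpolys V"
  by (simp add: hpolys_def)

lemma mpolys_mult:
  assumes *: "p \<in> mpolys V" "q \<in> mpolys V"
  shows "p * q \<in> mpolys V"
proof -
  have "keys m \<subseteq> V" if m: "m \<in> keys (p * q)" for m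
  proof -
    obtain a b where "m = a + b" "a \<in> keys p" "b \<in> keys q"
      using m keys_mult[of p q] by blast
    then show ?thesis
      using * Poly_Mapping.keys_add[of a b] unfolding mpolys_def by blast
  qed
  then show ?thesis by (simp add: mpolys_def)
qed

lemma hpolys_mult:
  assumes "p \<in> hpolys V a" "q \<in> hpolys V b"
  shows "p * q \<in> hpolys V (a + b)"
proof -
  have "mon_degree m = a + b" if m: "m \<in> keys (p * q)" for m
  proof -
    obtain u v where "m = u + v" "u \<in> keys p" "v \<in> keys q"
      using m keys_mult[of p q] by blast
    then show ?thesis using assms by (simp add: hpolys_def mon_degree_add)
  qed
  then show ?thesis
    using assms mpolys_mult[of p V q] by (auto simp: hpolys_def)
qed

lemma hpolys_single:
  assumes "keys m \<subseteq> V" "mon_degree m = n"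
  shows "single m c \<in> hpolys V n"
  using assms by (auto simp: hpolys_def mpolys_def split: if_splits)

lemma meval_homogeneous:
  assumes "p \<in> hpolys V n"
  shows "meval (\<lambda>v. c * x v) p = c ^ n * meval x p"
proof -
  have "mon_eval (\<lambda>v. c * x v) m = c ^ n * mon_eval x m" if "m \<in> keys p" for m
  proof -
    have "(\<Prod>v\<in>keys m. c ^ lookup m v) = c ^ n"
      using that assms by (simp add: power_sum[symmetric] hpolys_def mon_degree_def)
    then show ?thesis
      by (simp add: power_mult_distrib prod.distrib)
  qed
  then show ?thesis
    unfolding meval_def by (simp add: sum_distrib_left mult_ac cong: sum.cong)
qed

text \<open>Forms of degree \<open>n\<close> as functions, which spares exhibiting the polynomial.\<close>

definition form_fun :: "'v set \<Rightarrow> nat \<Rightarrow> (('v \<Rightarrow> 'a::field) \<Rightarrow> 'a) \<Rightarrow> bool" where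
  "form_fun V n F \<longleftrightarrow> (\<exists>p\<in>hpolys V n. \<forall>x. F x = meval x p)"

lemma form_fun_meval: "p \<in> hpolys V n \<Longrightarrow> form_fun V n (\<lambda>x. meval x p)"
  by (auto simp: form_fun_def)

lemma form_fun_zero: "form_fun V n (\<lambda>_. 0)"
  unfolding form_fun_def by (rule bexI[of _ 0]) auto

lemma form_fun_const: "form_fun V 0 (\<lambda>_. c)"
  unfolding form_fun_def
  by (rule bexI[of _ "single 0 c"]) (auto simp: meval_single intro: hpolys_single)

lemma form_fun_var: "v \<in> V \<Longrightarrow> form_fun V 1 (\<lambda>x. x v)"
  unfolding form_fun_def
  by (rule bexI[of _ "single (single v 1) 1"])
    (auto simp: meval_single intro!: hpolys_single)

lemma form_fun_add: "form_fun V n F \<Longrightarrow> form_fun V n G \<Longrightarrow> form_fun V n (\<lambda>x. F x + G x)"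
proof (unfold form_fun_def, elim bexE)
  fix p q assume "p \<in> hpolys V n" "\<forall>x. F x = meval x p" "q \<in> hpolys V n" "\<forall>x. G x = meval x q"
  then show "\<exists>p\<in>hpolys V n. \<forall>x. F x + G x = meval x p"
    by (intro bexI[of _ "p + q"]) (simp_all add: meval_add hpolys_add)
qed

lemma form_fun_mult: "form_fun V a F \<Longrightarrow> form_fun V b G \<Longrightarrow> form_fun V (a + b) (\<lambda>x. F x * G x)"
proof (unfold form_fun_def, elim bexE)
  fix p q assume "p \<in> hpolys V a" "\<forall>x. F x = meval x p" "q \<in> hpolys V b" "\<forall>x. G x = meval x q"
  then show "\<exists>p\<in>hpolys V (a + b). \<forall>x. F x * G x = meval x p"
    by (intro bexI[of _ "p * q"]) (simp_all add: meval_mult hpolys_mult)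
qed

lemma form_fun_cmult: "form_fun V n F \<Longrightarrow> form_fun V n (\<lambda>x. c * F x)"
  using form_fun_mult[OF form_fun_const] by force

lemma form_fun_sum: "(\<And>i. i \<in> A \<Longrightarrow> form_fun V n (F i)) \<Longrightarrow> form_fun V n (\<lambda>x. \<Sum>i\<in>A. F i x)"
  by (induction A rule: infinite_finite_induct) (auto intro: form_fun_zero form_fun_add)

lemma form_fun_prod:
  "(\<And>i. i \<in> A \<Longrightarrow> form_fun V n (F i)) \<Longrightarrow> form_fun V (n * card A) (\<lambda>x. \<Prod>i\<in>A. F i x)"
proof (induction A rule: infinite_finite_induct)
  case (insert a A)
  then have "form_fun V (n + n * card A) (\<lambda>x. F a x * (\<Prod>i\<in>A. F i x))"
    by (intro form_fun_mult) auto
  with insert show ?case by simp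
qed (simp_all add: form_fun_const)

lemma form_fun_power: "form_fun V n F \<Longrightarrow> form_fun V (n * b) (\<lambda>x. F x ^ b)"
  using form_fun_prod[of "{..<b}" V n "\<lambda>_. F"] by simp

lemma det_mat_expand:
  "det (mat n n (\<lambda>(i, j). f i j)) = (\<Sum>p | p permutes {0..<n}. signof p * (\<Prod>i = 0..<n. f i (p i)))"
  by (subst det_def') (auto intro!: sum.cong prod.cong simp: permutes_in_image)

lemma form_fun_det:
  assumes "\<And>i j. i < n \<Longrightarrow> j < n \<Longrightarrow> form_fun V a (F i j)"
  shows "form_fun V (a * n) (\<lambda>x. det (mat n n (\<lambda>(i, j). F i j x)))"
  unfolding det_mat_expand
proof (intro form_fun_sum form_fun_cmult)
  fix p assume "p \<in> {p. p permutes {0..<n}}"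
  then have "form_fun V (a * card {0..<n}) (\<lambda>x. \<Prod>i = 0..<n. F i (p i) x)"
    using permutes_in_image[of p "{0..<n}"] by (intro form_fun_prod assms) auto
  then show "form_fun V (a * n) (\<lambda>x. \<Prod>i = 0..<n. F i (p i) x)" by simp
qed

lemma form_fun_homogeneous: "form_fun V n F \<Longrightarrow> F (\<lambda>v. c * x v) = c ^ n * F x"
  unfolding form_fun_def using meval_homogeneous by fastforce

section \<open>Dimensions of subspaces of finite dimension\<close>

context vector_space
begin

text \<open>The spaces of all polynomials and of all functions have infinite dimension, where
  \<open>dim\<close> is the cardinality 0 of an infinite basis. Hence the facts on dimensions carry
  a finite set \<open>B\<close> whose span contains the subspaces.\<close>

lemma finite_basis_exists:
  assumes "S \<subseteq> span B" "finite B"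
  obtains C where "C \<subseteq> S" "independent C" "finite C" "S \<subseteq> span C" "card C = dim S"
proof -
  obtain C where C: "C \<subseteq> S" "independent C" "S \<subseteq> span C" "card C = dim S"
    using basis_exists by blast
  have "finite C"
    using independent_span_bound[OF assms(2) C(2)] C(1) assms(1) by blast
  with C that show thesis by blast
qed

lemma independent_card_le_dim:
  assumes "C \<subseteq> S" "independent C" "S \<subseteq> span B" "finite B"
  shows "finite C" "card C \<le> dim S"
proof -
  obtain D where D: "D \<subseteq> S" "independent D" "finite D" "S \<subseteq> span D" "card D = dim S"
    using finite_basis_exists[OF assms(3,4)] .
  have "C \<subseteq> span D" using assms(1) D(4) by blast
  from independent_span_bound[OF D(3) assms(2) this] D(5)
  show "finite C" "card C \<le> dim S" by auto
qed

lemma dim_mono_finite: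
  assumes "S \<subseteq> T" "T \<subseteq> span B" "finite B"
  shows "dim S \<le> dim T"
proof -
  obtain C where C: "C \<subseteq> S" "independent C" "S \<subseteq> span C" "card C = dim S"
    using basis_exists by blast
  have "C \<subseteq> T" using C(1) assms(1) by blast
  from independent_card_le_dim(2)[OF this C(2) assms(2,3)] C(4) show ?thesis by simp
qed

lemma dim_Suc_le:
  assumes "subspace S" "S \<subseteq> T" "x \<in> T" "x \<notin> S" "T \<subseteq> span B" "finite B"
  shows "Suc (dim S) \<le> dim T"
proof -
  obtain C where C: "C \<subseteq> S" "independent C" "finite C" "S \<subseteq> span C" "card C = dim S"
    using finite_basis_exists[of S B] assms by blast
  have "x \<notin> span C"
    using assms(1,4) C(1) span_minimal by blast
  then have "independent (insert x C)" "x \<notin> C"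
    using C(2) independent_insertI span_superset by blast+
  then show ?thesis
    using independent_card_le_dim(2)[of "insert x C" T B] C assms by auto
qed

lemma subspace_eqI_dim:
  assumes "subspace S" "S \<subseteq> T" "dim T \<le> dim S" "T \<subseteq> span B" "finite B"
  shows "S = T"
  using dim_Suc_le[OF assms(1,2) _ _ assms(4,5)] assms(2,3) by fastforce

lemma dim_zero [simp]: "dim {0} = 0"
  using dim_le_card[of "{0}" "{}"] by simp

lemma dim_pos_imp_nonzero:
  assumes "dim S > 0"
  obtains x where "x \<in> S" "x \<noteq> 0"
proof (cases "S \<subseteq> {0}")
  case True
  then show ?thesis using dim_le_card[of S "{}"] assms by simp
qed (use that in blast)

end

section \<open>Rank and nullity on finite-dimensional subspaces\<close>

context vector_space_pair
begin

text \<open>A basis \<open>C\<close> of the kernel is extended to a basis \<open>D\<close> of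
  \<open>S\<close>. The map is injective on the span of \<open>D - C\<close>, so the images of
  \<open>D - C\<close> form a basis of the image.\<close>

lemma rank_nullity:
  assumes f: "Vector_Spaces.linear s1 s2 f" and S: "vs1.subspace S" "S \<subseteq> vs1.span B" "finite B"
  shows "vs1.dim S = vs1.dim {x \<in> S. f x = 0} + vs2.dim (f ` S)"
proof -
  interpret f: Vector_Spaces.linear s1 s2 f by (rule f)
  let ?K = "{x \<in> S. f x = 0}"
  have K: "vs1.subspace ?K"
    using S(1) unfolding vs1.subspace_def by (auto simp: f.add f.scale)
  obtain C where C: "C \<subseteq> ?K" "vs1.independent C" "finite C" "?K \<subseteq> vs1.span C" "card C = vs1.dim ?K"
    using vs1.finite_basis_exists[of ?K B] S by blast
  obtain D where D: "C \<subseteq> D" "D \<subseteq> S" "vs1.independent D" "S \<subseteq> vs1.span D"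
    using vs1.maximal_independent_subset_extend[of C S] C by blast
  have D': "finite D" "card D = vs1.dim S"
    using vs1.independent_card_le_dim[OF D(2,3) S(2,3)] vs1.basis_card_eq_dim[OF D(2,4,3)] by auto
  let ?E = "D - C"
  have inj0: "x = 0" if x: "x \<in> vs1.span ?E" "f x = 0" for x
  proof -
    have "vs1.span ?E \<subseteq> S" by (rule vs1.span_minimal) (use D(2) S(1) in auto)
    then have xC: "x \<in> vs1.span C" using x C(4) by blast
    \<comment> \<open>\<open>x\<close> lies in the spans of \<open>C\<close> and of
      \<open>D - C\<close>; its coordinates with respect to \<open>D\<close> are supported on both
      sets, so they all vanish.\<close>
    have "vs1.representation C x = vs1.representation ?E x"
      using vs1.representation_extend[OF D(3) xC D(1)] vs1.representation_extend[OF D(3) x(1)] by simp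
    then have "vs1.representation C x b = 0" for b
      using vs1.representation_ne_zero[of C x b] vs1.representation_ne_zero[of ?E x b] by force
    then show ?thesis
      using vs1.sum_nonzero_representation_eq[OF C(2) xC] by simp
  qed
  have inj: "inj_on f (vs1.span ?E)"
    using inj0 f.inj_on_iff_eq_0[OF vs1.subspace_span] by blast
  have "vs2.independent (f ` ?E)"
    using D(3) vs1.independent_mono[of D ?E] f.independent_injective_image[OF _ inj] by blast
  moreover have "f ` S \<subseteq> vs2.span (f ` ?E)"
  proof -
    have "f ` S \<subseteq> vs2.span (f ` D)"
      using D(4) f.span_image by blast
    also have "f ` D \<subseteq> insert 0 (f ` ?E)" using C(1) by auto
    then have "vs2.span (f ` D) \<subseteq> vs2.span (f ` ?E)"
      using vs2.span_mono vs2.span_insert_0 by blast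
    finally show ?thesis .
  qed
  moreover have "f ` ?E \<subseteq> f ` S" using D(2) by blast
  ultimately have "vs2.dim (f ` S) = card (f ` ?E)"
    using vs2.basis_card_eq_dim by metis
  also have "\<dots> = card ?E"
    using inj inj_on_subset[OF inj vs1.span_superset] card_image by blast
  also have "\<dots> = vs1.dim S - vs1.dim ?K"
    using C D D' by (simp add: card_Diff_subset)
  finally show ?thesis
    using vs1.dim_mono_finite[of ?K S B] S by auto
qed

lemma dim_image_injective:
  assumes f: "Vector_Spaces.linear s1 s2 f" and S: "vs1.subspace S" "S \<subseteq> vs1.span B" "finite B"
    and "\<And>x. x \<in> S \<Longrightarrow> f x = 0 \<Longrightarrow> x = 0"
  shows "vs2.dim (f ` S) = vs1.dim S"
proof -
  have "{x \<in> S. f x = 0} \<subseteq> {0}" using assms by auto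
  then have "vs1.dim {x \<in> S. f x = 0} = 0"
    using vs1.dim_le_card[of "{x \<in> S. f x = 0}" "{}"] by auto
  then show ?thesis using rank_nullity[OF f S] by simp
qed

lemma kernel_dim_ge:
  assumes f: "Vector_Spaces.linear s1 s2 f" and S: "vs1.subspace S" "S \<subseteq> vs1.span B" "finite B"
    and "f ` S \<subseteq> vs2.span C" "finite C"
  shows "vs1.dim S \<le> vs1.dim {x \<in> S. f x = 0} + card C"
  using rank_nullity[OF f S] vs2.dim_le_card[OF assms(5,6)] by simp

end

text \<open>Two ways of evaluating the same vectors are compared through their kernels alone, so no
  map between the two targets has to be constructed.\<close>

lemma dim_image_le_of_kernel:
  assumes "vector_space_pair s1 s2" "vector_space_pair s1 s3"
    and f: "Vector_Spaces.linear s1 s2 f" and g: "Vector_Spaces.linear s1 s3 g"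
    and S: "module.subspace s1 S" "S \<subseteq> module.span s1 B" "finite B"
    and ker: "\<And>x. x \<in> S \<Longrightarrow> g x = 0 \<Longrightarrow> f x = 0"
  shows "vector_space.dim s2 (f ` S) \<le> vector_space.dim s3 (g ` S)"
proof -
  interpret p: vector_space_pair s1 s2 by fact
  interpret q: vector_space_pair s1 s3 by fact
  have "p.vs1.dim {x \<in> S. g x = 0} \<le> p.vs1.dim {x \<in> S. f x = 0}"
    by (rule p.vs1.dim_mono_finite[of _ _ B]) (use S ker in auto)
  then show ?thesis
    using p.rank_nullity[OF f S] q.rank_nullity[OF g S] by simp
qed

section \<open>Spaces of functions and of univariate polynomials\<close>

definition fscale :: "'a::field \<Rightarrow> ('b \<Rightarrow> 'a) \<Rightarrow> 'b \<Rightarrow> 'a" where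
  "fscale c f = (\<lambda>x. c * f x)"

interpretation fs: vector_space "fscale :: 'a::field \<Rightarrow> ('b \<Rightarrow> 'a) \<Rightarrow> 'b \<Rightarrow> 'a"
  by unfold_locales (auto simp: fscale_def fun_eq_iff algebra_simps)

interpretation pl: vector_space "smult :: 'a::field \<Rightarrow> 'a poly \<Rightarrow> 'a poly"
  by unfold_locales (auto simp: smult_add_right smult_add_left)

lemma sum_fun_apply: "sum f A x = (\<Sum>i\<in>A. f i (x :: 'b) :: 'a::comm_monoid_add)"
  by (induction A rule: infinite_finite_induct) simp_all

lemma linearI:
  assumes "vector_space s1" "vector_space s2"
    and "\<And>x y. f (x + y) = f x + f y" "\<And>c x. f (s1 c x) = s2 c (f x)"
  shows "Vector_Spaces.linear s1 s2 f"
  using assms by (simp add: Vector_Spaces.linear_iff)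

lemma mp_fs: "vector_space_pair mscale fscale"
  by (simp add: vector_space_pair_def mp.vector_space_axioms fs.vector_space_axioms)

lemma mp_pl: "vector_space_pair mscale smult"
  by (simp add: vector_space_pair_def mp.vector_space_axioms pl.vector_space_axioms)

lemma pl_fs: "vector_space_pair smult fscale"
  by (simp add: vector_space_pair_def pl.vector_space_axioms fs.vector_space_axioms)

lemma fs_fs: "vector_space_pair fscale fscale"
  by (simp add: vector_space_pair_def fs.vector_space_axioms)

definition polys_le :: "nat \<Rightarrow> 'a::field poly set" where
  "polys_le n = {p. degree p \<le> n}"

lemma subspace_polys_le: "pl.subspace (polys_le n)"
  unfolding pl.subspace_def polys_le_def
  by (auto intro: degree_add_le order_trans[OF degree_smult_le])

lemma polys_le_span: "polys_le n = pl.span (monom (1::'a::field) ` {..n})"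
proof
  show "polys_le n \<subseteq> pl.span (monom (1::'a) ` {..n})"
  proof
    fix p :: "'a poly" assume "p \<in> polys_le n"
    then have "p = (\<Sum>i\<le>n. smult (coeff p i) (monom 1 i))"
      by (subst poly_as_sum_of_monoms'[symmetric, of p n]) (auto simp: polys_le_def smult_monom)
    also have "\<dots> \<in> pl.span (monom 1 ` {..n})"
      by (intro pl.span_sum pl.span_scale pl.span_base) auto
    finally show "p \<in> pl.span (monom 1 ` {..n})" .
  qed
  show "pl.span (monom (1::'a) ` {..n}) \<subseteq> polys_le n"
    by (rule pl.span_minimal[OF _ subspace_polys_le]) (auto simp: polys_le_def degree_monom_eq)
qed

lemma polys_le_finite_span:
  "polys_le n \<subseteq> pl.span (monom (1::'a::field) ` {..n})"
  "finite (monom (1::'a::field) ` {..n})"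
  by (simp_all only: polys_le_span) auto

lemma dim_polys_le: "pl.dim (polys_le n :: 'a::field poly set) = Suc n"
proof -
  have "pl.dim (polys_le n :: 'a poly set) \<le> Suc n" for n
  proof -
    have "pl.dim (polys_le n :: 'a poly set) \<le> card (monom (1::'a) ` {..n})"
      by (rule pl.dim_le_card[OF polys_le_finite_span])
    also have "\<dots> \<le> card {..n}" by (rule card_image_le) simp
    finally show ?thesis by simp
  qed
  moreover have "Suc n \<le> pl.dim (polys_le n :: 'a poly set)"
  proof (induction n)
    case 0
    have "Suc (pl.dim {0 :: 'a poly}) \<le> pl.dim (polys_le 0 :: 'a poly set)"
      by (rule pl.dim_Suc_le[OF _ _ _ _ polys_le_finite_span, where x = 1]) (auto simp: polys_le_def)
    then show ?case by simp
  next
    case (Suc n)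
    have "Suc (pl.dim (polys_le n :: 'a poly set)) \<le> pl.dim (polys_le (Suc n) :: 'a poly set)"
      by (rule pl.dim_Suc_le[OF subspace_polys_le _ _ _ polys_le_finite_span, where x = "monom 1 (Suc n)"])
        (auto simp: polys_le_def degree_monom_eq)
    then show ?case using Suc by simp
  qed
  ultimately show ?thesis by (simp add: le_antisym)
qed

lemma hpolys_finite_span:
  assumes "finite V"
  shows "\<exists>B. finite B \<and> (hpolys V n :: ('v, 'a::field) mpoly set) \<subseteq> mp.span B"
proof -
  define M where "M = {m :: 'v \<Rightarrow>\<^sub>0 nat. keys m \<subseteq> V \<and> mon_degree m = n}"
  have "inj_on (\<lambda>m. restrict (lookup m) V) M"
  proof (rule inj_onI, rule poly_mapping_eqI)
    fix m m' k assume *: "m \<in> M" "m' \<in> M"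
      "restrict (lookup m) V = restrict (lookup m') V"
    show "lookup m k = lookup m' k"
    proof (cases "k \<in> V")
      case True
      then show ?thesis using fun_cong[OF *(3), of k] by simp
    next
      case False
      then have "k \<notin> keys m" "k \<notin> keys m'" using * by (auto simp: M_def)
      then show ?thesis by (simp add: in_keys_iff)
    qed
  qed
  moreover have "(\<lambda>m. restrict (lookup m) V) ` M \<subseteq> V \<rightarrow>\<^sub>E {..n}"
  proof (rule image_subsetI)
    fix m assume "m \<in> M"
    then have "lookup m v \<le> n" if "v \<in> V" for v
      using mon_degree_superset[OF assms, of m] member_le_sum[OF that _ assms, of "lookup m"]
      by (auto simp: M_def)
    then show "restrict (lookup m) V \<in> V \<rightarrow>\<^sub>E {..n}" by auto
  qed
  moreover have "finite (V \<rightarrow>\<^sub>E {..n})" using assms by (simp add: finite_PiE)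
  ultimately have "finite M" by (meson finite_imageD finite_subset)
  moreover have "hpolys V n \<subseteq> mp.span ((\<lambda>m. single m (1::'a)) ` M)"
  proof
    fix p :: "('v, 'a) mpoly" assume p: "p \<in> hpolys V n"
    have "single m c = mscale c (single m 1)" for m :: "'v \<Rightarrow>\<^sub>0 nat" and c :: 'a
      by (simp add: mscale_def mult_single)
    then have "(\<Sum>m\<in>keys p. single m (lookup p m))
        = (\<Sum>m\<in>keys p. mscale (lookup p m) (single m 1))"
      by (intro sum.cong refl)
    then have "p = (\<Sum>m\<in>keys p. mscale (lookup p m) (single m 1))"
      by (simp only: sum_singles)
    also have "\<dots> \<in> mp.span ((\<lambda>m. single m (1::'a)) ` M)"
      using p by (intro mp.span_sum mp.span_scale mp.span_base) (auto simp: M_def hpolys_def mpolys_def)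
    finally show "p \<in> mp.span ((\<lambda>m. single m (1::'a)) ` M)" .
  qed
  ultimately show ?thesis by blast
qed

section \<open>Polynomial functions on affine space\<close>

text \<open>\<open>D\<close> bounds the degree in each variable separately.\<close>

abbreviation monomials :: "'v set \<Rightarrow> nat \<Rightarrow> (('v \<Rightarrow> 'a::field) \<Rightarrow> 'a) set" where
  "monomials W D \<equiv> (\<lambda>\<alpha> x. \<Prod>v\<in>W. x v ^ \<alpha> v) ` (W \<rightarrow>\<^sub>E {..D})"

definition poly_funs :: "'v set \<Rightarrow> nat \<Rightarrow> (('v \<Rightarrow> 'a::field) \<Rightarrow> 'a) set" where
  "poly_funs W D = fs.span (monomials W D)"

lemma subspace_poly_funs: "fs.subspace (poly_funs W D)"
  by (simp add: poly_funs_def)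

lemma poly_funs_mono: "D \<le> E \<Longrightarrow> poly_funs W D \<subseteq> poly_funs W E"
  unfolding poly_funs_def by (intro fs.span_mono image_mono PiE_mono) auto

lemma poly_funs_monom:
  assumes "\<And>v. v \<in> W \<Longrightarrow> \<alpha> v \<le> D"
  shows "(\<lambda>x. \<Prod>v\<in>W. x v ^ \<alpha> v) \<in> poly_funs W D"
proof -
  have "(\<lambda>x. \<Prod>v\<in>W. x v ^ \<alpha> v) = (\<lambda>x::'a \<Rightarrow> 'b. \<Prod>v\<in>W. x v ^ restrict \<alpha> W v)"
    by (simp cong: prod.cong)
  moreover have "restrict \<alpha> W \<in> W \<rightarrow>\<^sub>E {..D}" using assms by auto
  ultimately show ?thesis unfolding poly_funs_def by (intro fs.span_base) blast
qed

lemma poly_funs_const: "(\<lambda>_. c) \<in> poly_funs W D"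
  using fs.subspace_scale[OF subspace_poly_funs poly_funs_monom[of W "\<lambda>_. 0" D], of c]
  by (simp add: fscale_def)

lemma poly_funs_var:
  assumes "finite W" "w \<in> W"
  shows "(\<lambda>x :: 'v \<Rightarrow> 'a::field. x w) \<in> poly_funs W 1"
proof -
  have eq: "(\<Prod>v\<in>W. x v ^ (if v = w then 1 else 0)) = x w" for x :: "'v \<Rightarrow> 'a"
  proof -
    have "(\<Prod>v\<in>W. x v ^ (if v = w then 1 else 0)) = (\<Prod>v\<in>W. if v = w then x v else 1)"
      by (rule prod.cong) auto
    then show ?thesis using assms by simp
  qed
  have "(\<lambda>x :: 'v \<Rightarrow> 'a. \<Prod>v\<in>W. x v ^ (if v = w then 1 else 0)) \<in> poly_funs W 1"
    by (rule poly_funs_monom) auto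
  then show ?thesis by (simp only: eq)
qed

lemma poly_funs_add: "f \<in> poly_funs W D \<Longrightarrow> g \<in> poly_funs W D \<Longrightarrow> (\<lambda>x. f x + g x) \<in> poly_funs W D"
  using fs.subspace_add[OF subspace_poly_funs, of f W D g] by (simp add: plus_fun_def)

lemma poly_funs_cmult: "f \<in> poly_funs W D \<Longrightarrow> (\<lambda>x. c * f x) \<in> poly_funs W D"
  using fs.subspace_scale[OF subspace_poly_funs, of f W D c] by (simp add: fscale_def)

lemma poly_funs_sum:
  "(\<And>i. i \<in> A \<Longrightarrow> f i \<in> poly_funs W D) \<Longrightarrow> (\<lambda>x. \<Sum>i\<in>A. f i x) \<in> poly_funs W D"
  by (induction A rule: infinite_finite_induct) (auto intro: poly_funs_const poly_funs_add)

lemma poly_funs_mult: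
  assumes "f \<in> poly_funs W D" "g \<in> poly_funs W E"
  shows "(\<lambda>x. f x * g x) \<in> poly_funs W (D + E)"
proof -
  let ?m = "\<lambda>\<alpha> x. \<Prod>v\<in>W. x v ^ \<alpha> v"
  have mono: "(\<lambda>x. ?m \<alpha> x * g x) \<in> poly_funs W (D + E)" if "\<alpha> \<in> W \<rightarrow>\<^sub>E {..D}" for \<alpha>
    using assms(2)[unfolded poly_funs_def]
  proof (induction g rule: fs.span_induct_alt)
    case base
    then show ?case using poly_funs_const[of 0] by simp
  next
    case (step c h g)
    then obtain \<beta> where \<beta>: "\<beta> \<in> W \<rightarrow>\<^sub>E {..E}" "h = ?m \<beta>" by blast
    have "(\<lambda>x. ?m (\<lambda>v. \<alpha> v + \<beta> v) x) \<in> poly_funs W (D + E)"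
      using that \<beta>(1) by (intro poly_funs_monom) (auto intro: add_mono)
    then have "(\<lambda>x. c * ?m (\<lambda>v. \<alpha> v + \<beta> v) x + ?m \<alpha> x * g x) \<in> poly_funs W (D + E)"
      by (intro poly_funs_add poly_funs_cmult step.IH)
    then show ?case
      by (simp add: \<beta>(2) fscale_def power_add prod.distrib algebra_simps)
  qed
  show ?thesis
    using assms(1)[unfolded poly_funs_def]
  proof (induction f rule: fs.span_induct_alt)
    case base
    then show ?case using poly_funs_const[of 0] by simp
  next
    case (step c h f)
    then obtain \<alpha> where \<alpha>: "\<alpha> \<in> W \<rightarrow>\<^sub>E {..D}" "h = ?m \<alpha>" by blast
    have "(\<lambda>x. c * (?m \<alpha> x * g x) + f x * g x) \<in> poly_funs W (D + E)"
      by (intro poly_funs_add poly_funs_cmult step.IH mono \<alpha>)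
    then show ?case
      by (simp add: \<alpha>(2) fscale_def algebra_simps)
  qed
qed

lemma poly_funs_prod:
  "(\<And>i. i \<in> A \<Longrightarrow> f i \<in> poly_funs W (D i)) \<Longrightarrow> (\<lambda>x. \<Prod>i\<in>A. f i x) \<in> poly_funs W (\<Sum>i\<in>A. D i)"
  by (induction A rule: infinite_finite_induct) (auto intro: poly_funs_const poly_funs_mult)

lemma poly_funs_power: "f \<in> poly_funs W D \<Longrightarrow> (\<lambda>x. f x ^ n) \<in> poly_funs W (n * D)"
  using poly_funs_prod[of "{..<n}" "\<lambda>_. f" W "\<lambda>_. D"] by simp

lemma poly_funs_det:
  assumes "\<And>i j. i < n \<Longrightarrow> j < n \<Longrightarrow> F i j \<in> poly_funs W D"
  shows "(\<lambda>x. det (mat n n (\<lambda>(i, j). F i j x))) \<in> poly_funs W (n * D)"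
  unfolding det_mat_expand
proof (intro poly_funs_sum poly_funs_cmult)
  fix p assume "p \<in> {p. p permutes {0..<n}}"
  then have "(\<lambda>x. \<Prod>i = 0..<n. F i (p i) x) \<in> poly_funs W (\<Sum>i=0..<n. D)"
    using permutes_in_image[of p "{0..<n}"] by (intro poly_funs_prod assms) auto
  then show "(\<lambda>x. \<Prod>i = 0..<n. F i (p i) x) \<in> poly_funs W (n * D)" by simp
qed

text \<open>The bound \<open>n * D\<close> is linear in the degree \<open>n\<close> of the form.
  This turns the count of monomials in a parametrization into a polynomial bound for Hilbert
  functions.\<close>

lemma poly_funs_form:
  assumes "form_fun V n F" "\<And>v. v \<in> V \<Longrightarrow> (\<lambda>x. y x v) \<in> poly_funs W D"
  shows "(\<lambda>x. F (y x)) \<in> poly_funs W (n * D)"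
proof -
  obtain p where p: "p \<in> hpolys V n" and F: "\<And>x. F x = meval x p"
    using assms(1) unfolding form_fun_def by blast
  show ?thesis
    unfolding F meval_def
  proof (intro poly_funs_sum poly_funs_cmult)
    fix m assume m: "m \<in> keys p"
    then have "keys m \<subseteq> V" "mon_degree m = n"
      using p by (auto simp: hpolys_def mpolys_def)
    then have "mon_eval (y x) m = (\<Prod>v\<in>keys m. y x v ^ lookup m v)"
      "(\<Sum>v\<in>keys m. lookup m v * D) = n * D" for x
      by (auto simp: mon_degree_def sum_distrib_right)
    moreover have "(\<lambda>x. mon_eval (y x) m) \<in> poly_funs W (\<Sum>v\<in>keys m. lookup m v * D)"
      by (intro poly_funs_prod poly_funs_power assms(2)) (use \<open>keys m \<subseteq> V\<close> in auto)
    ultimately show "(\<lambda>x. mon_eval (y x) m) \<in> poly_funs W (n * D)" by simp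
  qed
qed

lemma card_monomials_le:
  assumes "finite W"
  shows "finite (monomials W D :: (('v \<Rightarrow> 'a::field) \<Rightarrow> 'a) set)"
    "card (monomials W D :: (('v \<Rightarrow> 'a::field) \<Rightarrow> 'a) set) \<le> Suc D ^ card W"
proof -
  have fin: "finite (W \<rightarrow>\<^sub>E {..D})" using assms by (simp add: finite_PiE)
  then show "finite (monomials W D :: (('v \<Rightarrow> 'a::field) \<Rightarrow> 'a) set)" by simp
  show "card (monomials W D :: (('v \<Rightarrow> 'a::field) \<Rightarrow> 'a) set) \<le> Suc D ^ card W"
    using card_image_le[OF fin] assms by (simp add: card_PiE)
qed

lemma poly_funs_line:
  assumes "f \<in> poly_funs W D"
  obtains q where "\<And>\<tau>. f (\<lambda>v. a v + \<tau> * (b v - a v)) = poly q \<tau>"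
proof -
  have "\<exists>q. \<forall>\<tau>. f (\<lambda>v. a v + \<tau> * (b v - a v)) = poly q \<tau>"
    using assms[unfolded poly_funs_def]
  proof (induction f rule: fs.span_induct_alt)
    case base
    show ?case by (rule exI[of _ 0]) simp
  next
    case (step c h f)
    then obtain \<alpha> where \<alpha>: "h = (\<lambda>x. \<Prod>v\<in>W. x v ^ \<alpha> v)" by blast
    obtain q where q: "\<forall>\<tau>. f (\<lambda>v. a v + \<tau> * (b v - a v)) = poly q \<tau>" using step.IH by blast
    show ?case
      by (rule exI[of _ "smult c (\<Prod>v\<in>W. [:a v, b v - a v:] ^ \<alpha> v) + q"])
        (simp add: \<alpha> q fscale_def poly_prod)
  qed
  then show thesis using that by blast
qed

text \<open>Over an infinite field, joining two points by a line reduces to univariate polynomials.\<close>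

lemma poly_funs_mult_nonzero:
  fixes f :: "('v \<Rightarrow> 'a::field_char_0) \<Rightarrow> 'a"
  assumes "f \<in> poly_funs W D" "g \<in> poly_funs W E" "f a \<noteq> 0" "g b \<noteq> 0"
  obtains \<tau> where "f (\<lambda>v. a v + \<tau> * (b v - a v)) * g (\<lambda>v. a v + \<tau> * (b v - a v)) \<noteq> 0"
proof -
  obtain p where p: "\<And>\<tau>. f (\<lambda>v. a v + \<tau> * (b v - a v)) = poly p \<tau>"
    using poly_funs_line[OF assms(1)] by metis
  obtain q where q: "\<And>\<tau>. g (\<lambda>v. a v + \<tau> * (b v - a v)) = poly q \<tau>"
    using poly_funs_line[OF assms(2)] by metis
  have "poly p 0 \<noteq> 0" "poly q 1 \<noteq> 0"
    using assms(3,4) p[of 0] q[of 1] by auto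
  then have "p * q \<noteq> 0" by auto
  then obtain \<tau> where "poly (p * q) \<tau> \<noteq> 0"
    using poly_eq_poly_eq_iff[of "p * q" 0] by fastforce
  then show thesis using that[of \<tau>] p q by simp
qed

section \<open>Coordinates of binary forms\<close>

text \<open>
  In the coordinates dual to the divided powers, the rational normal curve is
  \<open>(x\<^sup>i)\<^sub>i\<close> and apolarity is a linear recurrence with constant coefficients.
\<close>

definition dcoeff :: "nat \<Rightarrow> (nat, 'a::field) mpoly \<Rightarrow> nat \<Rightarrow> 'a" where
  "dcoeff d v i = form_coeff d v i / of_nat (d choose i)"

definition form_of :: "nat \<Rightarrow> (nat \<Rightarrow> 'a) \<Rightarrow> (nat, 'a::field) mpoly" where
  "form_of d a = (\<Sum>i\<le>d. single (single 1 i + single 2 (d - i))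
     (of_nat (d choose i) * a i))"

lemma form_coeff_add: "form_coeff d (v + w) i = form_coeff d v i + form_coeff d w i"
  by (simp add: form_coeff_def lookup_add)

lemma form_coeff_mscale: "form_coeff d (mscale c v) i = c * form_coeff d v i"
  by (simp add: form_coeff_def lookup_mscale)

lemma dcoeff_zero [simp]: "dcoeff d 0 i = 0"
  by (simp add: dcoeff_def form_coeff_def)

lemma dcoeff_add: "dcoeff d (v + w) i = dcoeff d v i + dcoeff d w i"
  by (simp add: dcoeff_def form_coeff_add add_divide_distrib)

lemma dcoeff_mscale: "dcoeff d (mscale c v) i = c * dcoeff d v i"
  by (simp add: dcoeff_def form_coeff_mscale)

lemma dcoeff_sum: "dcoeff d (sum f A) i = (\<Sum>x\<in>A. dcoeff d (f x) i)"
  by (induction A rule: infinite_finite_induct) (simp_all add: dcoeff_add)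

lemma binary_monomial_inject:
  assumes "single (1::nat) i + single 2 k
    = single 1 i' + single 2 k'"
  shows "i = (i' :: nat)"
  using arg_cong[OF assms, of "\<lambda>m. lookup m 1"]
  by (simp add: lookup_add lookup_single)

lemma binary_monomial_cases:
  assumes "keys m \<subseteq> {1, 2 :: nat}" "mon_degree m = d"
  obtains i where "i \<le> d" "m = single 1 i + single 2 (d - i)"
proof
  have d: "d = lookup m 1 + lookup m 2"
    using assms mon_degree_superset[of "{1, 2}" m] by simp
  then show "lookup m 1 \<le> d" by simp
  show "m = single 1 (lookup m 1)
      + single 2 (d - lookup m 1)"
  proof (rule poly_mapping_eqI)
    fix k
    show "lookup m k = lookup (single 1 (lookup m 1)
      + single 2 (d - lookup m 1)) k"
      using assms(1) by (cases "k \<in> {1, 2}") (auto simp: d lookup_add lookup_single in_keys_iff)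
  qed
qed

lemma form_of_in_binary_forms: "form_of d a \<in> binary_forms d"
  unfolding form_of_def binary_forms_def
  by (intro mp.subspace_sum[OF subspace_hpolys] hpolys_single)
    (auto simp: mon_degree_add dest: subsetD[OF Poly_Mapping.keys_add] split: if_splits)

lemma form_coeff_form_of:
  assumes "i \<le> d"
  shows "form_coeff d (form_of d a) i = of_nat (d choose i) * a i"
proof -
  have "form_coeff d (form_of d a) i = (\<Sum>k\<le>d. if k = i then of_nat (d choose k) * a k else 0)"
    unfolding form_coeff_def form_of_def lookup_sum
    by (rule sum.cong) (auto simp: lookup_single when_def dest!: binary_monomial_inject[unfolded One_nat_def])
  then show ?thesis using assms by simp
qed

lemma dcoeff_form_of:
  "i \<le> d \<Longrightarrow> dcoeff d (form_of d (a :: nat \<Rightarrow> 'a::field_char_0)) i = a i"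
  by (simp add: dcoeff_def form_coeff_form_of)

lemma binary_forms_eqI:
  fixes v w :: "(nat, 'a::field_char_0) mpoly"
  assumes "v \<in> binary_forms d" "w \<in> binary_forms d" "\<And>i. i \<le> d \<Longrightarrow> dcoeff d v i = dcoeff d w i"
  shows "v = w"
proof (rule poly_mapping_eqI)
  fix m
  show "lookup v m = lookup w m"
  proof (cases "keys m \<subseteq> {1, 2} \<and> mon_degree m = d")
    case True
    then obtain i where "i \<le> d" "m = single 1 i + single 2 (d - i)"
      using binary_monomial_cases by blast
    then show ?thesis
      using assms(3)[of i] by (simp add: dcoeff_def form_coeff_def)
  next
    case False
    then have "m \<notin> keys v" "m \<notin> keys w"
      using assms(1,2) by (auto simp: binary_forms_def hpolys_def mpolys_def)
    then show ?thesis by (simp add: in_keys_iff)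
  qed
qed

lemma form_of_dcoeff:
  "v \<in> binary_forms d \<Longrightarrow> form_of d (dcoeff d v) = (v :: (nat, 'a::field_char_0) mpoly)"
  by (rule binary_forms_eqI[OF form_of_in_binary_forms]) (simp_all add: dcoeff_form_of)

lemma subspace_binary_forms: "mp.subspace (binary_forms d)"
  by (simp add: binary_forms_def subspace_hpolys)

text \<open>\<open>dual_family\<close> and \<open>separated_by\<close> together describe a reduced
  echelon basis with pivot columns \<open>P\<close>: the first puts the identity matrix into these
  columns, the second says that the vectors of a subspace \<Lambda> are determined by them.\<close>

definition dual_family :: "nat \<Rightarrow> nat set \<Rightarrow> (nat \<Rightarrow> (nat, 'a::field) mpoly) \<Rightarrow> bool" where
  "dual_family d P b \<longleftrightarrow> (\<forall>p\<in>P. \<forall>q\<in>P. dcoeff d (b p) q = (if p = q then 1 else 0))"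

definition separated_by :: "nat \<Rightarrow> nat set \<Rightarrow> (nat, 'a::field) mpoly set \<Rightarrow> bool" where
  "separated_by d P \<Lambda> \<longleftrightarrow> (\<forall>v\<in>\<Lambda>. (\<forall>p\<in>P. dcoeff d v p = 0) \<longrightarrow> v = 0)"

lemma dual_family_inj: "dual_family d P b \<Longrightarrow> inj_on b P"
  by (rule inj_onI) (metis dual_family_def zero_neq_one)

lemma dual_family_independent:
  assumes "finite P" "dual_family d P b"
  shows "mp.independent (b ` P)"
proof (rule mp.independent_if_scalars_zero)
  show "finite (b ` P)" using assms(1) by simp
  fix f x assume *: "(\<Sum>x\<in>b ` P. mscale (f x) x) = 0" "x \<in> b ` P"
  then obtain p where p: "p \<in> P" "x = b p" by blast
  have "0 = dcoeff d (\<Sum>x\<in>b ` P. mscale (f x) x) p"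
    using * by simp
  also have "\<dots> = (\<Sum>q\<in>P. f (b q) * dcoeff d (b q) p)"
    by (simp add: sum.reindex dual_family_inj[OF assms(2)] dcoeff_sum dcoeff_mscale)
  also have "\<dots> = (\<Sum>q\<in>P. if q = p then f (b q) else 0)"
    using assms(2) p by (intro sum.cong) (auto simp: dual_family_def)
  also have "\<dots> = f x" using p assms(1) by simp
  finally show "f x = 0" by simp
qed

lemma dual_family_expansion:
  assumes "finite P" "dual_family d P b" "b ` P \<subseteq> \<Lambda>" "mp.subspace \<Lambda>" "separated_by d P \<Lambda>" "v \<in> \<Lambda>"
  shows "v = (\<Sum>p\<in>P. mscale (dcoeff d v p) (b p))"
proof -
  let ?w = "\<Sum>p\<in>P. mscale (dcoeff d v p) (b p)"
  have "?w \<in> \<Lambda>" using assms by (intro mp.subspace_sum mp.subspace_scale) auto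
  then have "v - ?w \<in> \<Lambda>" using assms mp.subspace_diff by blast
  moreover have "dcoeff d (v - ?w) q = 0" if "q \<in> P" for q
  proof -
    have "dcoeff d ?w q = (\<Sum>p\<in>P. if p = q then dcoeff d v p else 0)"
      unfolding dcoeff_sum dcoeff_mscale using assms(2) that
      by (intro sum.cong) (auto simp: dual_family_def)
    then have "dcoeff d ?w q = dcoeff d v q" using that assms(1) by simp
    then show ?thesis using dcoeff_add[of d "v - ?w" ?w q] by simp
  qed
  ultimately show ?thesis using assms(5) by (auto simp: separated_by_def)
qed

lemma dual_family_basis:
  assumes "finite P" "dual_family d P b" "b ` P \<subseteq> \<Lambda>" "mp.subspace \<Lambda>" "separated_by d P \<Lambda>"
  shows "mp.span (b ` P) = \<Lambda>" "mp.dim \<Lambda> = card P"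
proof -
  have "v \<in> mp.span (b ` P)" if "v \<in> \<Lambda>" for v
    by (subst dual_family_expansion[OF assms that]) (intro mp.span_sum mp.span_scale mp.span_base imageI)
  then show "mp.span (b ` P) = \<Lambda>"
    using mp.span_minimal[OF assms(3,4)] by blast
  then show "mp.dim \<Lambda> = card P"
    using mp.dim_span_eq_card_independent[OF dual_family_independent[OF assms(1,2)]]
      card_image[OF dual_family_inj[OF assms(2)]] by metis
qed

text \<open>A minimal set of coordinates separating the points of \<open>\<Lambda>\<close> admits a dual basis.\<close>

lemma exists_dual_family:
  assumes "mp.subspace \<Lambda>" "finite Q" "separated_by d Q \<Lambda>"
  obtains P b where "P \<subseteq> Q" "dual_family d P b" "b ` P \<subseteq> \<Lambda>" "separated_by d P \<Lambda>"
proof -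
  let ?ok = "\<lambda>P. P \<subseteq> Q \<and> separated_by d P \<Lambda>"
  obtain P where P: "?ok P" "\<And>P'. ?ok P' \<Longrightarrow> card P \<le> card P'"
    using ex_has_least_nat[of ?ok Q card] assms(3) by blast
  have finP: "finite P" using P(1) assms(2) finite_subset by blast
  have "\<exists>b. b \<in> \<Lambda> \<and> (\<forall>q\<in>P. dcoeff d b q = (if p = q then 1 else 0))" if p: "p \<in> P" for p
  proof -
    have "card (P - {p}) < card P" using finP p by (meson card_Diff1_less)
    moreover have "card P \<le> card (P - {p})" if "separated_by d (P - {p}) \<Lambda>"
      by (rule P(2)) (use that P(1) in blast)
    ultimately have "\<not> separated_by d (P - {p}) \<Lambda>" by linarith
    then obtain v where v: "v \<in> \<Lambda>" "v \<noteq> 0" "\<forall>q\<in>P - {p}. dcoeff d v q = 0"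
      unfolding separated_by_def by blast
    then have "dcoeff d v p \<noteq> 0"
      using P(1) unfolding separated_by_def by blast
    then show ?thesis
      using v mp.subspace_scale[OF assms(1) v(1), of "1 / dcoeff d v p"]
      by (intro exI[of _ "mscale (1 / dcoeff d v p) v"]) (auto simp: dcoeff_mscale)
  qed
  then obtain b where "\<forall>p\<in>P. b p \<in> \<Lambda> \<and> (\<forall>q\<in>P. dcoeff d (b p) q = (if p = q then 1 else 0))"
    by metis
  then show thesis using that[of P b] P(1) by (auto simp: dual_family_def)
qed

lemma separated_by_all:
  "\<Lambda> \<subseteq> binary_forms d \<Longrightarrow> separated_by d {..d} (\<Lambda> :: (nat, 'a::field_char_0) mpoly set)"
  unfolding separated_by_def
  using binary_forms_eqI[of _ d 0] mp.subspace_0[OF subspace_binary_forms] by auto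

lemma binary_forms_finite_span:
  "\<exists>B. finite B \<and> binary_forms d \<subseteq> mp.span (B :: (nat, 'a::field_char_0) mpoly set)"
proof -
  obtain P and b :: "nat \<Rightarrow> (nat, 'a) mpoly" where P: "P \<subseteq> {..d}" "dual_family d P b"
    "b ` P \<subseteq> binary_forms d" "separated_by d P (binary_forms d :: (nat, 'a) mpoly set)"
    by (rule exists_dual_family[OF subspace_binary_forms[of d] finite_atMost separated_by_all[OF order_refl, of d]]) (rule that)
  then have "finite P" using finite_subset by blast
  with P show ?thesis
    using dual_family_basis(1)[OF _ P(2,3) subspace_binary_forms P(4)]
    by (intro exI[of _ "b ` P"]) simp
qed

section \<open>Apolarity and linear recurrences\<close>

text \<open>Read \<open>g\<close> as a binary form of degree \<open>s\<close> and let it act on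
  \<open>v\<close> as a differential operator. For \<open>s \<le> d\<close> the result is a form of
  degree \<open>d - s\<close> whose coordinates \<open>dcoeff\<close> are these
  \<open>d - s + 1\<close> sums, up to a common nonzero factor. The degree \<open>s\<close> is a
  separate argument because \<open>g\<close> may have a smaller degree as a polynomial.\<close>

definition apolar_space :: "nat \<Rightarrow> nat \<Rightarrow> 'a::field poly \<Rightarrow> (nat, 'a) mpoly set" where
  "apolar_space d s g =
     {v \<in> binary_forms d. \<forall>i\<le>d - s. (\<Sum>l\<le>s. coeff g l * dcoeff d v (i + l)) = 0}"

lemma subspace_apolar_space: "mp.subspace (apolar_space d s g)"
proof -
  have "(\<Sum>l\<le>s. coeff g l * (x l + y l)) = (\<Sum>l\<le>s. coeff g l * x l) + (\<Sum>l\<le>s. coeff g l * y l)"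
    "(\<Sum>l\<le>s. coeff g l * (c * x l)) = c * (\<Sum>l\<le>s. coeff g l * x l)" for x y c
    by (simp_all add: distrib_left sum.distrib sum_distrib_left mult_ac)
  then show ?thesis
    using subspace_binary_forms[of d]
    unfolding mp.subspace_def apolar_space_def by (auto simp: dcoeff_add dcoeff_mscale)
qed

lemma apolar_space_smult:
  assumes "k \<noteq> 0"
  shows "apolar_space d s (smult k g) = apolar_space d s g"
proof -
  have "(\<Sum>l\<le>s. coeff (smult k g) l * x l) = k * (\<Sum>l\<le>s. coeff g l * x l)" for x
    by (simp add: sum_distrib_left mult_ac)
  then show ?thesis using assms by (simp add: apolar_space_def)
qed

text \<open>The continuation of \<open>b\<close> through the window \<open>{j..<j + m}\<close> by the linear recurrence of order \<open>j\<close>.\<close>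

function rec_ext :: "nat \<Rightarrow> nat \<Rightarrow> (nat \<Rightarrow> 'a::field) \<Rightarrow> (nat \<Rightarrow> 'a) \<Rightarrow> nat \<Rightarrow> 'a" where
  "rec_ext j m c b i =
     (if j \<le> i \<and> i < j + m then - (\<Sum>l<j. c l * rec_ext j m c b (i - j + l)) else b i)"
  by pat_completeness auto
termination
  by (relation "measure (\<lambda>(j, m, c, b, i). i)") auto

declare rec_ext.simps [simp del]

lemma rec_ext_outside: "i \<notin> {j..<j + m} \<Longrightarrow> rec_ext j m c b i = b i"
  by (subst rec_ext.simps) auto

lemma rec_ext_inside:
  "i < m \<Longrightarrow> rec_ext j m c b (i + j) = - (\<Sum>l<j. c l * rec_ext j m c b (i + l))"
  by (subst rec_ext.simps) auto

lemma rec_ext_unique: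
  assumes "\<And>i. i < m \<Longrightarrow> a (i + j) = - (\<Sum>l<j. c l * a (i + l))"
    and "\<And>i. i \<le> d \<Longrightarrow> i \<notin> {j..<j + m} \<Longrightarrow> a i = b i"
  shows "i \<le> d \<Longrightarrow> a i = rec_ext j m c b i"
proof (induction i rule: less_induct)
  case (less i)
  show ?case
  proof (cases "i \<in> {j..<j + m}")
    case True
    then have "i - j < m" "i - j + j = i" by auto
    then have "a i = - (\<Sum>l<j. c l * a (i - j + l))"
      using assms(1)[of "i - j"] by simp
    also have "(\<Sum>l<j. c l * a (i - j + l)) = (\<Sum>l<j. c l * rec_ext j m c b (i - j + l))"
      using True less by (intro sum.cong) auto
    also have "- \<dots> = rec_ext j m c b i"
      using True by (subst (2) rec_ext.simps) auto
    finally show ?thesis .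
  qed (use less.prems assms(2) rec_ext_outside in metis)
qed

text \<open>The coefficients of \<open>g\<close> above \<open>j\<close> vanish, so equation
  \<open>i\<close> ends at coordinate \<open>i + j\<close> and can be solved for it. The solved
  coordinates fill a window that starts at \<open>j\<close>; its length \<open>d - s + 1\<close>
  does not depend on the degree of \<open>g\<close>.\<close>

lemma apolar_space_monic:
  assumes "degree g = j" "lead_coeff g = 1" "j \<le> s"
  shows "v \<in> apolar_space d s g \<longleftrightarrow> v \<in> binary_forms d \<and>
    (\<forall>i<d - s + 1. dcoeff d v (i + j) = - (\<Sum>l<j. coeff g l * dcoeff d v (i + l)))"
proof -
  have "(\<Sum>l\<le>s. coeff g l * x l) = x j + (\<Sum>l<j. coeff g l * x l)" for x
  proof -
    have "(\<Sum>l\<le>s. coeff g l * x l) = (\<Sum>l\<le>j. coeff g l * x l)"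
      using assms by (intro sum.mono_neutral_right) (auto simp: coeff_eq_0)
    also have "{..j} = insert j {..<j}" by auto
    finally show ?thesis using assms by simp
  qed
  then show ?thesis
    by (auto simp: apolar_space_def eq_neg_iff_add_eq_0 less_Suc_eq_le)
qed

text \<open>A vector that vanishes outside the window and the zero vector are continued into the
  window by the same recurrence, and the continuation is unique.\<close>

lemma recurrence_separated:
  fixes \<Lambda> :: "(nat, 'a::field_char_0) mpoly set"
  assumes "\<Lambda> \<subseteq> binary_forms d"
    and rec: "\<And>v i. v \<in> \<Lambda> \<Longrightarrow> i < m \<Longrightarrow> dcoeff d v (i + j) = - (\<Sum>l<j. c l * dcoeff d v (i + l))"
  shows "separated_by d ({..d} - {j..<j + m}) \<Lambda>"
  unfolding separated_by_def
proof (intro ballI impI)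
  fix v assume v: "v \<in> \<Lambda>" and 0: "\<forall>p\<in>{..d} - {j..<j + m}. dcoeff d v p = 0"
  have "dcoeff d v i = rec_ext j m c (\<lambda>_. 0) i" if "i \<le> d" for i
    using rec[OF v] 0 that by (intro rec_ext_unique) auto
  moreover have "0 = rec_ext j m c (\<lambda>_. 0) i" if "i \<le> d" for i
    using that by (intro rec_ext_unique[where a = "\<lambda>_. 0"]) auto
  ultimately have "dcoeff d v i = dcoeff d 0 i" if "i \<le> d" for i
    using that by simp
  then show "v = 0"
    using v assms(1) mp.subspace_0[OF subspace_binary_forms] by (intro binary_forms_eqI[of v d 0]) auto
qed

lemma form_of_rec_ext_apolar:
  fixes g :: "'a::field_char_0 poly"
  assumes "degree g = j" "lead_coeff g = 1" "j \<le> s" "s \<le> d"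
  shows "form_of d (rec_ext j (d - s + 1) (coeff g) b) \<in> apolar_space d s g"
  unfolding apolar_space_monic[OF assms(1-3)]
proof (intro conjI allI impI form_of_in_binary_forms)
  fix i assume i: "i < d - s + 1"
  have "(\<Sum>l<j. coeff g l * dcoeff d (form_of d (rec_ext j (d - s + 1) (coeff g) b)) (i + l))
      = (\<Sum>l<j. coeff g l * rec_ext j (d - s + 1) (coeff g) b (i + l))"
    using i assms(3,4) by (intro sum.cong refl arg_cong2[where f = "(*)"] dcoeff_form_of) auto
  then show "dcoeff d (form_of d (rec_ext j (d - s + 1) (coeff g) b)) (i + j) =
     - (\<Sum>l<j. coeff g l * dcoeff d (form_of d (rec_ext j (d - s + 1) (coeff g) b)) (i + l))"
    using i assms(3,4) rec_ext_inside[OF i, of j "coeff g" b] by (simp add: dcoeff_form_of)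
qed

text \<open>Whatever the degree of \<open>g\<close>, the window takes \<open>d - s + 1\<close> of
  the \<open>d + 1\<close> coordinates; the other \<open>s\<close> can be prescribed freely. The
  basis vector \<open>b q\<close> continues the unit vector at \<open>q\<close> through the
  window.\<close>

lemma dim_apolar_space:
  fixes g :: "'a::field_char_0 poly"
  assumes "g \<noteq> 0" "degree g \<le> s" "s \<le> d"
  shows "mp.dim (apolar_space d s g) = s"
proof -
  define h where "h = smult (1 / lead_coeff g) g"
  define j where "j = degree h"
  define P where "P = {..d} - {j..<j + (d - s + 1)}"
  define b where "b q = form_of d (rec_ext j (d - s + 1) (coeff h) (\<lambda>p. if p = q then 1 else 0))" for q
  have h: "degree h = j" "lead_coeff h = 1" "j \<le> s" "apolar_space d s h = apolar_space d s g"
    using assms by (simp_all add: h_def j_def apolar_space_smult)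
  have "mp.dim (apolar_space d s h) = card P"
  proof (rule dual_family_basis(2)[OF _ _ _ subspace_apolar_space])
    show "dual_family d P b"
      by (auto simp: dual_family_def b_def P_def dcoeff_form_of rec_ext_outside)
    show "b ` P \<subseteq> apolar_space d s h"
      using form_of_rec_ext_apolar[OF h(1-3) assms(3)] by (auto simp: b_def)
    show "separated_by d P (apolar_space d s h)"
      unfolding P_def using apolar_space_monic[OF h(1-3)]
      by (intro recurrence_separated[where c = "coeff h"]) blast+
  qed (simp add: P_def)
  also have "card P = s"
    unfolding P_def using h(3) assms(3) by (subst card_Diff_subset) auto
  finally show ?thesis using h(4) by simp
qed

section \<open>Pluecker coordinates\<close>

abbreviation (input) Gr :: "nat \<Rightarrow> nat \<Rightarrow> (nat, 'a::field) mpoly set set" where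
  "Gr t d \<equiv> grassmannian t (binary_forms d)"

abbreviation pluecker_index :: "nat \<Rightarrow> nat \<Rightarrow> nat set set" where
  "pluecker_index t d \<equiv> {J. J \<subseteq> {0..d} \<and> card J = t}"

lemma length_ordered_basis:
  assumes "ordered_basis bs \<Lambda>"
  shows "length bs = mp.dim \<Lambda>"
  using assms mp.dim_span_eq_card_independent distinct_card unfolding ordered_basis_def by metis

lemma form_coeff_sum: "form_coeff d (sum f A) i = (\<Sum>x\<in>A. form_coeff d (f x) i)"
  by (simp add: form_coeff_def lookup_sum)

lemma det_mult_sum:
  fixes M N :: "nat \<Rightarrow> nat \<Rightarrow> 'a::field"
  shows "det (mat n n (\<lambda>(i, j). \<Sum>k<n. M i k * N k j))
    = det (mat n n (\<lambda>(i, j). M i j)) * det (mat n n (\<lambda>(i, j). N i j))"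
proof -
  have "mat n n (\<lambda>(i, j). \<Sum>k<n. M i k * N k j)
      = mat n n (\<lambda>(i, j). M i j) * mat n n (\<lambda>(i, j). N i j)"
    by (rule eq_matI) (auto simp: scalar_prod_def lessThan_atLeast0)
  then show ?thesis by (simp add: det_mult[of _ n])
qed

lemma pluecker_change_basis:
  assumes "ordered_basis bs \<Lambda>" "ordered_basis bs' \<Lambda>"
  obtains c where "pluecker d bs' = (\<lambda>J. c * pluecker d bs J)"
proof -
  have len: "length bs' = length bs"
    using length_ordered_basis[OF assms(1)] length_ordered_basis[OF assms(2)] by simp
  have "\<exists>a. bs' ! i = (\<Sum>k<length bs. mscale (a k) (bs ! k))" if "i < length bs" for i
  proof -
    have "bs' ! i \<in> mp.span (set bs)"
      using assms that len mp.span_superset[of "set bs'"] unfolding ordered_basis_def by force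
    then obtain u where "bs' ! i = (\<Sum>v\<in>set bs. mscale (u v) v)"
      by (auto simp: mp.span_finite)
    also have "\<dots> = (\<Sum>k<length bs. mscale (u (bs ! k)) (bs ! k))"
      using assms(1) unfolding ordered_basis_def
      by (intro sum.reindex_bij_betw[symmetric] bij_betw_nth) auto
    finally show ?thesis by (rule exI[of _ "\<lambda>k. u (bs ! k)"])
  qed
  then obtain a where a: "bs' ! i = (\<Sum>k<length bs. mscale (a i k) (bs ! k))" if "i < length bs" for i
    by metis
  have "pluecker d bs' J = det (mat (length bs) (length bs) (\<lambda>(i, j). a i j)) * pluecker d bs J" for J
  proof -
    have "mat (length bs) (length bs) (\<lambda>(i, j). form_coeff d (bs' ! i) (sorted_list_of_set J ! j))
      = mat (length bs) (length bs) (\<lambda>(i, j). \<Sum>k<length bs. a i k * form_coeff d (bs ! k) (sorted_list_of_set J ! j))"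
      by (rule eq_matI) (auto simp: a form_coeff_sum form_coeff_mscale)
    then show ?thesis
      unfolding pluecker_def len by (simp add: det_mult_sum)
  qed
  then show thesis using that by blast
qed

text \<open>The factor \<kappa> must not depend on the basis, because it becomes a coefficient of a
  form in the Pluecker coordinates. It is the determinant of the matrix \<open>N\<close> that
  selects the columns \<open>js\<close> from those of \<open>J\<close> and divides by the binomial
  coefficients; it vanishes if \<open>js\<close> repeats a column.\<close>

lemma minor_eq_pluecker:
  fixes J :: "nat set"
  assumes "finite J" "card J = t" "length js = t" "set js \<subseteq> J"
  obtains \<kappa> :: "'a::field" where "\<And>bs. length bs = t \<Longrightarrow>
    det (mat t t (\<lambda>(i, j). dcoeff d (bs ! i) (js ! j))) = \<kappa> * pluecker d bs J"
proof -
  define ss where "ss = sorted_list_of_set J"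
  have ss: "length ss = t" "set ss = J" "distinct ss" using assms by (simp_all add: ss_def)
  define N where "N k j = (if ss ! k = js ! j then 1 / of_nat (d choose (js ! j)) else 0 :: 'a)" for k j
  have "det (mat t t (\<lambda>(i, j). dcoeff d (bs ! i) (js ! j)))
      = det (mat t t (\<lambda>(i, j). N i j)) * pluecker d bs J" if len: "length bs = t" for bs
  proof -
    have "dcoeff d (bs ! i) (js ! j) = (\<Sum>k<t. form_coeff d (bs ! i) (ss ! k) * N k j)" if j: "j < t" for i j
    proof -
      have "js ! j \<in> set ss" using j assms ss by (metis nth_mem subsetD)
      then obtain k0 where k0: "k0 < t" "ss ! k0 = js ! j"
        using ss(1) by (metis in_set_conv_nth)
      have "ss ! k = js ! j \<longleftrightarrow> k = k0" if "k < t" for k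
        using that k0 ss nth_eq_iff_index_eq[OF ss(3), of k k0] by auto
      then have "(\<Sum>k<t. form_coeff d (bs ! i) (ss ! k) * N k j)
          = (\<Sum>k<t. if k = k0 then form_coeff d (bs ! i) (ss ! k) * N k j else 0)"
        by (intro sum.cong) (auto simp: N_def)
      then show ?thesis using k0 by (simp add: N_def dcoeff_def)
    qed
    then have "mat t t (\<lambda>(i, j). dcoeff d (bs ! i) (js ! j))
        = mat t t (\<lambda>(i, j). \<Sum>k<t. form_coeff d (bs ! i) (ss ! k) * N k j)"
      by (intro eq_matI) auto
    then show ?thesis
      unfolding pluecker_def len ss_def[symmetric] by (simp add: det_mult_sum)
  qed
  then show thesis using that by blast
qed

definition normalized :: "nat \<Rightarrow> nat set \<Rightarrow> (nat, 'a::field) mpoly list \<Rightarrow> bool" where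
  "normalized d P bs \<longleftrightarrow> length bs = card P \<and>
     (\<forall>i<card P. \<forall>j<card P. dcoeff d (bs ! i) (sorted_list_of_set P ! j) = (if i = j then 1 else 0))"

lemma det_delta: "det (mat n n (\<lambda>(i, j). if i = j then 1 else 0)) = (1 :: 'a::field)"
proof -
  have "mat n n (\<lambda>(i, j). if i = j then 1 else 0) = (1\<^sub>m n :: 'a mat)"
    by (rule eq_matI) auto
  then show ?thesis by simp
qed

lemma normalized_pluecker_nonzero:
  fixes bs :: "(nat, 'a::field) mpoly list"
  assumes "normalized d P bs" "finite P"
  shows "pluecker d bs P \<noteq> 0"
proof -
  obtain \<kappa> :: 'a where \<kappa>: "\<And>bs. length bs = card P \<Longrightarrow>
    det (mat (card P) (card P) (\<lambda>(i, j). dcoeff d (bs ! i) (sorted_list_of_set P ! j))) = \<kappa> * pluecker d bs P"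
    using minor_eq_pluecker[of P "card P" "sorted_list_of_set P" d] assms(2) by auto
  have "mat (card P) (card P) (\<lambda>(i, j). dcoeff d (bs ! i) (sorted_list_of_set P ! j))
    = (mat (card P) (card P) (\<lambda>(i, j). if i = j then 1 else 0) :: 'a mat)"
    using assms by (intro eq_matI) (auto simp: normalized_def)
  then have "\<kappa> * pluecker d bs P = 1"
    using \<kappa>[of bs] assms by (simp add: normalized_def det_delta)
  then show ?thesis by auto
qed

text \<open>
  By Cramer's rule, replacing one of the columns in \<open>P\<close> by the column \<open>q\<close> recovers the
  entries of a normalized basis from its Pluecker coordinates.
\<close>

lemma entry_form:
  assumes "P \<subseteq> {0..d}" "k < card P" "q \<le> d"
  obtains F :: "(nat set \<Rightarrow> 'a::field) \<Rightarrow> 'a" where "form_fun (pluecker_index (card P) d) 1 F"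
    "\<And>bs. normalized d P bs \<Longrightarrow> F (pluecker d bs) = dcoeff d (bs ! k) q"
proof -
  have finP: "finite P" using assms(1) finite_subset by blast
  define ss where "ss = sorted_list_of_set P"
  have ss: "length ss = card P" "set ss = P" "distinct ss" using finP by (simp_all add: ss_def)
  define js where "js = ss[k := q]"
  \<comment> \<open>If \<open>q\<close> is itself a pivot, then \<open>js\<close> is drawn from
    \<open>P\<close>, possibly with a repetition; taking \<open>J = P\<close> keeps an index set of
    the right size.\<close>
  define J where "J = (if q \<in> P then P else insert q (P - {ss ! k}))"
  have mem: "ss ! k \<in> P" using ss assms(2) nth_mem by fastforce
  have J: "finite J" "card J = card P" "J \<subseteq> {0..d}"
    using finP mem assms by (auto simp: J_def card.insert_remove card_Suc_Diff1)
  have "set js \<subseteq> J"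
  proof
    fix x assume "x \<in> set js"
    then obtain i where i: "i < card P" "x = js ! i"
      using ss(1) by (auto simp: in_set_conv_nth js_def)
    then show "x \<in> J"
      using ss assms(2) nth_eq_iff_index_eq[OF ss(3), of i k] nth_mem[of i ss]
      by (cases "i = k") (auto simp: js_def J_def)
  qed
  then obtain \<kappa> :: 'a where \<kappa>: "\<And>bs. length bs = card P \<Longrightarrow>
      det (mat (card P) (card P) (\<lambda>(i, j). dcoeff d (bs ! i) (js ! j))) = \<kappa> * pluecker d bs J"
    using minor_eq_pluecker[of J "card P" js d] J ss(1) by (auto simp: js_def)
  show thesis
  proof (rule that[of "\<lambda>y. \<kappa> * y J"])
    show "form_fun (pluecker_index (card P) d) 1 (\<lambda>y. \<kappa> * y J)"
      by (intro form_fun_cmult form_fun_var) (use J in simp)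
    fix bs :: "(nat, 'a) mpoly list" assume bs: "normalized d P bs"
    let ?x = "vec (card P) (\<lambda>i. dcoeff d (bs ! i) q)"
    have "mat (card P) (card P) (\<lambda>(i, j). dcoeff d (bs ! i) (js ! j))
        = replace_col (1\<^sub>m (card P)) (1\<^sub>m (card P) *\<^sub>v ?x) k"
      using bs assms(2) ss(1) unfolding normalized_def ss_def[symmetric]
      by (intro eq_matI) (auto simp: replace_col_def js_def)
    then have "det (mat (card P) (card P) (\<lambda>(i, j). dcoeff d (bs ! i) (js ! j)))
        = dcoeff d (bs ! k) q"
      using cramer_lemma_mat[of "1\<^sub>m (card P)" "card P" ?x k] assms(2) by simp
    then show "\<kappa> * pluecker d bs J = dcoeff d (bs ! k) q"
      using \<kappa>[of bs] bs by (simp add: normalized_def)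
  qed
qed

lemma normalized_ordered_basis:
  assumes "finite P" "dual_family d P b" "b ` P \<subseteq> \<Lambda>" "mp.subspace \<Lambda>" "separated_by d P \<Lambda>"
  shows "ordered_basis (map b (sorted_list_of_set P)) \<Lambda>" "normalized d P (map b (sorted_list_of_set P))"
proof -
  show "ordered_basis (map b (sorted_list_of_set P)) \<Lambda>"
    using assms(1) dual_family_inj[OF assms(2)] dual_family_independent[OF assms(1,2)] dual_family_basis(1)[OF assms]
    by (simp add: ordered_basis_def distinct_map)
  have "sorted_list_of_set P ! i \<in> P" if "i < card P" for i
    using that assms(1) nth_mem[of i "sorted_list_of_set P"] by simp
  moreover have "sorted_list_of_set P ! i = sorted_list_of_set P ! j \<longleftrightarrow> i = j" if "i < card P" "j < card P" for i j
    using that assms(1) by (simp add: nth_eq_iff_index_eq)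
  ultimately show "normalized d P (map b (sorted_list_of_set P))"
    using assms(1,2) by (auto simp: normalized_def dual_family_def)
qed

lemma normalized_basis_exists:
  fixes \<Lambda> :: "(nat, 'a::field_char_0) mpoly set"
  assumes "\<Lambda> \<in> Gr t d"
  obtains P bs where "P \<subseteq> {0..d}" "card P = t" "ordered_basis bs \<Lambda>" "normalized d P bs"
proof -
  have \<Lambda>: "mp.subspace \<Lambda>" "\<Lambda> \<subseteq> binary_forms d" "mp.dim \<Lambda> = t"
    using assms by (auto simp: grassmannian_def)
  obtain P b where P: "P \<subseteq> {..d}" "dual_family d P b" "b ` P \<subseteq> \<Lambda>" "separated_by d P \<Lambda>"
    by (rule exists_dual_family[OF \<Lambda>(1) finite_atMost separated_by_all[OF \<Lambda>(2)]])
  have fin: "finite P" using P(1) finite_subset by blast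
  show thesis
    by (rule that[OF _ _ normalized_ordered_basis[OF fin P(2,3) \<Lambda>(1) P(4)]])
      (use P(1) dual_family_basis(2)[OF fin P(2,3) \<Lambda>(1) P(4)] \<Lambda>(3) in auto)
qed

section \<open>The Zariski topology\<close>

definition vanishes :: "nat \<Rightarrow> ((nat set \<Rightarrow> 'a::field) \<Rightarrow> 'a) \<Rightarrow> (nat, 'a) mpoly set \<Rightarrow> bool" where
  "vanishes d F \<Lambda> \<longleftrightarrow> (\<forall>bs. ordered_basis bs \<Lambda> \<longrightarrow> F (pluecker d bs) = 0)"

abbreviation (input) "nonvanishing t d F \<equiv> {\<Lambda> \<in> Gr t d. \<not> vanishes d F \<Lambda>}"

lemma vanishes_iff:
  assumes "form_fun V n F" "ordered_basis bs \<Lambda>"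
  shows "vanishes d F \<Lambda> \<longleftrightarrow> F (pluecker d bs) = 0"
proof -
  have "F (pluecker d bs') = 0" if F0: "F (pluecker d bs) = 0" and bs': "ordered_basis bs' \<Lambda>" for bs'
  proof -
    obtain c where "pluecker d bs' = (\<lambda>J. c * pluecker d bs J)"
      using pluecker_change_basis[OF assms(2) bs'] by blast
    then show ?thesis using form_fun_homogeneous[OF assms(1)] F0 by simp
  qed
  then show ?thesis using assms(2) unfolding vanishes_def by blast
qed

lemma open_nonvanishing:
  assumes "form_fun (pluecker_index t d) n F"
  shows "openin (grassmann_zariski t d) (nonvanishing t d F)"
proof -
  obtain p where p: "p \<in> hpolys (pluecker_index t d) n" "\<And>y. F y = meval y p"
    using assms unfolding form_fun_def by blast
  then have "pluecker_nonzeros t d p = (nonvanishing t d F)"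
    by (auto simp: pluecker_nonzeros_def vanishes_def)
  moreover have "p \<in> pluecker_polys t d" using p(1) by (auto simp: pluecker_polys_def)
  ultimately show ?thesis
    unfolding grassmann_zariski_def by (metis imageI topology_generated_by_Basis)
qed

text \<open>The generating loci already form a base: in the induction over generated open sets, an
  intersection is served by the product \<open>?FG\<close>, which vanishes exactly where one of its
  factors does.\<close>

lemma nonvanishing_form_in_open:
  fixes \<Lambda> :: "(nat, 'a::field_char_0) mpoly set"
  assumes "openin (grassmann_zariski t d) U" "\<Lambda> \<in> U"
  obtains n F where "form_fun (pluecker_index t d) n F" "\<not> vanishes d F \<Lambda>"
    "(nonvanishing t d F) \<subseteq> U"
proof -
  have "generate_topology_on (pluecker_nonzeros t d ` pluecker_polys t d) U"
    using assms(1) unfolding grassmann_zariski_def by (rule openin_topology_generated_by)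
  then have "\<forall>\<Lambda>\<in>U. \<exists>n F. form_fun (pluecker_index t d) n F \<and> \<not> vanishes d F \<Lambda> \<and>
      (nonvanishing t d F) \<subseteq> U"
  proof (induction rule: generate_topology_on.induct)
    case (Int A B)
    show ?case
    proof
      fix \<Lambda> assume "\<Lambda> \<in> A \<inter> B"
      then have \<Lambda>: "\<Lambda> \<in> A" "\<Lambda> \<in> B" by auto
      from bspec[OF Int.IH(1) \<Lambda>(1)] obtain m F where F: "form_fun (pluecker_index t d) m F" "\<not> vanishes d F \<Lambda>"
          "(nonvanishing t d F) \<subseteq> A"
        by (elim exE conjE)
      from bspec[OF Int.IH(2) \<Lambda>(2)] obtain n G where G: "form_fun (pluecker_index t d) n G" "\<not> vanishes d G \<Lambda>"
          "(nonvanishing t d G) \<subseteq> B"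
        by (elim exE conjE)
      let ?FG = "\<lambda>y. F y * G y"
      have FG: "form_fun (pluecker_index t d) (m + n) ?FG" by (rule form_fun_mult[OF F(1) G(1)])
      have "vanishes d ?FG \<Lambda>' \<longleftrightarrow> vanishes d F \<Lambda>' \<or> vanishes d G \<Lambda>'" for \<Lambda>'
      proof (cases "\<exists>bs. ordered_basis bs \<Lambda>'")
        case True
        then obtain bs where bs: "ordered_basis bs \<Lambda>'" by blast
        show ?thesis
          by (simp add: vanishes_iff[OF F(1) bs] vanishes_iff[OF G(1) bs] vanishes_iff[OF FG bs])
      qed (simp add: vanishes_def)
      then show "\<exists>n F. form_fun (pluecker_index t d) n F \<and> \<not> vanishes d F \<Lambda> \<and>
          (nonvanishing t d F) \<subseteq> A \<inter> B"
        using F G FG by (intro exI[of _ "m + n"] exI[of _ ?FG]) auto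
    qed
  next
    case (UN K)
    show ?case
    proof
      fix \<Lambda> assume "\<Lambda> \<in> \<Union> K"
      then obtain k where "k \<in> K" "\<Lambda> \<in> k" by blast
      from bspec[OF UN.IH[OF \<open>k \<in> K\<close>] \<open>\<Lambda> \<in> k\<close>]
      obtain n F where "form_fun (pluecker_index t d) n F" "\<not> vanishes d F \<Lambda>"
          "(nonvanishing t d F) \<subseteq> k"
        by (elim exE conjE)
      with \<open>k \<in> K\<close> show "\<exists>n F. form_fun (pluecker_index t d) n F \<and> \<not> vanishes d F \<Lambda> \<and>
          (nonvanishing t d F) \<subseteq> \<Union> K"
        by (intro exI[of _ n] exI[of _ F]) auto
    qed
  next
    case (Basis s)
    then obtain p n where p: "p \<in> hpolys (pluecker_index t d) n" "s = pluecker_nonzeros t d p"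
      by (auto simp: pluecker_polys_def)
    have "s = {\<Lambda> \<in> Gr t d. \<not> vanishes d (\<lambda>y. meval y p) \<Lambda>}"
      by (auto simp: p(2) pluecker_nonzeros_def vanishes_def)
    then show ?case
      by (intro ballI exI[of _ n] exI[of _ "\<lambda>y. meval y p"]) (auto intro: form_fun_meval[OF p(1)])
  qed simp
  from bspec[OF this assms(2)] show thesis using that by (elim exE conjE)
qed

lemma topspace_grassmann_zariski:
  "topspace (grassmann_zariski t d) = grassmannian t (binary_forms d :: (nat, 'a::field_char_0) mpoly set)"
proof
  show "topspace (grassmann_zariski t d) \<subseteq> (Gr t d :: (nat, 'a) mpoly set set)"
    unfolding grassmann_zariski_def topology_generated_by_topspace by (auto simp: pluecker_nonzeros_def)
  have "\<not> vanishes d (\<lambda>_. 1) \<Lambda>" if "\<Lambda> \<in> Gr t d" for \<Lambda> :: "(nat, 'a) mpoly set"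
  proof -
    obtain P bs where "ordered_basis bs \<Lambda>" "normalized d P bs"
      using normalized_basis_exists[OF \<open>\<Lambda> \<in> Gr t d\<close>] by metis
    then show ?thesis unfolding vanishes_def by auto
  qed
  then show "(Gr t d :: (nat, 'a) mpoly set set) \<subseteq> topspace (grassmann_zariski t d)"
    using openin_subset[OF open_nonvanishing[OF form_fun_const[of "pluecker_index t d" 1]]] by blast
qed

lemma closed_vanishing:
  fixes S :: "(nat, 'a::field_char_0) mpoly set set"
  assumes "form_fun (pluecker_index t d) n F" "S \<subseteq> Gr t d"
  shows "closedin (subtopology (grassmann_zariski t d) S) {\<Lambda> \<in> S. vanishes d F \<Lambda>}"
proof -
  have top: "topspace (subtopology (grassmann_zariski t d) S) = S"
    using assms(2) by (auto simp: topspace_grassmann_zariski)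
  have "S - {\<Lambda> \<in> S. vanishes d F \<Lambda>} = S \<inter> (nonvanishing t d F)"
    using assms(2) by auto
  moreover have "openin (subtopology (grassmann_zariski t d) S)
     (S \<inter> (nonvanishing t d F))"
    using open_nonvanishing[OF assms(1)] by (rule openin_subtopology_Int2)
  ultimately show ?thesis
    unfolding closedin_def top by auto
qed

lemma form_separating_closed:
  fixes S :: "(nat, 'a::field_char_0) mpoly set set"
  assumes "closedin (subtopology (grassmann_zariski t d) S) Z" "S \<subseteq> Gr t d"
    and "\<Lambda> \<in> S" "\<Lambda> \<notin> Z"
  obtains n F where "form_fun (pluecker_index t d) n F" "\<And>\<Lambda>'. \<Lambda>' \<in> Z \<Longrightarrow> vanishes d F \<Lambda>'" "\<not> vanishes d F \<Lambda>"
proof -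
  obtain C where C: "closedin (grassmann_zariski t d) C" "Z = C \<inter> S"
    using assms(1) by (auto simp: closedin_subtopology)
  have "openin (grassmann_zariski t d) (Gr t d - C)"
    using C(1) by (metis topspace_grassmann_zariski openin_diff openin_topspace)
  moreover have "\<Lambda> \<in> Gr t d - C" using assms C by auto
  ultimately obtain n F where F: "form_fun (pluecker_index t d) n F" "\<not> vanishes d F \<Lambda>"
    "(nonvanishing t d F) \<subseteq> Gr t d - C"
    by (rule nonvanishing_form_in_open)
  show thesis
    by (rule that[OF F(1) _ F(2)]) (use F(3) C(2) assms(2) in blast)
qed

section \<open>Upper bounds for the dimension\<close>

text \<open>
  For an irreducible \<open>Z\<close>, adding one step to a chain multiplies the Hilbert function of the cone
  over \<open>Z\<close> by a linear function, whereas a parametrization by \<open>N\<close> variables bounds it by a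
  polynomial of degree \<open>N\<close>.
\<close>

definition restr :: "('v \<Rightarrow> 'a::field) set \<Rightarrow> ('v, 'a) mpoly \<Rightarrow> ('v \<Rightarrow> 'a) \<Rightarrow> 'a" where
  "restr A p = (\<lambda>y. if y \<in> A then meval y p else 0)"

text \<open>This is the Hilbert function of the homogeneous coordinate ring of \<open>A\<close>:
  forms of degree \<open>m\<close> modulo those that vanish on \<open>A\<close>.\<close>

definition hilb :: "'v set \<Rightarrow> ('v \<Rightarrow> 'a::field) set \<Rightarrow> nat \<Rightarrow> nat" where
  "hilb V A m = fs.dim (restr A ` hpolys V m)"

lemma linear_restr: "Vector_Spaces.linear mscale fscale (restr A)"
  by (rule linearI[OF mp.vector_space_axioms fs.vector_space_axioms])
    (auto simp: restr_def fscale_def fun_eq_iff meval_add meval_mscale)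

lemma subspace_restr: "fs.subspace (restr A ` hpolys V m)"
proof -
  interpret Vector_Spaces.linear mscale fscale "restr A" by (rule linear_restr)
  show ?thesis by (rule subspace_image[OF subspace_hpolys])
qed

lemma restr_finite_span:
  fixes A :: "('v \<Rightarrow> 'a::field) set"
  assumes "finite V"
  shows "\<exists>B. finite B \<and> restr A ` hpolys V m \<subseteq> fs.span B"
proof -
  interpret Vector_Spaces.linear mscale fscale "restr A" by (rule linear_restr)
  obtain B :: "('v, 'a) mpoly set" where "finite B" "hpolys V m \<subseteq> mp.span B"
    using hpolys_finite_span[OF assms] by metis
  then show ?thesis by (intro exI[of _ "restr A ` B"]) (auto simp: span_image)
qed

lemma linear_fun_mult: "Vector_Spaces.linear fscale fscale (\<lambda>h y. F y * h y)"
  by (rule linearI[OF fs.vector_space_axioms fs.vector_space_axioms])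
    (auto simp: fscale_def fun_eq_iff algebra_simps)

text \<open>The hypothesis \<open>dom\<close> says that \<open>f\<close> is not a zero divisor for
  forms of degree \<open>m\<close> on \<open>A\<close>, so multiplication by \<open>f\<close> embeds
  these into degree \<open>m + e\<close>.\<close>

lemma dim_restr_mult:
  assumes "finite V" "f \<in> hpolys V e"
    and dom: "\<And>p. p \<in> hpolys V m \<Longrightarrow> \<forall>y\<in>A. meval y f * meval y p = 0 \<Longrightarrow> \<forall>y\<in>A. meval y p = 0"
  shows "fs.dim ((\<lambda>h y. meval y f * h y) ` restr A ` hpolys V m) = hilb V A m"
    "(\<lambda>h y. meval y f * h y) ` restr A ` hpolys V m \<subseteq> restr A ` hpolys V (m + e)"
proof -
  interpret ff: vector_space_pair "fscale :: 'b \<Rightarrow> (('a \<Rightarrow> 'b) \<Rightarrow> 'b) \<Rightarrow> _" "fscale :: 'b \<Rightarrow> (('a \<Rightarrow> 'b) \<Rightarrow> 'b) \<Rightarrow> _"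
    by (rule fs_fs)
  obtain B where B: "finite B" "restr A ` hpolys V m \<subseteq> fs.span B"
    using restr_finite_span[OF assms(1)] by metis
  show "fs.dim ((\<lambda>h y. meval y f * h y) ` restr A ` hpolys V m) = hilb V A m"
    unfolding hilb_def
  proof (rule ff.dim_image_injective[OF linear_fun_mult subspace_restr B(2,1)])
    fix h assume "h \<in> restr A ` hpolys V m" and 0: "(\<lambda>y. meval y f * h y) = 0"
    then obtain p where p: "p \<in> hpolys V m" "h = restr A p" by blast
    have "\<forall>y\<in>A. meval y f * meval y p = 0"
    proof
      fix y assume "y \<in> A"
      with fun_cong[OF 0, of y] show "meval y f * meval y p = 0" by (simp add: p(2) restr_def)
    qed
    from dom[OF p(1) this] show "h = 0" by (auto simp: p(2) restr_def fun_eq_iff)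
  qed
  show "(\<lambda>h y. meval y f * h y) ` restr A ` hpolys V m \<subseteq> restr A ` hpolys V (m + e)"
  proof clarify
    fix p :: "('a, 'b) mpoly" assume "p \<in> hpolys V m"
    then have "p * f \<in> hpolys V (m + e)" using hpolys_mult assms(2) by blast
    moreover have "(\<lambda>y. meval y f * restr A p y) = restr A (p * f)"
      by (auto simp: restr_def fun_eq_iff meval_mult)
    ultimately show "(\<lambda>y. meval y f * restr A p y) \<in> restr A ` hpolys V (m + e)" by blast
  qed
qed

lemma hilb_mult_le:
  assumes "finite V" "f \<in> hpolys V e"
    and "\<And>p. p \<in> hpolys V m \<Longrightarrow> \<forall>y\<in>A. meval y f * meval y p = 0 \<Longrightarrow> \<forall>y\<in>A. meval y p = 0"
  shows "hilb V A m \<le> hilb V A (m + e)"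
proof -
  obtain B where B: "finite B" "restr A ` hpolys V (m + e) \<subseteq> fs.span B"
    using restr_finite_span[OF assms(1)] by metis
  show ?thesis
    using fs.dim_mono_finite[OF dim_restr_mult(2)[OF assms] B(2,1)] dim_restr_mult(1)[OF assms]
    by (simp add: hilb_def)
qed

text \<open>Restriction from \<open>A'\<close> to \<open>A\<close> is onto in degree
  \<open>m + e\<close>, and its kernel contains the multiples of \<open>f\<close>, a copy of the
  forms of degree \<open>m\<close> on \<open>A'\<close>.\<close>

lemma hilb_step:
  assumes "finite V" "f \<in> hpolys V e" "A \<subseteq> A'" "\<And>y. y \<in> A \<Longrightarrow> meval y f = 0"
    and dom: "\<And>p. p \<in> hpolys V m \<Longrightarrow> \<forall>y\<in>A'. meval y f * meval y p = 0 \<Longrightarrow> \<forall>y\<in>A'. meval y p = 0"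
  shows "hilb V A (m + e) + hilb V A' m \<le> hilb V A' (m + e)"
proof -
  interpret ff: vector_space_pair "fscale :: 'b \<Rightarrow> (('a \<Rightarrow> 'b) \<Rightarrow> 'b) \<Rightarrow> _" "fscale :: 'b \<Rightarrow> (('a \<Rightarrow> 'b) \<Rightarrow> 'b) \<Rightarrow> _"
    by (rule fs_fs)
  let ?S = "restr A' ` hpolys V (m + e)"
  \<comment> \<open>Restriction to \<open>A\<close>, written as multiplication by the indicator
    function of \<open>A\<close>.\<close>
  let ?r = "\<lambda>h y. (if y \<in> A then 1 else 0) * h y"
  obtain B where B: "finite B" "?S \<subseteq> fs.span B"
    using restr_finite_span[OF assms(1)] by metis
  note mult = dim_restr_mult[where m = m and A = A', OF assms(1,2) dom]
  have "?r ` ?S = restr A ` hpolys V (m + e)"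
    unfolding image_image using assms(3) by (intro image_cong refl) (auto simp: restr_def fun_eq_iff)
  moreover have "(\<lambda>h y. meval y f * h y) ` restr A' ` hpolys V m \<subseteq> {h \<in> ?S. ?r h = 0}"
    using mult(2) assms(4) by (auto simp: fun_eq_iff)
  then have "fs.dim ((\<lambda>h y. meval y f * h y) ` restr A' ` hpolys V m) \<le> fs.dim {h \<in> ?S. ?r h = 0}"
    by (rule fs.dim_mono_finite[OF _ _ B(1)]) (use B(2) in auto)
  then have "hilb V A' m \<le> fs.dim {h \<in> ?S. ?r h = 0}"
    by (simp only: mult(1))
  ultimately show ?thesis
    using ff.rank_nullity[OF linear_fun_mult subspace_restr B(2,1), of "\<lambda>y. if y \<in> A then 1 else 0"]
    by (simp add: hilb_def)
qed

lemma hilb_mono: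
  assumes "finite V" "A \<subseteq> A'"
  shows "hilb V A m \<le> hilb V A' m"
proof -
  obtain B where B: "finite B" "hpolys V m \<subseteq> mp.span (B :: ('a, 'b) mpoly set)"
    using hpolys_finite_span[OF assms(1)] by metis
  show ?thesis
    unfolding hilb_def
  proof (rule dim_image_le_of_kernel[OF mp_fs mp_fs linear_restr linear_restr subspace_hpolys B(2,1)])
    fix p assume 0: "restr A' p = 0"
    have "meval z p = 0" if "z \<in> A" for z
      using fun_cong[OF 0, of z] that assms(2) by (auto simp: restr_def)
    then show "restr A p = 0" by (auto simp: restr_def)
  qed
qed

text \<open>\<open>hilb_step\<close> telescopes over \<open>b\<close> steps of length
  \<open>e\<close>. Each step adds a value of the Hilbert function of \<open>A\<close>, and repeated
  multiplication by \<open>g\<close> keeps these values at least \<open>hilb V A m\<close>. The one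
  further copy in \<open>Suc b\<close> comes from \<open>A \<subseteq> A'\<close>.\<close>

lemma hilb_growth:
  assumes V: "finite V" and f: "f \<in> hpolys V e" "A \<subseteq> A'" "\<And>y. y \<in> A \<Longrightarrow> meval y f = 0"
    and dom: "\<And>m p. p \<in> hpolys V m \<Longrightarrow> \<forall>y\<in>A'. meval y f * meval y p = 0 \<Longrightarrow> \<forall>y\<in>A'. meval y p = 0"
    and g: "g \<in> hpolys V e"
    and dom': "\<And>m p. p \<in> hpolys V m \<Longrightarrow> \<forall>y\<in>A. meval y g * meval y p = 0 \<Longrightarrow> \<forall>y\<in>A. meval y p = 0"
  shows "Suc b * hilb V A m \<le> hilb V A' (m + e * b)"
proof -
  have mult: "hilb V A m \<le> hilb V A (m + e * b)" for b
  proof (induction b)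
    case (Suc b)
    have "hilb V A (m + e * b) \<le> hilb V A (m + e * b + e)"
      by (rule hilb_mult_le[OF V g dom'])
    with Suc show ?case by (simp add: algebra_simps)
  qed simp
  show ?thesis
  proof (induction b)
    case 0
    then show ?case using hilb_mono[OF V f(2)] by simp
  next
    case (Suc b)
    have "hilb V A (m + e * b + e) + hilb V A' (m + e * b) \<le> hilb V A' (m + e * b + e)"
      by (rule hilb_step[OF V f dom])
    with Suc mult[of "Suc b"] show ?case by (simp add: algebra_simps)
  qed
qed

text \<open>For subspaces of a fixed positive dimension this is the punctured affine cone over the
  image of \<open>Z\<close> in the Pluecker embedding: all bases of a space together give all
  nonzero multiples of its Pluecker vector.\<close>

definition cone :: "nat \<Rightarrow> (nat, 'a::field) mpoly set set \<Rightarrow> (nat set \<Rightarrow> 'a) set" where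
  "cone d Z = {pluecker d bs | bs \<Lambda>. \<Lambda> \<in> Z \<and> ordered_basis bs \<Lambda>}"

lemma zero_on_cone_iff: "(\<forall>y\<in>cone d Z. F y = 0) \<longleftrightarrow> (\<forall>\<Lambda>\<in>Z. vanishes d F \<Lambda>)"
  by (auto simp: cone_def vanishes_def)

text \<open>In ring terms, the homogeneous ideal of an irreducible set is prime: the zero loci of
  \<open>F\<close> and \<open>G\<close> are closed and cover \<open>Z\<close>, so one of them is all
  of \<open>Z\<close>.\<close>

lemma irreducible_forms:
  fixes S :: "(nat, 'a::field_char_0) mpoly set set"
  assumes "S \<subseteq> Gr t d" "Z \<subseteq> S"
    and irr: "irreducible_space (subtopology (subtopology (grassmann_zariski t d) S) Z)"
    and F: "form_fun (pluecker_index t d) m F" and G: "form_fun (pluecker_index t d) n G"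
    and 0: "\<forall>y\<in>cone d Z. F y * G y = 0"
  shows "(\<forall>y\<in>cone d Z. F y = 0) \<or> (\<forall>y\<in>cone d Z. G y = 0)"
proof -
  have ZG: "Z \<subseteq> Gr t d" using assms(1,2) by blast
  have top: "subtopology (subtopology (grassmann_zariski t d) S) Z = subtopology (grassmann_zariski t d) Z"
    using assms(2) by (simp add: subtopology_subtopology inf.absorb2)
  have tZ: "topspace (subtopology (grassmann_zariski t d) Z) = Z"
    using ZG by (auto simp: topspace_grassmann_zariski)
  have "\<forall>\<Lambda>\<in>Z. vanishes d F \<Lambda> \<or> vanishes d G \<Lambda>"
  proof
    fix \<Lambda> assume \<Lambda>: "\<Lambda> \<in> Z"
    show "vanishes d F \<Lambda> \<or> vanishes d G \<Lambda>"
    proof (cases "\<exists>bs. ordered_basis bs \<Lambda>")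
      case True
      then obtain bs where bs: "ordered_basis bs \<Lambda>" by blast
      then have "F (pluecker d bs) * G (pluecker d bs) = 0" using 0 \<Lambda> by (auto simp: cone_def)
      then show ?thesis by (simp add: vanishes_iff[OF F bs] vanishes_iff[OF G bs])
    qed (simp add: vanishes_def)
  qed
  then have "{\<Lambda> \<in> Z. vanishes d F \<Lambda>} \<union> {\<Lambda> \<in> Z. vanishes d G \<Lambda>} = Z" by blast
  then have "{\<Lambda> \<in> Z. vanishes d F \<Lambda>} = Z \<or> {\<Lambda> \<in> Z. vanishes d G \<Lambda>} = Z"
    using irr closed_vanishing[OF F ZG] closed_vanishing[OF G ZG]
    unfolding irreducible_space_def top tZ by blast
  then show ?thesis unfolding zero_on_cone_iff by blast
qed

section \<open>Hilbert functions along chains and under parametrizations\<close>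

lemma finite_pluecker_index: "finite (pluecker_index t d)"
  by (rule finite_subset[of _ "Pow {0..d}"]) auto

text \<open>Each inclusion contributes a factor \<open>Suc b\<close>. It comes from
  \<open>hilb_growth\<close> for a form \<open>F\<close> that vanishes on \<open>Z n\<close> but not
  on all of \<open>Z (Suc n)\<close>; irreducibility excludes zero divisors on both cones. The
  degrees of these forms add up to \<kappa>.\<close>

lemma chain_hilb:
  fixes S :: "(nat, 'a::field_char_0) mpoly set set"
  assumes S: "S \<subseteq> Gr t d"
    and Z: "\<And>i. i \<le> n \<Longrightarrow> closedin (subtopology (grassmann_zariski t d) S) (Z i)"
      "\<And>i. i \<le> n \<Longrightarrow> irreducible_space (subtopology (subtopology (grassmann_zariski t d) S) (Z i))"
      "\<And>i. i < n \<Longrightarrow> Z i \<subset> Z (Suc i)"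
  shows "\<exists>\<kappa>. \<forall>b. Suc b ^ n \<le> hilb (pluecker_index t d) (cone d (Z n)) (\<kappa> * b)"
  using Z
proof (induction n)
  let ?V = "pluecker_index t d" and ?X = "subtopology (grassmann_zariski t d) S"
  have topS: "topspace ?X = S"
    using S by (auto simp: topspace_grassmann_zariski)
  have nonempty: "\<exists>\<Lambda> bs P. \<Lambda> \<in> Z' \<and> P \<in> ?V \<and> ordered_basis bs \<Lambda> \<and> pluecker d bs P \<noteq> 0"
    if Z': "closedin ?X Z'"
      "irreducible_space (subtopology ?X Z')" for Z'
  proof -
    have "Z' \<subseteq> S" using closedin_subset[OF Z'(1)] topS by simp
    then obtain \<Lambda> where \<Lambda>: "\<Lambda> \<in> Z'" "\<Lambda> \<in> Gr t d"
      using Z'(2) S by (auto simp: irreducible_space_def)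
    obtain P bs where P: "P \<subseteq> {0..d}" "card P = t" "ordered_basis bs \<Lambda>" "normalized d P bs"
      using normalized_basis_exists[OF \<Lambda>(2)] by metis
    then have "pluecker d bs P \<noteq> 0" using normalized_pluecker_nonzero finite_subset by blast
    with \<Lambda>(1) P show ?thesis by blast
  qed
  {
    case 0
    obtain \<Lambda> bs where *: "\<Lambda> \<in> Z 0" "ordered_basis bs \<Lambda>"
      using nonempty[OF 0(1,2)] by blast
    let ?one = "restr (cone d (Z 0)) (single 0 1)"
    have one: "?one \<in> restr (cone d (Z 0)) ` hpolys ?V 0"
      by (intro imageI hpolys_single) auto
    have "?one (pluecker d bs) = 1"
      using * by (auto simp: restr_def cone_def meval_single)
    then have "?one \<noteq> 0" by (metis zero_fun_apply zero_neq_one)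
    from restr_finite_span[where V = ?V and A = "cone d (Z 0)" and m = 0, OF finite_pluecker_index]
    obtain B where B: "finite B" "restr (cone d (Z 0)) ` hpolys ?V 0 \<subseteq> fs.span B"
      by (elim exE conjE)
    have "card {?one} \<le> hilb ?V (cone d (Z 0)) 0"
      unfolding hilb_def by (intro fs.independent_card_le_dim(2)[OF _ _ B(2,1)]) (use one \<open>?one \<noteq> 0\<close> in auto)
    then have "1 \<le> hilb ?V (cone d (Z 0)) 0" by simp
    then show ?case by (intro exI[of _ 0]) simp
  next
    case (Suc n)
    have cl: "closedin ?X (Z n)"
      "closedin ?X (Z (Suc n))"
      and irr: "irreducible_space (subtopology ?X (Z n))"
      "irreducible_space (subtopology ?X (Z (Suc n)))"
      using Suc.prems(1,2)[of n] Suc.prems(1,2)[of "Suc n"] by simp_all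
    have sub: "Z n \<subseteq> S" "Z (Suc n) \<subseteq> S"
      using closedin_subset[OF cl(1)] closedin_subset[OF cl(2)] topS by simp_all
    have "\<exists>\<kappa>. \<forall>b. Suc b ^ n \<le> hilb ?V (cone d (Z n)) (\<kappa> * b)"
      by (rule Suc.IH) (use Suc.prems in auto)
    then obtain \<kappa> where \<kappa>: "Suc b ^ n \<le> hilb ?V (cone d (Z n)) (\<kappa> * b)" for b by blast
    obtain \<Lambda> where \<Lambda>: "\<Lambda> \<in> Z (Suc n)" "\<Lambda> \<notin> Z n" using Suc.prems(3)[of n] by blast
    have "\<Lambda> \<in> S" using \<Lambda>(1) sub(2) by blast
    then obtain e F where F: "form_fun ?V e F" "\<And>\<Lambda>'. \<Lambda>' \<in> Z n \<Longrightarrow> vanishes d F \<Lambda>'" "\<not> vanishes d F \<Lambda>"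
      using form_separating_closed[OF cl(1) S _ \<Lambda>(2)] by metis
    obtain f where f: "f \<in> hpolys ?V e" "\<And>y. F y = meval y f"
      using F(1) unfolding form_fun_def by blast
    obtain \<Lambda>0 bs P where P: "\<Lambda>0 \<in> Z n" "P \<in> ?V" "ordered_basis bs \<Lambda>0" "pluecker d bs P \<noteq> 0"
      using nonempty[OF cl(1) irr(1)] by blast
    \<comment> \<open>A form of the same degree as \<open>F\<close> that does not vanish identically
      on \<open>Z n\<close>; it serves as the \<open>g\<close> of
      \<open>hilb_growth\<close>.\<close>
    have "form_fun ?V (1 * e) (\<lambda>y :: nat set \<Rightarrow> 'a. y P ^ e)"
      by (intro form_fun_power form_fun_var P(2))
    then obtain g :: "(nat set, 'a) mpoly" where g: "g \<in> hpolys ?V e" "\<And>y. y P ^ e = meval y g"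
      unfolding form_fun_def by auto
    have "Suc b ^ Suc n \<le> hilb ?V (cone d (Z (Suc n))) ((\<kappa> + e) * b)" for b
    proof -
      have "Suc b * hilb ?V (cone d (Z n)) (\<kappa> * b) \<le> hilb ?V (cone d (Z (Suc n))) (\<kappa> * b + e * b)"
      proof (rule hilb_growth[where f = f and g = g])
        show "finite ?V" by (rule finite_pluecker_index)
        show "f \<in> hpolys ?V e" "g \<in> hpolys ?V e" by (fact f(1) g(1))+
        show "cone d (Z n) \<subseteq> cone d (Z (Suc n))" using Suc.prems(3)[of n] by (auto simp: cone_def)
        show "meval y f = 0" if "y \<in> cone d (Z n)" for y
          using that F(2) f(2) zero_on_cone_iff[of d "Z n" F] by auto
        fix m and p :: "(nat set, 'a) mpoly" assume p: "p \<in> hpolys ?V m"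
        show "\<forall>y\<in>cone d (Z (Suc n)). meval y p = 0"
          if "\<forall>y\<in>cone d (Z (Suc n)). meval y f * meval y p = 0"
          using irreducible_forms[OF S sub(2) irr(2) form_fun_meval[OF f(1)] form_fun_meval[OF p] that]
            zero_on_cone_iff[of d "Z (Suc n)" F] F(3) \<Lambda>(1) f(2) by auto
        show "\<forall>y\<in>cone d (Z n). meval y p = 0" if "\<forall>y\<in>cone d (Z n). meval y g * meval y p = 0"
        proof -
          have "pluecker d bs \<in> cone d (Z n)" "meval (pluecker d bs) g \<noteq> 0"
            using P g(2)[symmetric] by (auto simp: cone_def)
          then show ?thesis
            using irreducible_forms[OF S sub(1) irr(1) form_fun_meval[OF g(1)] form_fun_meval[OF p] that] by blast
        qed
      qed
      moreover have "Suc b ^ Suc n \<le> Suc b * hilb ?V (cone d (Z n)) (\<kappa> * b)"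
        using \<kappa>[of b] by (simp only: power_Suc mult_le_mono2)
      ultimately show ?thesis by (simp add: algebra_simps)
    qed
    then show ?case by blast
  }
qed

text \<open>On \<open>A\<close> a form is determined by its pullbacks to the finitely many charts in
  \<open>C\<close>, and each pullback has degree at most \<open>m * D\<close> in each of at most
  \<open>N\<close> variables. The charts may overlap and need not be injective.\<close>

lemma hilb_param_le:
  fixes y :: "'c \<Rightarrow> ('v \<Rightarrow> 'a::field) \<Rightarrow> 'j \<Rightarrow> 'a"
  assumes "finite V" "finite C"
    and W: "\<And>c. c \<in> C \<Longrightarrow> finite (W c)" "\<And>c. c \<in> C \<Longrightarrow> card (W c) \<le> N"
    and y: "\<And>c j. c \<in> C \<Longrightarrow> j \<in> V \<Longrightarrow> (\<lambda>x. y c x j) \<in> poly_funs (W c) D"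
    and cover: "\<And>p n. p \<in> hpolys V n \<Longrightarrow> (\<And>c x. c \<in> C \<Longrightarrow> meval (y c x) p = 0) \<Longrightarrow> \<forall>z\<in>A. meval z p = 0"
  shows "hilb V A m \<le> card C * Suc (m * D) ^ N"
proof -
  \<comment> \<open>The pullbacks to all charts are combined to one function on the disjoint union
    of the charts; \<open>?i c\<close> extends a function on the chart \<open>c\<close> by
    zero.\<close>
  let ?b = "\<lambda>p (c, x). if c \<in> C then meval (y c x) p else 0"
  let ?mon = "\<lambda>c. monomials (W c) (m * D) :: (('v \<Rightarrow> 'a) \<Rightarrow> 'a) set"
  let ?i = "\<lambda>c h (c', x :: 'v \<Rightarrow> 'a). if c' = c then h x else (0 :: 'a)"
  let ?T = "\<Union>c\<in>C. ?i c ` ?mon c"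
  have lin_b: "Vector_Spaces.linear mscale fscale ?b"
    by (rule linearI[OF mp.vector_space_axioms fs.vector_space_axioms])
      (auto simp: fscale_def fun_eq_iff meval_add meval_mscale)
  have lin_i: "Vector_Spaces.linear fscale fscale (?i c)" for c
    by (rule linearI[OF fs.vector_space_axioms fs.vector_space_axioms])
      (auto simp: fscale_def fun_eq_iff)
  obtain B where B: "finite B" "hpolys V m \<subseteq> mp.span (B :: ('j, 'a) mpoly set)"
    using hpolys_finite_span[OF assms(1)] by metis
  have "hilb V A m \<le> fs.dim (?b ` hpolys V m)"
    unfolding hilb_def
  proof (rule dim_image_le_of_kernel[OF mp_fs mp_fs linear_restr lin_b subspace_hpolys B(2,1)])
    fix p assume p: "p \<in> hpolys V m" "?b p = 0"
    have "meval (y c x) p = 0" if "c \<in> C" for c x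
      using that fun_cong[OF p(2), of "(c, x)"] by simp
    then show "restr A p = 0" using cover[OF p(1)] by (auto simp: restr_def)
  qed
  also have "\<dots> \<le> card ?T"
  proof (rule fs.dim_le_card)
    show "finite ?T" using assms(2) W(1) by (intro finite_UN_I finite_imageI finite_PiE) auto
    show "?b ` hpolys V m \<subseteq> fs.span ?T"
    proof (rule image_subsetI)
      fix p :: "('j, 'a) mpoly" assume p: "p \<in> hpolys V m"
      have "?b p = (\<Sum>c\<in>C. ?i c (\<lambda>x. meval (y c x) p))"
      proof
        fix z :: "'c \<times> ('v \<Rightarrow> 'a)"
        obtain c x where z: "z = (c, x)" by (cases z)
        have "(\<Sum>c'\<in>C. ?i c' (\<lambda>x. meval (y c' x) p)) z = (\<Sum>c'\<in>C. if c' = c then meval (y c' x) p else 0)"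
          unfolding sum_fun_apply z by (intro sum.cong) auto
        then show "?b p z = (\<Sum>c\<in>C. ?i c (\<lambda>x. meval (y c x) p)) z"
          using assms(2) by (simp add: z)
      qed
      also have "\<dots> \<in> fs.span ?T"
      proof (rule fs.span_sum)
        fix c assume c: "c \<in> C"
        interpret i: Vector_Spaces.linear fscale fscale "?i c" by (rule lin_i)
        have "(\<lambda>x. meval (y c x) p) \<in> poly_funs (W c) (m * D)"
          using poly_funs_form[OF form_fun_meval[OF p], of "y c" "W c" D] y[OF c] by blast
        then have "?i c (\<lambda>x. meval (y c x) p) \<in> fs.span (?i c ` ?mon c)"
          unfolding poly_funs_def i.span_image by (rule imageI)
        moreover have "fs.span (?i c ` ?mon c) \<subseteq> fs.span ?T"
          by (rule fs.span_mono, rule UN_upper[OF c])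
        ultimately show "?i c (\<lambda>x. meval (y c x) p) \<in> fs.span ?T" by (rule subsetD[rotated])
      qed
      finally show "?b p \<in> fs.span ?T" .
    qed
  qed
  also have "card ?T \<le> (\<Sum>c\<in>C. card (?i c ` ?mon c))"
    by (rule card_UN_le[OF assms(2)])
  also have "\<dots> \<le> (\<Sum>c\<in>C. Suc (m * D) ^ N)"
  proof (rule sum_mono)
    fix c assume c: "c \<in> C"
    have "card (?i c ` ?mon c) \<le> card (?mon c)"
      by (rule card_image_le[OF card_monomials_le(1)[OF W(1)[OF c]]])
    also have "\<dots> \<le> Suc (m * D) ^ card (W c)" by (rule card_monomials_le(2)[OF W(1)[OF c]])
    also have "\<dots> \<le> Suc (m * D) ^ N" by (rule power_increasing[OF W(2)[OF c]]) simp
    finally show "card (?i c ` ?mon c) \<le> Suc (m * D) ^ N" .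
  qed
  finally show ?thesis by simp
qed

lemma power_growth_le:
  assumes "\<And>b. Suc b ^ n \<le> C * Suc (k * b * D) ^ N"
  shows "n \<le> N"
proof (rule ccontr)
  assume "\<not> n \<le> N"
  \<comment> \<open>The constant is chosen such that \<open>b = M\<close> already contradicts the
    assumption: \<open>Suc M ^ Suc N\<close> would be at most \<open>M * Suc M ^ N\<close>.\<close>
  define M where "M = C * Suc (k * D) ^ N"
  have "Suc M * Suc M ^ N = Suc M ^ Suc N" by simp
  also have "\<dots> \<le> Suc M ^ n" using \<open>\<not> n \<le> N\<close> by (intro power_increasing) auto
  also have "\<dots> \<le> C * Suc (k * M * D) ^ N" by (rule assms)
  also have "\<dots> \<le> C * (Suc (k * D) * Suc M) ^ N"
    by (intro mult_le_mono2 power_mono) (auto simp: algebra_simps)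
  also have "\<dots> = M * Suc M ^ N" by (simp only: M_def power_mult_distrib mult.assoc)
  finally show False by simp
qed

lemma krull_dim_le_param:
  fixes S :: "(nat, 'a::field_char_0) mpoly set set"
    and y :: "'c \<Rightarrow> ('v \<Rightarrow> 'a) \<Rightarrow> nat set \<Rightarrow> 'a"
  assumes S: "S \<subseteq> Gr t d" and "finite C"
    and W: "\<And>c. c \<in> C \<Longrightarrow> finite (W c)" "\<And>c. c \<in> C \<Longrightarrow> card (W c) \<le> N"
    and y: "\<And>c j. c \<in> C \<Longrightarrow> j \<in> pluecker_index t d \<Longrightarrow> (\<lambda>x. y c x j) \<in> poly_funs (W c) D"
    and cover: "\<And>\<Lambda>. \<Lambda> \<in> S \<Longrightarrow> \<exists>c\<in>C. \<exists>x bs. ordered_basis bs \<Lambda> \<and> pluecker d bs = y c x"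
  shows "krull_dim (subtopology (grassmann_zariski t d) S) \<le> enat N"
  unfolding krull_dim_def
proof (rule Sup_least, clarify)
  fix n and Z :: "nat \<Rightarrow> (nat, 'a) mpoly set set"
  let ?V = "pluecker_index t d"
  assume Z: "\<forall>i\<le>n. closedin (subtopology (grassmann_zariski t d) S) (Z i) \<and>
      irreducible_space (subtopology (subtopology (grassmann_zariski t d) S) (Z i))"
    "\<forall>i<n. Z i \<subset> Z (Suc i)"
  have "\<exists>\<kappa>. \<forall>b. Suc b ^ n \<le> hilb ?V (cone d (Z n)) (\<kappa> * b)"
    by (rule chain_hilb[OF S]) (use Z in auto)
  then obtain \<kappa> where \<kappa>: "Suc b ^ n \<le> hilb ?V (cone d (Z n)) (\<kappa> * b)" for b by blast
  have "Z n \<subseteq> S"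
    using Z(1) closedin_subset S by (fastforce simp: topspace_grassmann_zariski)
  then have sub: "cone d (Z n) \<subseteq> cone d S" by (auto simp: cone_def)
  have "hilb ?V (cone d S) m \<le> card C * Suc (m * D) ^ N" for m
  proof (rule hilb_param_le[OF finite_pluecker_index assms(2) W])
    show "(\<lambda>x. y c x j) \<in> poly_funs (W c) D" if "c \<in> C" "j \<in> ?V" for c j by (rule y[OF that])
    fix p :: "(nat set, 'a) mpoly" and k assume p: "p \<in> hpolys ?V k" "\<And>c x. c \<in> C \<Longrightarrow> meval (y c x) p = 0"
    have "vanishes d (\<lambda>z. meval z p) \<Lambda>" if \<Lambda>: "\<Lambda> \<in> S" for \<Lambda>
    proof -
      obtain c x bs where "c \<in> C" "ordered_basis bs \<Lambda>" "pluecker d bs = y c x"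
        using cover[OF \<Lambda>] by blast
      then show ?thesis
        using vanishes_iff[OF form_fun_meval[OF p(1)]] p(2) by metis
    qed
    then show "\<forall>z\<in>cone d S. meval z p = 0" by (simp add: zero_on_cone_iff)
  qed
  then have "Suc b ^ n \<le> card C * Suc (\<kappa> * b * D) ^ N" for b
    using \<kappa>[of b] hilb_mono[OF finite_pluecker_index sub] le_trans by blast
  then show "enat n \<le> enat N" using power_growth_le by (simp only: enat_ord_simps) blast
qed

section \<open>Lower bounds for the dimension\<close>

text \<open>The last assumption on \<open>T\<close> makes it contain the line through any two of its
  points. If two proper closed subsets covered the closure, forms vanishing on them but not at the
  images of \<open>a\<close> and \<open>b\<close> would restrict to nonzero univariate polynomials
  on the line through \<open>a\<close> and \<open>b\<close>, although one of the two forms vanishes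
  at every point of that line.\<close>

lemma irreducible_closure_param:
  fixes S :: "(nat, 'a::field_char_0) mpoly set set" and \<phi> :: "('v \<Rightarrow> 'a) \<Rightarrow> (nat, 'a) mpoly set"
  assumes S: "S \<subseteq> Gr t d"
    and \<phi>: "\<And>x. \<phi> x \<in> S" "\<And>x. ordered_basis (bs x) (\<phi> x)"
    and poly: "\<And>J. J \<in> pluecker_index t d \<Longrightarrow> (\<lambda>x. pluecker d (bs x) J) \<in> poly_funs W D"
    and T: "a0 \<in> T" "\<And>a b \<tau>. a \<in> T \<Longrightarrow> b \<in> T \<Longrightarrow> (\<lambda>v. a v + \<tau> * (b v - a v)) \<in> T"
  defines "X \<equiv> subtopology (grassmann_zariski t d) S"
  shows "irreducible_space (subtopology X (X closure_of (\<phi> ` T)))"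
  unfolding irreducible_space_def
proof (intro conjI allI impI)
  let ?Z = "X closure_of (\<phi> ` T)"
  have top: "topspace X = S" using S by (auto simp: X_def topspace_grassmann_zariski)
  have topZ: "topspace (subtopology X ?Z) = ?Z"
    using closure_of_subset_topspace[of X "\<phi> ` T"] by auto
  have sub: "\<phi> ` T \<subseteq> ?Z" using closure_of_subset[of "\<phi> ` T" X] \<phi>(1) top by auto
  then show "topspace (subtopology X ?Z) \<noteq> {}" using T(1) topZ by auto
  fix A B assume A: "closedin (subtopology X ?Z) A" and B: "closedin (subtopology X ?Z) B"
    and un: "A \<union> B = topspace (subtopology X ?Z)"
  have clA: "closedin X A" and clB: "closedin X B"
    using A B closedin_trans_full[OF _ closedin_closure_of] by blast+
  have Z: "A \<subseteq> ?Z" "B \<subseteq> ?Z" using un topZ by auto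
  show "A = topspace (subtopology X ?Z) \<or> B = topspace (subtopology X ?Z)"
  proof (rule ccontr)
    assume "\<not> ?thesis"
    then have "A \<noteq> ?Z" "B \<noteq> ?Z" using topZ by auto
    then have "\<not> \<phi> ` T \<subseteq> A" "\<not> \<phi> ` T \<subseteq> B"
      using closure_of_minimal[OF _ clA, of "\<phi> ` T"] closure_of_minimal[OF _ clB, of "\<phi> ` T"] Z by auto
    then obtain a b where ab: "a \<in> T" "\<phi> a \<notin> A" "b \<in> T" "\<phi> b \<notin> B" by blast
    obtain m F where F: "form_fun (pluecker_index t d) m F" "\<And>\<Lambda>. \<Lambda> \<in> A \<Longrightarrow> vanishes d F \<Lambda>" "\<not> vanishes d F (\<phi> a)"
      using form_separating_closed[OF clA[unfolded X_def] S \<phi>(1) ab(2)] by metis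
    obtain n G where G: "form_fun (pluecker_index t d) n G" "\<And>\<Lambda>. \<Lambda> \<in> B \<Longrightarrow> vanishes d G \<Lambda>" "\<not> vanishes d G (\<phi> b)"
      using form_separating_closed[OF clB[unfolded X_def] S \<phi>(1) ab(4)] by metis
    have f: "(\<lambda>x. F (pluecker d (bs x))) \<in> poly_funs W (m * D)"
      by (rule poly_funs_form[OF F(1) poly])
    have g: "(\<lambda>x. G (pluecker d (bs x))) \<in> poly_funs W (n * D)"
      by (rule poly_funs_form[OF G(1) poly])
    have "F (pluecker d (bs a)) \<noteq> 0" "G (pluecker d (bs b)) \<noteq> 0"
      using F(3) G(3) vanishes_iff[OF F(1) \<phi>(2)] vanishes_iff[OF G(1) \<phi>(2)] by auto
    then obtain \<tau> where \<tau>: "F (pluecker d (bs (\<lambda>v. a v + \<tau> * (b v - a v)))) * G (pluecker d (bs (\<lambda>v. a v + \<tau> * (b v - a v)))) \<noteq> 0"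
      by (rule poly_funs_mult_nonzero[OF f g])
    let ?c = "\<lambda>v. a v + \<tau> * (b v - a v)"
    have "\<phi> ?c \<in> A \<union> B" using T(2)[OF ab(1,3)] sub un topZ by blast
    then have "F (pluecker d (bs ?c)) = 0 \<or> G (pluecker d (bs ?c)) = 0"
      using F(2) G(2) vanishes_iff[OF F(1) \<phi>(2)] vanishes_iff[OF G(1) \<phi>(2)] by blast
    then show False using \<tau> by auto
  qed
qed

text \<open>The chain consists of the closures of the images of a flag of coordinate subspaces.\<close>

lemma krull_dim_ge_param:
  fixes S :: "(nat, 'a::field_char_0) mpoly set set" and \<phi> :: "('v \<Rightarrow> 'a) \<Rightarrow> (nat, 'a) mpoly set"
  assumes S: "S \<subseteq> Gr t d"
    and \<phi>: "\<And>x. \<phi> x \<in> S" "\<And>x. ordered_basis (bs x) (\<phi> x)"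
    and poly: "\<And>J. J \<in> pluecker_index t d \<Longrightarrow> (\<lambda>x. pluecker d (bs x) J) \<in> poly_funs W D"
    and sep: "\<And>i. i < N \<Longrightarrow> \<exists>n F. form_fun (pluecker_index t d) n F \<and>
        (\<forall>x. (\<forall>k. i \<le> k \<and> k < N \<longrightarrow> x (e k) = 0) \<longrightarrow> F (pluecker d (bs x)) = 0) \<and>
        (\<exists>x. (\<forall>k. i < k \<and> k < N \<longrightarrow> x (e k) = 0) \<and> F (pluecker d (bs x)) \<noteq> 0)"
  shows "enat N \<le> krull_dim (subtopology (grassmann_zariski t d) S)"
proof -
  define X where "X = subtopology (grassmann_zariski t d) S"
  define T where "T i = {x :: 'v \<Rightarrow> 'a. \<forall>k. i \<le> k \<and> k < N \<longrightarrow> x (e k) = 0}" for i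
  define Z where "Z i = X closure_of (\<phi> ` T i)" for i
  have top: "topspace X = S" using S by (auto simp: X_def topspace_grassmann_zariski)
  have "closedin X (Z i)" for i by (simp add: Z_def)
  moreover have "irreducible_space (subtopology X (Z i))" for i
    unfolding X_def Z_def
    by (rule irreducible_closure_param[OF S \<phi> poly, of "\<lambda>_. 0"]) (auto simp: T_def)
  moreover have "Z i \<subset> Z (Suc i)" if i: "i < N" for i
  proof
    show "Z i \<subseteq> Z (Suc i)"
      unfolding Z_def by (intro closure_of_mono image_mono) (auto simp: T_def)
    \<comment> \<open>\<open>F\<close> vanishes on the image of \<open>T i\<close>, hence on its
      closure, and is nonzero at the image of a point of \<open>T (Suc i)\<close>.\<close>
    from sep[OF i] obtain n F x where F: "form_fun (pluecker_index t d) n F"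
        "\<forall>x. (\<forall>k. i \<le> k \<and> k < N \<longrightarrow> x (e k) = 0) \<longrightarrow> F (pluecker d (bs x)) = 0"
      and x: "\<forall>k. i < k \<and> k < N \<longrightarrow> x (e k) = 0" "F (pluecker d (bs x)) \<noteq> 0"
      by (elim exE conjE)
    have "\<phi> ` T i \<subseteq> {\<Lambda> \<in> S. vanishes d F \<Lambda>}"
      using F(2) \<phi>(1) vanishes_iff[OF F(1) \<phi>(2)] by (auto simp: T_def)
    then have "Z i \<subseteq> {\<Lambda> \<in> S. vanishes d F \<Lambda>}"
      unfolding Z_def X_def by (rule closure_of_minimal[OF _ closed_vanishing[OF F(1) S]])
    moreover have "\<phi> x \<in> Z (Suc i)"
    proof -
      have "\<phi> ` T (Suc i) \<subseteq> topspace X" using \<phi>(1) top by auto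
      moreover have "x \<in> T (Suc i)" using x(1) by (auto simp: T_def)
      ultimately show ?thesis unfolding Z_def using closure_of_subset by blast
    qed
    ultimately show "Z i \<noteq> Z (Suc i)"
      using x(2) vanishes_iff[OF F(1) \<phi>(2)] by blast
  qed
  ultimately have "\<exists>Z. (\<forall>i\<le>N. closedin X (Z i) \<and> irreducible_space (subtopology X (Z i))) \<and> (\<forall>i<N. Z i \<subset> Z (Suc i))"
    by (intro exI[of _ Z]) simp
  then show ?thesis
    unfolding krull_dim_def X_def[symmetric] by (intro Sup_upper) blast
qed

section \<open>Charts\<close>

text \<open>
  The spaces of solutions of a recurrence of order \<open>j\<close> in the window \<open>{j..<j + m}\<close> that are
  spanned by a basis dual to \<open>P\<close>: the variables \<open>Inl l\<close> are the coefficients of the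
  recurrence, \<open>Inr (p, q)\<close> is the coordinate \<open>q\<close> of the basis vector \<open>p\<close>.
\<close>

type_synonym 'a chart_point = "nat + nat \<times> nat \<Rightarrow> 'a"

definition chart_row :: "nat \<Rightarrow> nat \<Rightarrow> nat set \<Rightarrow> ('a::field chart_point) \<Rightarrow> nat \<Rightarrow> nat \<Rightarrow> 'a" where
  "chart_row j m P x p = rec_ext j m (\<lambda>l. x (Inl l))
     (\<lambda>q. if q \<in> P then (if p = q then 1 else 0) else x (Inr (p, q)))"

definition chart_basis ::
  "nat \<Rightarrow> nat \<Rightarrow> nat \<Rightarrow> nat set \<Rightarrow> ('a::field chart_point) \<Rightarrow> (nat, 'a) mpoly list" where
  "chart_basis d j m P x = map (\<lambda>p. form_of d (chart_row j m P x p)) (sorted_list_of_set P)"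

definition chart_vars :: "nat \<Rightarrow> nat \<Rightarrow> nat \<Rightarrow> nat set \<Rightarrow> (nat + nat \<times> nat) set" where
  "chart_vars d j m P = Inl ` {..<j} \<union> Inr ` (P \<times> ({0..d} - {j..<j + m} - P))"

lemma finite_chart_vars: "finite P \<Longrightarrow> finite (chart_vars d j m P)"
  by (simp add: chart_vars_def)

text \<open>For \<open>t\<close> pivots, \<open>j = s\<close> and \<open>m = d - s + 1\<close> the
  count is \<open>s + t * (s - t)\<close>. The empty window \<open>j = m = 0\<close> gives the
  \<open>t * (d - t + 1)\<close> entries of an affine chart of the Grassmannian if
  \<open>t \<le> d\<close>.\<close>

lemma card_chart_vars:
  assumes "P \<subseteq> {0..d} - {j..<j + m}" "j + m \<le> Suc d"
  shows "card (chart_vars d j m P) = j + card P * (Suc d - m - card P)"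
proof -
  have fin: "finite P" using assms(1) finite_subset by blast
  have "card ({0..d} - {j..<j + m}) = Suc d - m"
    using assms(2) by (subst card_Diff_subset) auto
  then have "card ({0..d} - {j..<j + m} - P) = Suc d - m - card P"
    using assms(1) fin by (subst card_Diff_subset) auto
  then show ?thesis
    unfolding chart_vars_def using fin
    by (subst card_Un_disjoint) (auto simp: card_image card_cartesian_product)
qed

lemma chart_row_pivot:
  "p \<in> P \<Longrightarrow> q \<in> P \<Longrightarrow> P \<inter> {j..<j + m} = {} \<Longrightarrow> chart_row j m P x p q = (if p = q then 1 else 0)"
  unfolding chart_row_def by (subst rec_ext_outside) auto

lemma chart_row_var:
  "q \<notin> P \<Longrightarrow> q \<notin> {j..<j + m} \<Longrightarrow> chart_row j m P x p q = x (Inr (p, q))"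
  unfolding chart_row_def by (subst rec_ext_outside) auto

lemma chart_row_rec:
  "i < m \<Longrightarrow> chart_row j m P x p (i + j) = - (\<Sum>l<j. x (Inl l) * chart_row j m P x p (i + l))"
  unfolding chart_row_def by (rule rec_ext_inside)

text \<open>A step of the recurrence multiplies by one variable and refers only to smaller indices,
  so the degree grows by at most one with the index.\<close>

lemma chart_row_poly:
  assumes "finite P" "p \<in> P" "i \<le> d"
  shows "(\<lambda>x. chart_row j m P x p i :: 'a::field) \<in> poly_funs (chart_vars d j m P) (Suc i)"
  using assms(3)
proof (induction i rule: less_induct)
  case (less i)
  let ?W = "chart_vars d j m P"
  have fin: "finite ?W" using assms(1) by (rule finite_chart_vars)
  have var: "(\<lambda>x :: 'a chart_point. x w) \<in> poly_funs ?W (Suc k)" if "w \<in> ?W" for w k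
    using poly_funs_var[OF fin that] poly_funs_mono[of 1 "Suc k" ?W] by auto
  show ?case
  proof (cases "i \<in> {j..<j + m}")
    case True
    then have i: "i - j < m" "i - j + j = i" by auto
    have "chart_row j m P x p i = (- 1) * (\<Sum>l<j. x (Inl l) * chart_row j m P x p (i - j + l))"
      for x :: "'a chart_point"
      using chart_row_rec[OF i(1), of j P x p] i(2) by simp
    then have "(\<lambda>x. chart_row j m P x p i) = (\<lambda>x :: 'a chart_point. (- 1) * (\<Sum>l<j. x (Inl l) * chart_row j m P x p (i - j + l)))"
      by (rule ext)
    also have "\<dots> \<in> poly_funs ?W (Suc i)"
    proof (intro poly_funs_cmult poly_funs_sum)
      fix l assume l: "l \<in> {..<j}"
      then have "Inl l \<in> ?W" by (simp add: chart_vars_def)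
      moreover have lt: "i - j + l < i" using True l by auto
      then have "(\<lambda>x. chart_row j m P x p (i - j + l) :: 'a) \<in> poly_funs ?W (Suc (i - j + l))"
        using less by auto
      ultimately have "(\<lambda>x. x (Inl l) * chart_row j m P x p (i - j + l) :: 'a) \<in> poly_funs ?W (1 + Suc (i - j + l))"
        using poly_funs_var[OF fin] by (intro poly_funs_mult)
      moreover have "1 + Suc (i - j + l) \<le> Suc i" using lt by simp
      ultimately show "(\<lambda>x. x (Inl l) * chart_row j m P x p (i - j + l) :: 'a) \<in> poly_funs ?W (Suc i)"
        using poly_funs_mono by blast
    qed
    finally show ?thesis .
  next
    case False
    show ?thesis
    proof (cases "i \<in> P")
      case True
      then have "(\<lambda>x. chart_row j m P x p i) = (\<lambda>x :: 'a chart_point. if p = i then 1 else 0)"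
        using False unfolding chart_row_def by (subst rec_ext_outside) auto
      then show ?thesis by (simp add: poly_funs_const)
    next
      case F: False
      then have "Inr (p, i) \<in> ?W" using False assms(2) less.prems by (auto simp: chart_vars_def)
      then show ?thesis by (simp add: var chart_row_var[OF F False])
    qed
  qed
qed

lemma chart_basis_props:
  fixes x :: "'a::field_char_0 chart_point"
  assumes "P \<subseteq> {0..d} - {j..<j + m}"
  shows "ordered_basis (chart_basis d j m P x) (mp.span (set (chart_basis d j m P x)))"
    "normalized d P (chart_basis d j m P x)"
    "mp.span (set (chart_basis d j m P x)) \<in> Gr (card P) d"
proof -
  let ?b = "\<lambda>p. form_of d (chart_row j m P x p)"
  have fin: "finite P" using assms finite_subset by blast
  have set: "set (chart_basis d j m P x) = ?b ` P" using fin by (simp add: chart_basis_def)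
  have dual: "dual_family d P ?b"
    unfolding dual_family_def
  proof (intro ballI)
    fix p q assume "p \<in> P" "q \<in> P"
    moreover have "P \<inter> {j..<j + m} = {}" "P \<subseteq> {..d}" using assms by auto
    ultimately show "dcoeff d (?b p) q = (if p = q then 1 else 0)"
      by (subst dcoeff_form_of) (auto simp: chart_row_pivot)
  qed
  have sub: "?b ` P \<subseteq> mp.span (?b ` P)" by (rule mp.span_superset)
  have span: "mp.span (?b ` P) \<subseteq> binary_forms d"
    by (rule mp.span_minimal[OF _ subspace_binary_forms]) (auto simp: form_of_in_binary_forms)
  have sep: "separated_by d P (mp.span (?b ` P))"
    unfolding separated_by_def
  proof (intro ballI impI)
    fix v assume v: "v \<in> mp.span (?b ` P)" "\<forall>p\<in>P. dcoeff d v p = 0"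
    then obtain u where "v = (\<Sum>b\<in>?b ` P. mscale (u b) b)"
      using fin by (auto simp: mp.span_finite)
    then have v_eq: "v = (\<Sum>p\<in>P. mscale (u (?b p)) (?b p))"
      by (simp add: sum.reindex dual_family_inj[OF dual])
    have "u (?b q) = 0" if "q \<in> P" for q
    proof -
      have "0 = dcoeff d (\<Sum>p\<in>P. mscale (u (?b p)) (?b p)) q"
        using v(2) that v_eq by simp
      also have "\<dots> = (\<Sum>p\<in>P. if p = q then u (?b p) else 0)"
        unfolding dcoeff_sum dcoeff_mscale
        using dual that by (intro sum.cong) (auto simp: dual_family_def)
      finally show ?thesis using fin that by simp
    qed
    then show "v = 0" unfolding v_eq by (intro sum.neutral) simp
  qed
  show "ordered_basis (chart_basis d j m P x) (mp.span (set (chart_basis d j m P x)))"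
    "normalized d P (chart_basis d j m P x)"
    unfolding set unfolding chart_basis_def
    by (rule normalized_ordered_basis[OF fin dual sub mp.subspace_span sep])+
  show "mp.span (set (chart_basis d j m P x)) \<in> Gr (card P) d"
    unfolding set grassmannian_def
    using dual_family_basis(2)[OF fin dual sub mp.subspace_span sep] span by simp
qed

lemma chart_basis_nth:
  assumes "finite P" "k < card P"
  shows "chart_basis d j m P x ! k = form_of d (chart_row j m P x (sorted_list_of_set P ! k))"
  using assms by (simp add: chart_basis_def)

lemma chart_pluecker_poly:
  assumes "P \<subseteq> {0..d}" "J \<in> pluecker_index (card P) d"
  shows "(\<lambda>x :: 'a::field_char_0 chart_point. pluecker d (chart_basis d j m P x) J)
    \<in> poly_funs (chart_vars d j m P) (card P * Suc d)"
proof -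
  have fin: "finite P" "finite J" using assms finite_subset by auto
  have len: "length (chart_basis d j m P x) = card P" for x :: "'a chart_point"
    using fin by (simp add: chart_basis_def)
  show ?thesis
    unfolding pluecker_def len
  proof (rule poly_funs_det)
    fix i k assume ik: "i < card P" "k < card P"
    let ?p = "sorted_list_of_set P ! i" and ?q = "sorted_list_of_set J ! k"
    have p: "?p \<in> P" using ik fin nth_mem[of i "sorted_list_of_set P"] by simp
    have "?q \<in> J" using ik fin assms nth_mem[of k "sorted_list_of_set J"] by simp
    then have q: "?q \<le> d" using assms(2) by auto
    have "(\<lambda>x. chart_row j m P x ?p ?q :: 'a) \<in> poly_funs (chart_vars d j m P) (Suc d)"
      using chart_row_poly[OF fin(1) p q] poly_funs_mono[of "Suc ?q" "Suc d"] q by auto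
    then show "(\<lambda>x. form_coeff d (chart_basis d j m P x ! i) ?q :: 'a) \<in> poly_funs (chart_vars d j m P) (Suc d)"
      by (simp add: chart_basis_nth[OF fin(1) ik(1)] form_coeff_form_of[OF q] poly_funs_cmult)
  qed
qed

text \<open>The coordinates outside the window separate \<Lambda>, so the pivots can be chosen among
  them. The chart parameters are then the given recurrence coefficients and the entries of the dual
  basis.\<close>

lemma chart_cover:
  fixes \<Lambda> :: "(nat, 'a::field_char_0) mpoly set"
  assumes "\<Lambda> \<in> Gr t d"
    and rec: "\<And>v i. v \<in> \<Lambda> \<Longrightarrow> i < m \<Longrightarrow> dcoeff d v (i + j) = - (\<Sum>l<j. c l * dcoeff d v (i + l))"
  obtains P x where "P \<subseteq> {0..d} - {j..<j + m}" "card P = t" "ordered_basis (chart_basis d j m P x) \<Lambda>"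
proof -
  have \<Lambda>: "mp.subspace \<Lambda>" "\<Lambda> \<subseteq> binary_forms d" "mp.dim \<Lambda> = t"
    using assms(1) by (auto simp: grassmannian_def)
  obtain P b where P: "P \<subseteq> {..d} - {j..<j + m}" "dual_family d P b" "b ` P \<subseteq> \<Lambda>" "separated_by d P \<Lambda>"
    by (rule exists_dual_family[OF \<Lambda>(1) _ recurrence_separated[where m = m and j = j and c = c, OF \<Lambda>(2) rec]]) auto
  have fin: "finite P" using P(1) finite_subset by blast
  define x where "x v = (case v of Inl l \<Rightarrow> c l | Inr (p, q) \<Rightarrow> dcoeff d (b p) q)" for v
  have "form_of d (chart_row j m P x p) = b p" if p: "p \<in> P" for p
  proof -
    have "b p \<in> \<Lambda>" using p P(3) by auto
    have "dcoeff d (b p) i = chart_row j m P x p i" if "i \<le> d" for i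
      unfolding chart_row_def
    proof (rule rec_ext_unique[OF _ _ that])
      show "dcoeff d (b p) (i + j) = - (\<Sum>l<j. x (Inl l) * dcoeff d (b p) (i + l))" if "i < m" for i
        using rec[OF \<open>b p \<in> \<Lambda>\<close> that] by (simp add: x_def)
      show "dcoeff d (b p) i = (if i \<in> P then if p = i then 1 else 0 else x (Inr (p, i)))" for i
        using P(2) p by (auto simp: dual_family_def x_def)
    qed
    then show ?thesis
      using \<open>b p \<in> \<Lambda>\<close> \<Lambda>(2) by (intro binary_forms_eqI[OF form_of_in_binary_forms]) (auto simp: dcoeff_form_of)
  qed
  then have "chart_basis d j m P x = map b (sorted_list_of_set P)"
    using fin by (simp add: chart_basis_def)
  then have "ordered_basis (chart_basis d j m P x) \<Lambda>"
    using normalized_ordered_basis(1)[OF fin P(2,3) \<Lambda>(1) P(4)] by simp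
  moreover have "P \<subseteq> {0..d} - {j..<j + m}" using P(1) by auto
  moreover have "card P = t" using dual_family_basis(2)[OF fin P(2,3) \<Lambda>(1) P(4)] \<Lambda>(3) by simp
  ultimately show thesis by (rule that[rotated 2])
qed

lemma chart_entry_form:
  assumes "P \<subseteq> {0..d} - {j..<j + m}" "p \<in> P" "q \<le> d"
  obtains F :: "(nat set \<Rightarrow> 'a::field_char_0) \<Rightarrow> 'a" where "form_fun (pluecker_index (card P) d) 1 F"
    "\<And>x. F (pluecker d (chart_basis d j m P x)) = chart_row j m P x p q"
proof -
  have fin: "finite P" using assms(1) finite_subset by blast
  obtain k where k: "k < card P" "sorted_list_of_set P ! k = p"
    using assms(2) fin by (metis in_set_conv_nth sorted_list_of_set.length_sorted_key_list_of_set sorted_list_of_set.set_sorted_key_list_of_set)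
  have "P \<subseteq> {0..d}" using assms(1) by auto
  then obtain F :: "(nat set \<Rightarrow> 'a) \<Rightarrow> 'a" where F: "form_fun (pluecker_index (card P) d) 1 F"
    "\<And>bs. normalized d P bs \<Longrightarrow> F (pluecker d bs) = dcoeff d (bs ! k) q"
    using entry_form[OF _ k(1) assms(3)] by metis
  show thesis
    by (rule that[OF F(1)])
      (simp add: F(2)[OF chart_basis_props(2)[OF assms(1)]] chart_basis_nth[OF fin k(1)] k(2) dcoeff_form_of[OF assms(3)])
qed

section \<open>The recurrence of a chart and its recovery from the Pluecker coordinates\<close>

lemma chart_basis_apolar:
  fixes x :: "'a::field_char_0 chart_point"
  assumes "s \<le> d"
  obtains g where "g \<noteq> 0" "degree g \<le> s"
    "mp.span (set (chart_basis d s (d - s + 1) P x)) \<subseteq> apolar_space d s g"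
proof -
  define g where "g = monom 1 s + (\<Sum>l<s. monom (x (Inl l)) l)"
  have cg: "coeff g l = (if l = s then 1 else if l < s then x (Inl l) else 0)" for l
  proof -
    have "(\<Sum>k<s. coeff (monom (x (Inl k)) k) l) = (\<Sum>k<s. if k = l then x (Inl k) else 0)"
      by (rule sum.cong) auto
    then show ?thesis by (simp add: g_def coeff_sum)
  qed
  have deg: "degree g = s"
    by (rule antisym[OF degree_le le_degree]) (auto simp: cg)
  then have lead: "lead_coeff g = 1" by (simp add: cg)
  have "form_of d (chart_row s (d - s + 1) P x p) \<in> apolar_space d s g" for p
    unfolding apolar_space_monic[OF deg lead order_refl]
  proof (intro conjI allI impI form_of_in_binary_forms)
    fix i assume i: "i < d - s + 1"
    then show "dcoeff d (form_of d (chart_row s (d - s + 1) P x p)) (i + s)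
        = - (\<Sum>l<s. coeff g l * dcoeff d (form_of d (chart_row s (d - s + 1) P x p)) (i + l))"
      using assms chart_row_rec[OF i, of s P x p] by (simp add: dcoeff_form_of cg)
  qed
  then have "mp.span (set (chart_basis d s (d - s + 1) P x)) \<subseteq> apolar_space d s g"
    by (intro mp.span_minimal subspace_apolar_space) (auto simp: chart_basis_def)
  moreover have "g \<noteq> 0" using lead by auto
  ultimately show thesis using that deg by simp
qed

text \<open>
  The coefficient \<open>i\<close> of the recurrence is a quotient of two minors of the matrix with entries
  \<open>chart_row s (d - s + 1) P x p (l + h)\<close>, where \<open>(p, l)\<close> indexes the rows: in the numerator the column
  \<open>h = i\<close> is replaced by \<open>h = s\<close>, which is a combination of the others. The rows are chosen
  such that the denominator is \<open>1\<close> when the variables \<open>Inr _\<close> vanish.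
\<close>

lemma chart_coefficient_form:
  assumes P: "P \<subseteq> {..<s}" "s \<le> d" "\<forall>q<s. \<exists>p\<in>P. q \<le> p \<and> p \<le> q + (d - s)" and i: "i < s"
  shows "\<exists>n F. form_fun (pluecker_index (card P) d) n F \<and>
    (\<forall>x :: 'a::field_char_0 chart_point. (\<forall>h. i \<le> h \<and> h < s \<longrightarrow> x (Inl h) = 0) \<longrightarrow>
       F (pluecker d (chart_basis d s (d - s + 1) P x)) = 0) \<and>
    F (pluecker d (chart_basis d s (d - s + 1) P (\<lambda>v. if v = Inl i then 1 else 0))) \<noteq> 0"
proof -
  let ?y = "\<lambda>x :: 'a chart_point. pluecker d (chart_basis d s (d - s + 1) P x)"
  have P': "P \<subseteq> {0..d} - {s..<s + (d - s + 1)}" using P(1,2) by auto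
  \<comment> \<open>The pivot \<open>p q\<close> lies at most \<open>d - s\<close> above
    \<open>q\<close>, so \<open>p q - q\<close> is an admissible index of the recurrence, which then
    relates the entries \<open>r q 0\<close>, ..., \<open>r q s\<close>.\<close>
  from P(3) obtain p where p: "\<And>q. q < s \<Longrightarrow> p q \<in> P \<and> q \<le> p q \<and> p q \<le> q + (d - s)" by metis
  define r where "r q c x = chart_row s (d - s + 1) P x (p q) (p q - q + c)" for q c and x :: "'a chart_point"
  have ex: "\<exists>F :: (nat set \<Rightarrow> 'a) \<Rightarrow> 'a. form_fun (pluecker_index (card P) d) 1 F \<and>
      (\<forall>x. F (?y x) = r q c x)" if "q < s" "c \<le> s" for q c
  proof -
    have pq: "p q \<in> P" "p q - q + c \<le> d" using p[OF that(1)] that(2) P(2) by auto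
    obtain F :: "(nat set \<Rightarrow> 'a) \<Rightarrow> 'a" where "form_fun (pluecker_index (card P) d) 1 F"
      "\<And>x. F (?y x) = chart_row s (d - s + 1) P x (p q) (p q - q + c)"
      by (rule chart_entry_form[OF P' pq]) (rule that)
    then show ?thesis unfolding r_def by (intro exI[of _ F]) simp
  qed
  define F where "F q c = (SOME F :: (nat set \<Rightarrow> 'a) \<Rightarrow> 'a. form_fun (pluecker_index (card P) d) 1 F \<and>
      (\<forall>x. F (?y x) = r q c x))" for q c
  have F: "form_fun (pluecker_index (card P) d) 1 (F q c)"
    "F q c (?y x) = r q c x" if "q < s" "c \<le> s" for q c x
    using someI_ex[OF ex[OF that]] unfolding F_def by auto
  define n where "n = Suc i"
  define col where "col b = (if b < i then b else s)" for b
  define G where "G y = det (mat n n (\<lambda>(a, b). F a (col b) y))" for y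
  have formG: "form_fun (pluecker_index (card P) d) (1 * n) G"
    unfolding G_def using i by (intro form_fun_det F(1)) (auto simp: n_def col_def)
  have G_eq: "G (?y x)
      = - x (Inl i) * det (mat n n (\<lambda>(a, b). r a b x))"
    if x: "\<forall>h. i < h \<and> h < s \<longrightarrow> x (Inl h) = 0" for x
  proof -
    let ?M = "mat n n (\<lambda>(a, b). r a b x)"
    let ?v = "vec n (\<lambda>b. - x (Inl b))"
    \<comment> \<open>As the variables \<open>Inl h\<close> beyond \<open>i\<close> are zero, column
      \<open>s\<close> is a combination of the first \<open>n\<close> columns, with coefficient
      \<open>- x (Inl i)\<close> at column \<open>i\<close>; Cramer's rule isolates that
      coefficient.\<close>
    have rs: "r a s x = (\<Sum>b<n. r a b x * - x (Inl b))" if "a < n" for a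
    proof -
      have a: "a < s" using that i by (simp add: n_def)
      have "r a s x = - (\<Sum>l<s. x (Inl l) * r a l x)"
        unfolding r_def by (rule chart_row_rec) (use p[OF a] in linarith)
      also have "(\<Sum>l<s. x (Inl l) * r a l x) = (\<Sum>l<n. x (Inl l) * r a l x)"
        using i x by (intro sum.mono_neutral_right) (auto simp: n_def)
      finally show ?thesis by (simp add: sum_negf mult.commute)
    qed
    have "mat n n (\<lambda>(a, b). F a (col b) (?y x))
        = replace_col ?M (?M *\<^sub>v ?v) i"
    proof (rule eq_matI)
      fix a b assume "a < dim_row (replace_col ?M (?M *\<^sub>v ?v) i)" "b < dim_col (replace_col ?M (?M *\<^sub>v ?v) i)"
      then have ab: "a < n" "b < n" by (simp_all add: replace_col_def)
      have "F a (col b) (?y x) = r a (col b) x"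
        using ab i by (intro F(2)) (auto simp: n_def col_def)
      then show "mat n n (\<lambda>(a, b). F a (col b) (?y x)) $$ (a, b)
          = replace_col ?M (?M *\<^sub>v ?v) i $$ (a, b)"
        using ab rs[OF ab(1)]
        by (auto simp: replace_col_def col_def n_def scalar_prod_def lessThan_atLeast0)
    qed (simp_all add: replace_col_def)
    then have "G (?y x) = ?v $ i * det ?M"
      unfolding G_def by (simp only:) (rule cramer_lemma_mat, auto simp: n_def)
    then show ?thesis by (simp add: n_def)
  qed
  have disj: "P \<inter> {s..<s + (d - s + 1)} = {}" using P' by blast
  let ?x = "(\<lambda>v. if v = Inl i then 1 else 0) :: 'a chart_point"
  \<comment> \<open>On and below the diagonal the index \<open>p a - a + b\<close> is at most
    \<open>p a\<close>, hence in front of the window, where the entries at \<open>?x\<close> are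
    zero except at the pivot itself. Entries above the diagonal may lie in the window; triangularity
    keeps them out of the determinant.\<close>
  have r_low: "r a b ?x = (if a = b then 1 else 0)" if "b \<le> a" "a < n" for a b
  proof -
    have a: "a < s" using that(2) i by (simp add: n_def)
    have lt: "p a - a + b < s" "p a \<in> P" "p a - a + b = p a \<longleftrightarrow> a = b"
      using p[OF a] that P(1) by auto
    show ?thesis
    proof (cases "p a - a + b \<in> P")
      case True
      then show ?thesis
        using chart_row_pivot[OF lt(2) True disj, of ?x] lt(3) unfolding r_def by auto
    next
      case False
      then show ?thesis
        using chart_row_var[OF False, of s "d - s + 1" ?x "p a"] lt unfolding r_def by auto
    qed
  qed
  have "det (mat n n (\<lambda>(a, b). r a b ?x)) = 1"
  proof -
    let ?M = "mat n n (\<lambda>(a, b). r a b ?x)"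
    have "upper_triangular ?M" using r_low by (auto simp: upper_triangular_def)
    then have "det ?M = prod_list (diag_mat ?M)"
      by (rule det_upper_triangular[of _ n]) simp
    also have "\<dots> = (\<Prod>a = 0..<n. ?M $$ (a, a))" by (simp add: prod_list_diag_prod)
    also have "\<dots> = 1" using r_low by (intro prod.neutral) auto
    finally show ?thesis .
  qed
  then have "G (?y ?x) \<noteq> 0"
    by (subst G_eq) auto
  moreover have "G (?y x) = 0"
    if "\<forall>h. i \<le> h \<and> h < s \<longrightarrow> x (Inl h) = 0" for x
    using that i by (subst G_eq) auto
  ultimately show ?thesis
    using formG by (intro exI[of _ "1 * n"] exI[of _ G]) blast
qed

text \<open>From \<open>s - 1\<close> downwards every \<open>(e + 1)\<close>-st place is taken.
  Since \<open>s \<le> t * (e + 1)\<close>, at most \<open>t\<close> places are used before the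
  bottom is reached, and arbitrary further places bring their number to \<open>t\<close>.\<close>

lemma exists_covering_pivots:
  assumes "s \<le> t * (e + 1)" "t \<le> s"
  obtains P where "P \<subseteq> {..<s}" "card P = t" "\<forall>q<s. \<exists>p\<in>P. q \<le> p \<and> p \<le> q + e"
proof -
  define p where "p k = s - 1 - (e + 1) * k" for k
  define P0 where "P0 = p ` {k. k < t \<and> (e + 1) * k < s}"
  have "P0 \<subseteq> {..<s}" by (auto simp: P0_def p_def)
  moreover have "card P0 \<le> t"
  proof -
    have "card P0 \<le> card {k. k < t \<and> (e + 1) * k < s}" unfolding P0_def by (rule card_image_le) simp
    also have "\<dots> \<le> card {..<t}" by (rule card_mono) auto
    finally show ?thesis by simp
  qed
  ultimately obtain P where P: "P0 \<subseteq> P" "P \<subseteq> {..<s}" "card P = t"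
    using exists_subset_between[of P0 t "{..<s}"] assms(2) by auto
  have "\<exists>p\<in>P. q \<le> p \<and> p \<le> q + e" if q: "q < s" for q
  proof -
    \<comment> \<open>\<open>k\<close> numbers the block of \<open>e + 1\<close> places, counted
      from the top, that contains \<open>q\<close>; the pivot \<open>p k\<close> is the topmost
      place of this block.\<close>
    define k where "k = (s - 1 - q) div (e + 1)"
    have 1: "(e + 1) * k + (s - 1 - q) mod (e + 1) = s - 1 - q" unfolding k_def by (rule mult_div_mod_eq)
    have 2: "(s - 1 - q) mod (e + 1) \<le> e" using mod_less_divisor[of "e + 1" "s - 1 - q"] by linarith
    have "(e + 1) * k < s" using 1 q by linarith
    moreover have "k < t"
    proof (rule ccontr)
      assume "\<not> k < t"
      then have "(e + 1) * t \<le> (e + 1) * k" by (intro mult_le_mono2) simp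
      then show False using assms(1) \<open>(e + 1) * k < s\<close> by (simp add: mult.commute)
    qed
    ultimately have "p k \<in> P" using P(1) by (auto simp: P0_def)
    moreover have "q \<le> p k" "p k \<le> q + e" using 1 2 q unfolding p_def by linarith+
    ultimately show ?thesis by blast
  qed
  then show thesis using that P by blast
qed

section \<open>Restriction of forms to the rational normal curve\<close>

definition poly_eval :: "('v \<Rightarrow> 'a::field poly) \<Rightarrow> ('v, 'a) mpoly \<Rightarrow> 'a poly" where
  "poly_eval y f = (\<Sum>m\<in>keys f. smult (lookup f m)
     (\<Prod>v\<in>keys m. y v ^ lookup m v))"

lemma poly_poly_eval: "poly (poly_eval y f) x = meval (\<lambda>v. poly (y v) x) f"
  by (simp add: poly_eval_def meval_def poly_sum poly_prod)

lemma poly_eqI_values: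
  fixes p q :: "'a::field_char_0 poly"
  assumes "\<And>x. poly p x = poly q x"
  shows "p = q"
  using assms poly_eq_poly_eq_iff by blast

lemma poly_eval_add:
  "poly_eval y (f + g) = poly_eval y f + poly_eval (y :: 'v \<Rightarrow> 'a::field_char_0 poly) g"
  by (rule poly_eqI_values) (simp add: poly_poly_eval meval_add)

lemma poly_eval_mscale:
  "poly_eval y (mscale c f) = smult c (poly_eval (y :: 'v \<Rightarrow> 'a::field_char_0 poly) f)"
  by (rule poly_eqI_values) (simp add: poly_poly_eval meval_mscale)

lemma poly_eval_mult:
  "poly_eval y (f * g) = poly_eval y f * poly_eval (y :: 'v \<Rightarrow> 'a::field_char_0 poly) g"
  by (rule poly_eqI_values) (simp add: poly_poly_eval meval_mult)

lemma linear_poly_eval: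
  "Vector_Spaces.linear mscale smult (poly_eval (y :: 'v \<Rightarrow> 'a::field_char_0 poly))"
  by (rule linearI[OF mp.vector_space_axioms pl.vector_space_axioms])
    (simp_all add: poly_eval_add poly_eval_mscale)

lemma sum_mod_poly: "(\<Sum>i\<in>A. f i) mod K = (\<Sum>i\<in>A. f i mod (K :: 'a::field poly))"
  by (induction A rule: infinite_finite_induct) (simp_all add: poly_mod_add_left)

lemma poly_eval_mod_cong:
  fixes K :: "'a::field poly"
  assumes "f \<in> mpolys V" "\<And>v. v \<in> V \<Longrightarrow> y v mod K = z v mod K"
  shows "poly_eval y f mod K = poly_eval z f mod K"
proof -
  have "(\<Prod>v\<in>keys m. y v ^ lookup m v) mod K
      = (\<Prod>v\<in>keys m. z v ^ lookup m v) mod K" if m: "m \<in> keys f" for m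
  proof -
    have "y v ^ k mod K = z v ^ k mod K" if "v \<in> keys m" for v k
    proof -
      have "v \<in> V" using that m assms(1) by (auto simp: mpolys_def)
      then show ?thesis using assms(2) by (metis power_mod)
    qed
    then have "(\<Prod>v\<in>keys m. y v ^ lookup m v mod K) mod K
      = (\<Prod>v\<in>keys m. z v ^ lookup m v mod K) mod K"
      by (simp cong: prod.cong)
    then show ?thesis by (simp only: mod_prod_eq)
  qed
  then show ?thesis
    unfolding poly_eval_def sum_mod_poly mod_smult_left by (simp cong: sum.cong)
qed

text \<open>
  A polynomial of degree \<open>j < s\<close> stands for a form of degree \<open>s\<close> with an \<open>(s - j)\<close>-fold zero at
  infinity, which only the second chart of the curve sees.
\<close>

definition curve :: "nat \<Rightarrow> nat \<Rightarrow> 'a::field poly" where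
  "curve d i = monom (of_nat (d choose i)) i"

definition curve_inf :: "nat \<Rightarrow> nat \<Rightarrow> 'a::field poly" where
  "curve_inf d i = monom (of_nat (d choose i)) (d - i)"

definition linear_form :: "'a::field \<Rightarrow> 'a \<Rightarrow> (nat, 'a) mpoly" where
  "linear_form \<alpha> \<beta> = single (single 1 1) \<alpha> + single (single 2 1) \<beta>"

lemma linear_form_in: "linear_form \<alpha> \<beta> \<in> binary_forms 1"
  unfolding linear_form_def binary_forms_def by (intro hpolys_add hpolys_single) auto

lemma linear_form_eq: "linear_form \<alpha> \<beta> = form_of 1 (\<lambda>i. if i = 1 then \<alpha> else \<beta>)"
  by (simp add: form_of_def linear_form_def add.commute)

lemma linear_form_nonzero:
  assumes "\<alpha> \<noteq> 0 \<or> \<beta> \<noteq> (0 :: 'a::field_char_0)"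
  shows "linear_form \<alpha> \<beta> \<noteq> 0"
proof
  assume "linear_form \<alpha> \<beta> = 0"
  then have "dcoeff 1 (form_of 1 (\<lambda>i. if i = 1 then \<alpha> else \<beta>)) i = 0" for i
    by (simp add: linear_form_eq)
  from this[of 0] this[of 1] show False using assms by (simp add: dcoeff_form_of)
qed

lemma linear_form_cases:
  assumes "L \<in> binary_forms 1"
  obtains \<alpha> \<beta> where "L = linear_form \<alpha> (\<beta> :: 'a::field_char_0)"
proof
  have "L = form_of 1 (dcoeff 1 L)" using form_of_dcoeff[OF assms] by simp
  also have "\<dots> = linear_form (dcoeff 1 L 1) (dcoeff 1 L 0)"
    by (simp add: form_of_def linear_form_def add.commute)
  finally show "L = linear_form (dcoeff 1 L 1) (dcoeff 1 L 0)" .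
qed

lemma single_power:
  fixes m :: "nat \<Rightarrow>\<^sub>0 nat"
  shows "single m (c :: 'a::field) ^ k = single (of_nat k * m) (c ^ k)"
  by (induction k) (simp_all add: mult_single algebra_simps)

lemma of_nat_mult_single: "of_nat k * single (v :: nat) (n :: nat) = single v (k * n)"
  by (subst of_nat_single) (simp add: mult_single)

lemma linear_form_power:
  "linear_form \<alpha> \<beta> ^ d = form_of d (\<lambda>i. \<alpha> ^ i * (\<beta> :: 'a::field) ^ (d - i))"
proof -
  have "of_nat k * single m (c :: 'a) = single m (of_nat k * c)" for m :: "nat \<Rightarrow>\<^sub>0 nat" and k c
    by (subst of_nat_single) (simp only: o_def mult_single add_0)
  then show ?thesis
    unfolding linear_form_def form_of_def binomial_ring
    by (intro sum.cong refl)
      (simp add: single_power of_nat_mult_single mult_single mult.assoc del: of_nat_diff One_nat_def)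
qed

lemma form_coeff_linear_power:
  "i \<le> d \<Longrightarrow> form_coeff d (linear_form \<alpha> \<beta> ^ d) i = of_nat (d choose i) * (\<alpha> ^ i * \<beta> ^ (d - i))"
  by (simp add: linear_form_power form_coeff_form_of)

lemma curve_ideal_meval:
  fixes f :: "(nat, 'a::field_char_0) mpoly"
  assumes "f \<in> vanishing_ideal d (rational_normal_curve d)" "\<alpha> \<noteq> 0 \<or> \<beta> \<noteq> 0"
  shows "meval (\<lambda>i. of_nat (d choose i) * (\<alpha> ^ i * \<beta> ^ (d - i))) f = 0"
proof -
  let ?L = "linear_form \<alpha> \<beta>"
  have "mp.span {?L ^ d} \<in> rational_normal_curve d"
    using linear_form_in linear_form_nonzero[OF assms(2)] by (auto simp: rational_normal_curve_def)
  moreover have "?L ^ d \<in> mp.span {?L ^ d}" by (simp add: mp.span_base)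
  ultimately have "meval (form_coeff d (?L ^ d)) f = 0"
    using assms(1) by (auto simp: vanishing_ideal_def)
  moreover have "f \<in> mpolys {0..d}" using assms(1) by (simp add: vanishing_ideal_def)
  then have "meval (form_coeff d (?L ^ d)) f = meval (\<lambda>i. of_nat (d choose i) * (\<alpha> ^ i * \<beta> ^ (d - i))) f"
    by (rule meval_cong) (simp add: form_coeff_linear_power)
  ultimately show ?thesis by simp
qed

lemma poly_eval_curve_zero:
  fixes f :: "(nat, 'a::field_char_0) mpoly"
  assumes "f \<in> vanishing_ideal d (rational_normal_curve d)"
  shows "poly_eval (curve d) f = 0" "poly_eval (curve_inf d) f = 0"
proof -
  show "poly_eval (curve d) f = 0"
    by (rule poly_eqI_values)
      (use curve_ideal_meval[OF assms, of _ 1] in \<open>simp add: poly_poly_eval curve_def poly_monom\<close>)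
  show "poly_eval (curve_inf d) f = 0"
    by (rule poly_eqI_values)
      (use curve_ideal_meval[OF assms, of 1] in \<open>simp add: poly_poly_eval curve_inf_def poly_monom\<close>)
qed

text \<open>Homogeneity carries the vanishing from the affine chart to all points with nonzero
  second coordinate. The point at infinity follows because a polynomial in \<gamma> that vanishes
  for all nonzero \<gamma> is zero.\<close>

lemma curve_idealI:
  fixes f :: "(nat, 'a::field_char_0) mpoly"
  assumes f: "f \<in> hpolys {0..d} n" and 0: "poly_eval (curve d) f = 0"
  shows "f \<in> vanishing_ideal d (rational_normal_curve d)"
  unfolding vanishing_ideal_def
proof (clarsimp simp: hpolys_mpolys[OF f])
  fix l and v :: "(nat, 'a) mpoly" assume "l \<in> rational_normal_curve d" "v \<in> l"
  then obtain L where L: "L \<in> binary_forms 1" "v \<in> mp.span {L ^ d}"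
    by (auto simp: rational_normal_curve_def)
  obtain \<alpha> \<beta> where "L = linear_form \<alpha> \<beta>" using linear_form_cases[OF L(1)] by metis
  then obtain c where v: "v = mscale c (linear_form \<alpha> \<beta> ^ d)"
    using L(2) by (auto simp: mp.span_singleton)
  define q where "q = poly_eval (\<lambda>i. monom (c * of_nat (d choose i) * \<alpha> ^ i) (d - i)) f"
  have q: "poly q \<gamma> = meval (\<lambda>i. c * of_nat (d choose i) * \<alpha> ^ i * \<gamma> ^ (d - i)) f" for \<gamma>
    by (simp add: q_def poly_poly_eval poly_monom)
  have "poly q \<gamma> = 0" if "\<gamma> \<noteq> 0" for \<gamma>
  proof -
    have "meval (\<lambda>i. c * of_nat (d choose i) * \<alpha> ^ i * \<gamma> ^ (d - i)) f
        = meval (\<lambda>i. (c * \<gamma> ^ d) * (of_nat (d choose i) * (\<alpha> / \<gamma>) ^ i)) f"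
      by (rule meval_cong[OF hpolys_mpolys[OF f]]) (use that in \<open>simp add: power_diff power_divide\<close>)
    also have "\<dots> = (c * \<gamma> ^ d) ^ n * poly (poly_eval (curve d) f) (\<alpha> / \<gamma>)"
      by (simp add: meval_homogeneous[OF f] poly_poly_eval curve_def poly_monom)
    finally show ?thesis by (simp add: q 0)
  qed
  \<comment> \<open>The factor \<open>[:0, 1:]\<close> covers the argument 0, where nothing is known
    about \<open>q\<close> yet.\<close>
  then have "[:0, 1:] * q = 0" by (intro poly_eqI_values) auto
  then have "q = 0" by simp
  moreover have "meval (form_coeff d v) f = poly q \<beta>"
    unfolding q by (rule meval_cong[OF hpolys_mpolys[OF f]])
      (simp add: v form_coeff_mscale form_coeff_linear_power mult.assoc)
  ultimately show "meval (form_coeff d v) f = 0" by simp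
qed

lemma degree_poly_eval_curve:
  assumes "f \<in> hpolys {0..d} n"
  shows "degree (poly_eval (curve d :: nat \<Rightarrow> 'a::field_char_0 poly) f) \<le> d * n"
  unfolding poly_eval_def
proof (intro degree_sum_le finite_keys)
  fix m assume m: "m \<in> keys f"
  have "degree (\<Prod>v\<in>keys m. curve d v ^ lookup m v :: 'a poly)
      \<le> (\<Sum>v\<in>keys m. degree (curve d v ^ lookup m v :: 'a poly))"
    using degree_prod_sum_le[of "keys m" "\<lambda>v. curve d v ^ lookup m v :: 'a poly"] by (simp add: o_def)
  also have "\<dots> \<le> (\<Sum>v\<in>keys m. d * lookup m v)"
  proof (rule sum_mono)
    fix v assume "v \<in> keys m"
    moreover have "keys m \<subseteq> {0..d}" using m assms by (simp add: hpolys_def mpolys_def)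
    ultimately have "v \<le> d" by auto
    then have "degree (curve d v :: 'a poly) \<le> d"
      unfolding curve_def by (meson degree_monom_le order_trans)
    then have "degree (curve d v :: 'a poly) * lookup m v \<le> d * lookup m v"
      by (rule mult_le_mono1)
    then show "degree (curve d v ^ lookup m v :: 'a poly) \<le> d * lookup m v"
      using degree_power_le order_trans by blast
  qed
  also have "\<dots> = d * n"
    using m assms by (simp add: sum_distrib_left[symmetric] hpolys_def mon_degree_def)
  finally show "degree (smult (lookup f m) (\<Prod>v\<in>keys m. curve d v ^ lookup m v :: 'a poly)) \<le> d * n"
    using degree_smult_le order_trans by blast
qed

lemma poly_eval_var:
  "poly_eval y (single (single v 1) c) = smult c (y v :: 'a::field_char_0 poly)"
  by (rule poly_eqI_values) (simp add: poly_poly_eval meval_single)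

lemma poly_eval_one: "poly_eval y 1 = (1 :: 'a::field_char_0 poly)"
  by (rule poly_eqI_values) (simp add: poly_poly_eval)

text \<open>An exponent up to \<open>d * n\<close> is split greedily into \<open>n\<close> indices
  up to \<open>d\<close>.\<close>

lemma exists_form_monom:
  assumes "a \<le> d * n"
  shows "\<exists>f\<in>hpolys {0..d} n. poly_eval (curve d) f = monom (1 :: 'a::field_char_0) a"
  using assms
proof (induction n arbitrary: a)
  case 0
  then show ?case using form_fun_const
    by (intro bexI[of _ 1]) (auto simp: poly_eval_one hpolys_def mpolys_def)
next
  case (Suc n)
  define i where "i = min d a"
  have "a - i \<le> d * n" using Suc.prems by (auto simp: i_def min_def)
  then obtain f where f: "f \<in> hpolys {0..d} n" "poly_eval (curve d) f = monom (1 :: 'a) (a - i)"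
    using Suc.IH by blast
  let ?x = "single (single i 1) (1 / of_nat (d choose i)) :: (nat, 'a) mpoly"
  have "?x \<in> hpolys {0..d} 1" by (rule hpolys_single) (auto simp: i_def)
  then have "?x * f \<in> hpolys {0..d} (Suc n)" using hpolys_mult[OF _ f(1)] by fastforce
  moreover have "poly_eval (curve d) (?x * f) = monom 1 a"
    unfolding poly_eval_mult poly_eval_var f(2) curve_def
    by (simp add: smult_monom mult_monom i_def)
  ultimately show ?case by blast
qed

text \<open>This is the projective normality of the rational normal curve: forms of degree
  \<open>n\<close> restrict onto all binary forms of degree \<open>d * n\<close>, here
  dehomogenized.\<close>

lemma poly_eval_curve_image:
  "poly_eval (curve d) ` hpolys {0..d} n = (polys_le (d * n) :: 'a::field_char_0 poly set)"
proof
  interpret L: Vector_Spaces.linear mscale smult "poly_eval (curve d :: nat \<Rightarrow> 'a poly)"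
    by (rule linear_poly_eval)
  show "poly_eval (curve d) ` hpolys {0..d} n \<subseteq> (polys_le (d * n) :: 'a poly set)"
    using degree_poly_eval_curve by (auto simp: polys_le_def)
  show "(polys_le (d * n) :: 'a poly set) \<subseteq> poly_eval (curve d) ` hpolys {0..d} n"
    unfolding polys_le_span
  proof (rule pl.span_minimal)
    show "pl.subspace (poly_eval (curve d :: nat \<Rightarrow> 'a poly) ` hpolys {0..d} n)"
      by (rule L.subspace_image[OF subspace_hpolys])
    show "monom 1 ` {..d * n} \<subseteq> poly_eval (curve d :: nat \<Rightarrow> 'a poly) ` hpolys {0..d} n"
      using exists_form_monom[where 'a = 'a] by (force simp: image_iff)
  qed
qed

section \<open>The Hilbert function of a linear section of the curve\<close>

lemma subspace_vanishing_ideal: "mp.subspace (vanishing_ideal d X)"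
  using subspace_mpolys[of "{0..d}"]
  unfolding mp.subspace_def vanishing_ideal_def by (auto simp: meval_add meval_mscale)

lemma subspace_intersection_ideal: "mp.subspace (intersection_ideal d X Y)"
  unfolding intersection_ideal_def
  by (rule mp.subspace_sums[OF subspace_vanishing_ideal subspace_vanishing_ideal])

definition section_polys :: "nat \<Rightarrow> (nat, 'a::field) mpoly set set \<Rightarrow> nat \<Rightarrow> 'a poly set" where
  "section_polys d P n =
     poly_eval (curve d) ` (intersection_ideal d (rational_normal_curve d) P \<inter> hpolys {0..d} n)"

text \<open>The ideal contains every form that vanishes on the curve, so the quotient may be
  computed after restriction to the curve. There the ambient space has dimension
  \<open>Suc (d * n)\<close>.\<close>

lemma hilbert_function_section:
  fixes P :: "(nat, 'a::field_char_0) mpoly set set"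
  shows "hilbert_function d (intersection_ideal d (rational_normal_curve d) P) n
    = Suc (d * n) - pl.dim (section_polys d P n)"
proof -
  interpret mpl: vector_space_pair "mscale :: 'a \<Rightarrow> (nat, 'a) mpoly \<Rightarrow> _" "smult :: 'a \<Rightarrow> _"
    by (rule mp_pl)
  let ?I = "intersection_ideal d (rational_normal_curve d) P"
  let ?R = "hpolys {0..d} n :: (nat, 'a) mpoly set"
  let ?e = "poly_eval (curve d :: nat \<Rightarrow> 'a poly)"
  obtain B where B: "finite B" "?R \<subseteq> mp.span B" using hpolys_finite_span[of "{0..d}" n] by auto
  have "mp.dim ?R = mp.dim {f \<in> ?R. ?e f = 0} + Suc (d * n)"
    using mpl.rank_nullity[OF linear_poly_eval[of "curve d"] subspace_hpolys B(2,1)]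
    by (simp add: poly_eval_curve_image dim_polys_le)
  moreover have "mp.dim (?I \<inter> ?R) = mp.dim {f \<in> ?I \<inter> ?R. ?e f = 0} + pl.dim (section_polys d P n)"
    unfolding section_polys_def
    by (rule mpl.rank_nullity[OF linear_poly_eval mp.subspace_inter[OF subspace_intersection_ideal subspace_hpolys] _ B(1)])
      (use B(2) in auto)
  moreover have "{f \<in> ?I \<inter> ?R. ?e f = 0} = {f \<in> ?R. ?e f = 0}"
  proof -
    have "f \<in> ?I" if "f \<in> ?R" "?e f = 0" for f
    proof -
      have "f = f + 0" "f \<in> vanishing_ideal d (rational_normal_curve d)" "0 \<in> vanishing_ideal d P"
        using curve_idealI[OF that] mp.subspace_0[OF subspace_vanishing_ideal] by auto
      then show ?thesis unfolding intersection_ideal_def by blast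
    qed
    then show ?thesis by blast
  qed
  ultimately show ?thesis by (simp add: hilbert_function_def)
qed

section \<open>Secant planes and apolarity\<close>

lemma vanishing_on_proj_space:
  assumes "f \<in> vanishing_ideal d (proj_space W)" "w0 \<in> W" "w0 \<noteq> 0" "v \<in> W"
  shows "meval (form_coeff d v) f = 0"
proof (cases "v = 0")
  \<comment> \<open>The zero vector belongs to every line of \<open>proj_space W\<close>;
    \<open>w0\<close> guarantees that there is such a line.\<close>
  case True
  have "mp.span {w0} \<in> proj_space W" using assms(2,3) by (auto simp: proj_space_def)
  moreover have "v \<in> mp.span {w0}" using True mp.span_zero by simp
  ultimately show ?thesis using assms(1) by (auto simp: vanishing_ideal_def)
next
  case False
  then have "mp.span {v} \<in> proj_space W" using assms(4) by (auto simp: proj_space_def)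
  moreover have "v \<in> mp.span {v}" by (simp add: mp.span_base)
  ultimately show ?thesis using assms(1) by (auto simp: vanishing_ideal_def)
qed

text \<open>
  Reducing the coordinates of the curve modulo \<open>h\<close> moves its points into a space \<open>W\<close> on which
  \<open>f\<close> vanishes, so that \<open>h\<close> divides the restriction of \<open>f\<close> to the curve.
\<close>

lemma dvd_poly_eval:
  fixes h :: "'a::field_char_0 poly"
  assumes f: "f \<in> vanishing_ideal d (proj_space W)" and W: "w0 \<in> W" "w0 \<noteq> 0"
    and y: "\<And>i. y i = smult (of_nat (d choose i)) (c i)"
    and in_W: "\<And>x. form_of d (\<lambda>i. poly (c i mod h) x) \<in> W"
  shows "h dvd poly_eval y f"
proof -
  define z where "z i = smult (of_nat (d choose i)) (c i mod h)" for i
  have fV: "f \<in> mpolys {0..d}" using f by (simp add: vanishing_ideal_def)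
  have "poly_eval z f = 0"
  proof (rule poly_eqI_values)
    fix x
    have "poly (poly_eval z f) x = meval (form_coeff d (form_of d (\<lambda>i. poly (c i mod h) x))) f"
      unfolding poly_poly_eval by (rule meval_cong[OF fV]) (simp add: z_def form_coeff_form_of)
    then show "poly (poly_eval z f) x = poly 0 x"
      using vanishing_on_proj_space[OF f W in_W] by simp
  qed
  moreover have "poly_eval y f mod h = poly_eval z f mod h"
    by (rule poly_eval_mod_cong[OF fV]) (simp add: y z_def mod_smult_left)
  ultimately show ?thesis by (simp add: mod_eq_0_iff_dvd)
qed

text \<open>Both polynomials dehomogenize the same binary form of degree \<open>d * n\<close>, with
  respect to different variables; this reverses the coefficients.\<close>

lemma poly_eval_curve_inf_coeff:
  fixes f :: "(nat, 'a::field_char_0) mpoly"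
  assumes f: "f \<in> hpolys {0..d} n" and b: "b \<le> d * n"
  shows "coeff (poly_eval (curve_inf d) f) b = coeff (poly_eval (curve d) f) (d * n - b)"
proof -
  have pm: "(\<Prod>v\<in>A. monom (g v) (e v) ^ k v) = monom (\<Prod>v\<in>A. g v ^ k v) (\<Sum>v\<in>A. e v * k v)"
    for A :: "nat set" and g :: "nat \<Rightarrow> 'a" and e k
    by (induction A rule: infinite_finite_induct) (simp_all add: monom_power mult_monom)
  have "coeff (\<Prod>v\<in>keys m. curve_inf d v ^ lookup m v :: 'a poly) b
      = coeff (\<Prod>v\<in>keys m. curve d v ^ lookup m v) (d * n - b)"
    if m: "m \<in> keys f" for m
  proof -
    let ?K = "keys m" and ?k = "lookup m"
    have K: "?K \<subseteq> {0..d}" "(\<Sum>v\<in>?K. ?k v) = n"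
      using m f by (auto simp: hpolys_def mpolys_def mon_degree_def)
    have "(\<Sum>v\<in>?K. (d - v) * ?k v) + (\<Sum>v\<in>?K. v * ?k v) = (\<Sum>v\<in>?K. d * ?k v)"
      unfolding sum.distrib[symmetric] distrib_right[symmetric]
      by (rule sum.cong) (use K(1) in auto)
    also have "\<dots> = d * n" by (simp add: sum_distrib_left[symmetric] K(2))
    finally have "(\<Sum>v\<in>?K. (d - v) * ?k v) = b \<longleftrightarrow> (\<Sum>v\<in>?K. v * ?k v) = d * n - b"
      using b by linarith
    then show ?thesis by (simp add: curve_def curve_inf_def pm)
  qed
  then show ?thesis
    unfolding poly_eval_def coeff_sum coeff_smult by (simp cong: sum.cong)
qed

text \<open>Elements of the ideal restrict to forms divisible by the form of degree \<open>s\<close>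
  that belongs to \<open>g\<close>. In affine terms they are multiples \<open>g * q\<close> whose
  degree is lowered by a zero of order at least \<open>s - degree g\<close> at infinity, which
  leaves \<open>degree q \<le> d * n - s\<close>.\<close>

lemma section_polys_apolar:
  fixes g :: "'a::field_char_0 poly"
  assumes g: "g \<noteq> 0" "degree g \<le> s" "s \<le> d" "0 < s" "0 < n"
  shows "pl.dim (section_polys d (proj_space (apolar_space d s g)) n) \<le> Suc (d * n - s)"
proof -
  let ?W = "apolar_space d s g" and ?j = "degree g"
  \<comment> \<open>The reversal of \<open>g\<close> as a form of degree \<open>s\<close>: its
    equation in the chart at infinity, divisible by the power \<open>s - degree g\<close> of the
    variable.\<close>
  define h where "h = (\<Sum>l\<le>s. monom (coeff g l) (s - l))"
  obtain w0 where w0: "w0 \<in> ?W" "w0 \<noteq> 0"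
    using mp.dim_pos_imp_nonzero[of ?W] dim_apolar_space[OF g(1-3)] g(4) by metis
  \<comment> \<open>If a sequence satisfies the recurrence up to multiples of \<open>k\<close>, its
    residues modulo \<open>k\<close> satisfy it exactly, so their values at any \<open>x\<close> are
    the coordinates of a vector in \<open>?W\<close>.\<close>
  have in_W: "form_of d (\<lambda>i. poly (c i mod k) x) \<in> ?W"
    if c: "\<And>i. i \<le> d - s \<Longrightarrow> (\<Sum>l\<le>s. smult (coeff g l) (c (i + l))) = q i * k" for c q k x
    unfolding apolar_space_def
  proof (intro CollectI conjI allI impI form_of_in_binary_forms)
    fix i assume i: "i \<le> d - s"
    have "(\<Sum>l\<le>s. coeff g l * dcoeff d (form_of d (\<lambda>i. poly (c i mod k) x)) (i + l))
        = (\<Sum>l\<le>s. coeff g l * poly (c (i + l) mod k) x)"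
      by (intro sum.cong refl) (use i g(3) in \<open>auto simp: dcoeff_form_of\<close>)
    also have "\<dots> = poly ((\<Sum>l\<le>s. smult (coeff g l) (c (i + l))) mod k) x"
      by (simp add: sum_mod_poly mod_smult_left poly_sum)
    finally show "(\<Sum>l\<le>s. coeff g l * dcoeff d (form_of d (\<lambda>i. poly (c i mod k) x)) (i + l)) = 0"
      by (simp add: c[OF i])
  qed
  have in1: "form_of d (\<lambda>i. poly (monom 1 i mod g) x) \<in> ?W" for x
  proof (rule in_W)
    fix i
    have "monom 1 i * g = monom 1 i * (\<Sum>l\<le>s. monom (coeff g l) l)"
      by (simp only: poly_as_sum_of_monoms'[OF g(2)])
    then show "(\<Sum>l\<le>s. smult (coeff g l) (monom 1 (i + l))) = monom 1 i * g"
      by (simp add: sum_distrib_left mult_monom smult_monom)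
  qed
  have in2: "form_of d (\<lambda>i. poly (monom 1 (d - i) mod h) x) \<in> ?W" for x
  proof (rule in_W)
    fix i assume i: "i \<le> d - s"
    show "(\<Sum>l\<le>s. smult (coeff g l) (monom 1 (d - (i + l)))) = monom 1 (d - s - i) * h"
      unfolding h_def sum_distrib_left
      by (intro sum.cong refl) (use i g(3) in \<open>auto simp: mult_monom smult_monom intro!: arg_cong2[where f = monom]\<close>)
  qed
  have h_dvd: "monom 1 (s - ?j) dvd h"
    unfolding h_def
  proof (rule dvd_sum)
    fix l assume "l \<in> {..s}"
    show "monom 1 (s - ?j) dvd monom (coeff g l) (s - l)"
    proof (cases "l \<le> ?j")
      case True
      then show ?thesis unfolding monom_1_dvd_iff' by auto
    qed (simp add: coeff_eq_0)
  qed
  have "section_polys d (proj_space ?W) n \<subseteq> pl.span ((\<lambda>i. g * monom 1 i) ` {..d * n - s})"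
  proof
    fix F assume "F \<in> section_polys d (proj_space ?W) n"
    then obtain f f1 f2 where f: "F = poly_eval (curve d) f" "f \<in> hpolys {0..d} n" "f = f1 + f2"
        "f1 \<in> vanishing_ideal d (rational_normal_curve d)" "f2 \<in> vanishing_ideal d (proj_space ?W)"
      by (auto simp: section_polys_def intersection_ideal_def)
    have F: "F = poly_eval (curve d) f2" "poly_eval (curve_inf d) f = poly_eval (curve_inf d) f2"
      using poly_eval_curve_zero[OF f(4)] by (simp_all add: f(1,3) poly_eval_add)
    have "g dvd F"
      unfolding F(1) by (rule dvd_poly_eval[OF f(5) w0 _ in1]) (simp add: curve_def smult_monom)
    then obtain q where q: "F = g * q" by blast
    have "h dvd poly_eval (curve_inf d) f"
      unfolding F(2) by (rule dvd_poly_eval[OF f(5) w0 _ in2]) (simp add: curve_inf_def smult_monom)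
    then have low: "coeff (poly_eval (curve_inf d) f) b = 0" if "b < s - ?j" for b
      using h_dvd dvd_trans that unfolding monom_1_dvd_iff' by (metis monom_1_dvd_iff')
    have dn: "s \<le> d * n" using g(3,5) by (metis le_trans mult_le_mono2 mult.right_neutral Suc_leI One_nat_def)
    have "coeff F a = 0" if "a > d * n - (s - ?j)" for a
    proof (cases "a \<le> d * n")
      case True
      then have "coeff F a = coeff (poly_eval (curve_inf d) f) (d * n - a)"
        using poly_eval_curve_inf_coeff[OF f(2), of "d * n - a"] by (simp add: f(1))
      also have "\<dots> = 0" using low that True by auto
      finally show ?thesis .
    next
      case False
      then show ?thesis
        using degree_poly_eval_curve[OF f(2)] by (intro coeff_eq_0) (simp add: f(1))
    qed
    then have degF: "degree F \<le> d * n - (s - ?j)" by (intro degree_le) auto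
    show "F \<in> pl.span ((\<lambda>i. g * monom 1 i) ` {..d * n - s})"
    proof (cases "q = 0")
      case True
      then show ?thesis using q pl.span_zero by simp
    next
      case False
      then have "?j + degree q \<le> d * n - (s - ?j)"
        using degF g(1) by (simp add: q degree_mult_eq)
      then have "degree q \<le> d * n - s" using g(2) dn by linarith
      then have "F = (\<Sum>i\<le>d * n - s. smult (coeff q i) (g * monom 1 i))"
        unfolding q by (subst poly_as_sum_of_monoms'[symmetric, of q "d * n - s"])
          (simp_all add: sum_distrib_left smult_monom mult_smult_right[symmetric])
      also have "\<dots> \<in> pl.span ((\<lambda>i. g * monom 1 i) ` {..d * n - s})"
        by (intro pl.span_sum pl.span_scale pl.span_base) auto
      finally show ?thesis .
    qed
  qed
  then have "pl.dim (section_polys d (proj_space ?W) n) \<le> card ((\<lambda>i. g * monom 1 i) ` {..d * n - s})"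
    by (rule pl.dim_le_card) simp
  also have "\<dots> \<le> card {..d * n - s}" by (rule card_image_le) simp
  finally show ?thesis by simp
qed

lemma secant_plane_apolar:
  fixes g :: "'a::field_char_0 poly"
  assumes g: "g \<noteq> 0" "degree g \<le> s" "s \<le> d" "0 < s"
  shows "secant_plane d (s - 1) (proj_space (apolar_space d s g))"
  unfolding secant_plane_def
proof
  show "\<exists>W\<in>grassmannian (s - 1 + 1) (binary_forms d). proj_space (apolar_space d s g) = proj_space W"
    using subspace_apolar_space dim_apolar_space[OF g(1-3)] g(4)
    by (intro bexI[of _ "apolar_space d s g"]) (auto simp: grassmannian_def apolar_space_def)
  let ?I = "intersection_ideal d (rational_normal_curve d) (proj_space (apolar_space d s g))"
  have "s \<le> hilbert_function d ?I n" if "0 < n" for n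
  proof -
    have "s \<le> d * n" using g(3) that by (metis le_trans mult_le_mono2 mult.right_neutral Suc_leI One_nat_def)
    then show ?thesis
      using section_polys_apolar[OF g that] by (simp add: hilbert_function_section)
  qed
  then have "eventually (\<lambda>n. enat s \<le> enat (hilbert_function d ?I n)) sequentially"
    by (intro eventually_mono[OF eventually_gt_at_top[of "0::nat"]]) simp
  then show "enat (s - 1 + 1) \<le> scheme_length d ?I"
    unfolding scheme_length_def using g(4) by (simp add: Liminf_bounded)
qed

text \<open>
  With \<open>T = U + xU\<close>: if the dimension grows by only one, then \<open>U\<close> consists of the multiples of its
  element of least degree.
\<close>

lemma common_factor:
  fixes U :: "'a::field poly set"
  assumes U: "pl.subspace U" "U \<subseteq> polys_le d" "Suc d - s \<le> pl.dim U" "s \<le> d"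
    and T: "pl.subspace T" "U \<subseteq> T" "\<And>p. p \<in> U \<Longrightarrow> monom 1 1 * p \<in> T" "T \<subseteq> polys_le (Suc d)"
      "pl.dim T \<le> Suc (Suc d - s)"
  obtains g where "g \<noteq> 0" "degree g \<le> s" "\<And>i. i \<le> d - s \<Longrightarrow> monom 1 i * g \<in> U"
proof -
  let ?x = "monom 1 1 :: 'a poly"
  obtain p0 where p0: "p0 \<in> U" "p0 \<noteq> 0"
    using pl.dim_pos_imp_nonzero[of U] U(3,4) by force
  define ok where "ok p \<longleftrightarrow> p \<in> U \<and> p \<noteq> 0" for p
  have bound: "degree p \<le> d" if "ok p" for p using that U(2) by (auto simp: ok_def polys_le_def)
  obtain q where q: "ok q" "\<And>p. ok p \<Longrightarrow> degree p \<le> degree q"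
    using ex_has_greatest_nat[of ok p0 degree "Suc d"] p0 bound by (auto simp: ok_def less_Suc_eq_le)
  obtain g where g: "ok g" "\<And>p. ok p \<Longrightarrow> degree g \<le> degree p"
    using ex_has_least_nat[of ok p0 degree] p0 by (auto simp: ok_def)
  let ?\<delta> = "degree q" and ?j = "degree g"
  have T_span: "T \<subseteq> pl.span (monom 1 ` {..Suc d})" using T(4) by (simp only: polys_le_span)
  have deg_x: "degree (?x * p) = Suc (degree p)" if "p \<noteq> 0" for p
    using that by (simp add: degree_mult_eq degree_monom_eq monom_eq_0_iff)
  \<comment> \<open>\<open>?x * q\<close> lies in \<open>T\<close> but exceeds the degree
    \<open>?\<delta>\<close>, so the part \<open>?T'\<close> of degree at most
    \<open>?\<delta>\<close> has at most the dimension of \<open>U\<close>. As it contains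
    \<open>U\<close>, the two agree, and products of degree at most \<open>?\<delta>\<close> fall
    back into \<open>U\<close>.\<close>
  have closed: "?x * p \<in> U" if p: "ok p" "degree p < ?\<delta>" for p
  proof -
    let ?T' = "T \<inter> polys_le ?\<delta>"
    have sub: "pl.subspace ?T'" by (rule pl.subspace_inter[OF T(1) subspace_polys_le])
    have "Suc (pl.dim ?T') \<le> pl.dim T"
      using q(1) T(3) deg_x[of q]
      by (intro pl.dim_Suc_le[OF sub _ _ _ T_span, of "?x * q"]) (auto simp: ok_def polys_le_def)
    then have "pl.dim ?T' \<le> pl.dim U" using T(5) U(3) by simp
    moreover have "U \<subseteq> ?T'"
    proof
      fix p assume "p \<in> U"
      then show "p \<in> ?T'" using T(2) q(2)[of p] by (cases "p = 0") (auto simp: ok_def polys_le_def)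
    qed
    ultimately have "U = ?T'"
      using T_span by (intro pl.subspace_eqI_dim[OF U(1), where B = "monom 1 ` {..Suc d}"]) auto
    moreover have "?x * p \<in> ?T'" using p T(3) deg_x[of p] by (auto simp: ok_def polys_le_def)
    ultimately show ?thesis by simp
  qed
  have mult: "monom 1 i * g \<in> U" if "i \<le> ?\<delta> - ?j" for i
    using that
  proof (induction i)
    case 0
    then show ?case using g(1) by (simp add: ok_def)
  next
    case (Suc i)
    have "g \<noteq> 0" using g(1) by (simp add: ok_def)
    then have "monom 1 i * g \<noteq> 0" "degree (monom 1 i * g) = i + ?j"
      by (simp_all add: degree_mult_eq degree_monom_eq monom_eq_0_iff)
    then have "?x * (monom 1 i * g) \<in> U"
      using Suc by (intro closed) (auto simp: ok_def)
    moreover have "?x * (monom 1 i * g) = monom 1 (Suc i) * g"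
      by (simp only: mult.assoc[symmetric] mult_monom) simp
    ultimately show ?case by (simp only:)
  qed
  let ?G = "(\<lambda>i. monom 1 i * g) ` {..?\<delta> - ?j}"
  \<comment> \<open>Division by \<open>g\<close> on leading terms: the degrees in \<open>U\<close>
    lie between \<open>?j\<close> and \<open>?\<delta>\<close>, so the multiples of \<open>g\<close>
    that are needed belong to \<open>U\<close>.\<close>
  have span: "p \<in> pl.span ?G" if "p \<in> U" for p
    using that
  proof (induction "degree p" arbitrary: p rule: less_induct)
    case less
    show ?case
    proof (cases "p = 0")
      case True
      then show ?thesis using pl.span_zero by simp
    next
      case False
      define k where "k = degree p - ?j"
      define c where "c = lead_coeff p / lead_coeff g"
      have g0: "g \<noteq> 0" using g(1) by (simp add: ok_def)
      have k: "k \<le> ?\<delta> - ?j" "k + ?j = degree p"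
        using q(2)[of p] g(2)[of p] False less.prems by (auto simp: k_def ok_def)
      define r where "r = p - smult c (monom 1 k * g)"
      have inG: "smult c (monom 1 k * g) \<in> pl.span ?G"
        by (intro pl.span_scale pl.span_base) (use k(1) in auto)
      have "r \<in> U" unfolding r_def
        by (intro pl.subspace_diff[OF U(1)] less.prems pl.subspace_scale[OF U(1)] mult k(1))
      moreover have "degree r \<le> degree p"
        unfolding r_def using g0 k(2)
        by (intro degree_diff_le order_trans[OF degree_smult_le]) (simp_all add: degree_mult_eq degree_monom_eq monom_eq_0_iff)
      moreover have "coeff r (degree p) = 0"
        using g0 k(2) by (simp add: r_def c_def coeff_monom_mult k_def[symmetric] flip: k(2))
      ultimately have "r \<in> pl.span ?G"
        using less.hyps[of r] eq_zero_or_degree_less[of r "degree p"] pl.span_zero by fastforce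
      from pl.span_add[OF this inG] show ?thesis by (simp add: r_def)
    qed
  qed
  have "pl.dim U \<le> card ?G" by (rule pl.dim_le_card) (use span in auto)
  also have "\<dots> \<le> card {..?\<delta> - ?j}" by (rule card_image_le) simp
  \<comment> \<open>Counting the multiples of \<open>g\<close> gives
    \<open>d - s \<le> ?\<delta> - ?j\<close>; together with \<open>?\<delta> \<le> d\<close> this
    yields \<open>?j \<le> s\<close>.\<close>
  finally have "Suc d - s \<le> Suc (?\<delta> - ?j)" using U(3) by simp
  moreover have "?\<delta> \<le> d" "?j \<le> ?\<delta>" using bound[OF q(1)] q(2)[OF g(1)] by auto
  ultimately have *: "d - s \<le> ?\<delta> - ?j" "?j \<le> s" using U(4) by auto
  show thesis
    by (rule that[of g]) (use g(1) *(2) mult *(1) in \<open>auto simp: ok_def\<close>)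
qed

text \<open>\<open>M m\<close> collects the products of \<open>U\<close> with polynomials of degree
  at most \<open>m\<close>. For \<open>m = d * n'\<close> it lies in the restricted ideal in degree
  \<open>Suc n'\<close>, whose codimension is at least \<open>s\<close> when the degree is large.
  Going back from there in steps of at least one dimension bounds \<open>M 1\<close>, as
  \<open>common_factor\<close> requires.\<close>

lemma secant_imp_apolar:
  fixes W :: "(nat, 'a::field_char_0) mpoly set"
  assumes W: "W \<in> Gr s d" and s: "0 < s" "s \<le> d"
    and len: "enat s \<le> scheme_length d (intersection_ideal d (rational_normal_curve d) (proj_space W))"
  obtains g where "g \<noteq> 0" "degree g \<le> s" "W \<subseteq> apolar_space d s g"
proof -
  have W': "mp.subspace W" "W \<subseteq> binary_forms d" "mp.dim W = s" using W by (auto simp: grassmannian_def)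
  \<comment> \<open>\<open>pair p w\<close> is the value at \<open>w\<close> of the linear form that
    restricts to \<open>p\<close> on the curve.\<close>
  define pair where "pair p w = (\<Sum>i\<le>d. coeff p i * dcoeff d w i)" for p :: "'a poly" and w
  have pair_add: "pair (p + q) w = pair p w + pair q w" "pair p (v + w) = pair p v + pair p w" for p q v w
    by (simp_all add: pair_def dcoeff_add algebra_simps sum.distrib)
  have pair_scale: "pair (smult c p) w = c * pair p w" "pair p (mscale c w) = c * pair p w" for c p w
    by (simp_all add: pair_def dcoeff_mscale sum_distrib_left mult_ac)
  define U where "U = {p \<in> polys_le d. \<forall>w\<in>W. pair p w = 0}"
  have subU: "pl.subspace U"
    using subspace_polys_le[of d] unfolding pl.subspace_def U_def
    by (auto simp: pair_add pair_scale pair_def[of 0])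
  have dimU: "Suc d - s \<le> pl.dim U"
  proof -
    interpret plf: vector_space_pair "smult :: 'a \<Rightarrow> _" "fscale :: 'a \<Rightarrow> ((nat, 'a) mpoly \<Rightarrow> 'a) \<Rightarrow> _"
      by (rule pl_fs)
    obtain B0 :: "(nat, 'a) mpoly set" where "finite B0" "binary_forms d \<subseteq> mp.span B0"
      using binary_forms_finite_span by metis
    then obtain B where B: "B \<subseteq> W" "finite B" "W \<subseteq> mp.span B" "card B = s"
      using mp.finite_basis_exists[of W B0] W'(2,3) by (metis subset_trans)
    \<comment> \<open>Evaluation at \<open>s\<close> vectors that span \<open>W\<close>: at most
      \<open>s\<close> independent conditions on the \<open>Suc d\<close> coefficients of
      \<open>p\<close>.\<close>
    let ?f = "\<lambda>p w. if w \<in> B then pair p w else 0"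
    have lin: "Vector_Spaces.linear smult fscale ?f"
      by (rule linearI[OF pl.vector_space_axioms fs.vector_space_axioms])
        (auto simp: fscale_def fun_eq_iff pair_add pair_scale)
    have "?f p \<in> fs.span ((\<lambda>b w. if w = b then 1 else 0) ` B)" for p
    proof -
      have "?f p = (\<Sum>b\<in>B. fscale (pair p b) (\<lambda>w. if w = b then 1 else 0))"
      proof
        fix w
        have "(\<Sum>b\<in>B. fscale (pair p b) (\<lambda>w. if w = b then 1 else 0)) w = (\<Sum>b\<in>B. if b = w then pair p b else 0)"
          unfolding sum_fun_apply by (rule sum.cong) (auto simp: fscale_def)
        then show "?f p w = (\<Sum>b\<in>B. fscale (pair p b) (\<lambda>w. if w = b then 1 else 0)) w"
          using B(2) by simp
      qed
      also have "\<dots> \<in> fs.span ((\<lambda>b w. if w = b then 1 else 0) ` B)"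
        by (intro fs.span_sum fs.span_scale fs.span_base imageI)
      finally show ?thesis .
    qed
    then have "pl.dim (polys_le d :: 'a poly set) \<le> pl.dim {p \<in> polys_le d. ?f p = 0} + card ((\<lambda>b w. if w = b then 1 else 0 :: 'a) ` B)"
      using B(2) by (intro plf.kernel_dim_ge[OF lin subspace_polys_le polys_le_finite_span]) auto
    also have "card ((\<lambda>b w. if w = b then 1 else 0 :: 'a) ` B) \<le> s"
      using card_image_le[OF B(2)] B(4) by metis
    also have "{p \<in> polys_le d. ?f p = 0} \<subseteq> U"
    proof
      fix p assume p: "p \<in> {p \<in> polys_le d. ?f p = 0}"
      then have zero: "pair p w = 0" if "w \<in> B" for w
        using that fun_cong[of "?f p" 0 w] by simp
      have "W \<subseteq> {w. pair p w = 0}"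
        by (rule order_trans[OF B(3)], rule mp.span_minimal)
          (auto simp: zero mp.subspace_def pair_add pair_scale pair_def[of _ 0])
      then show "p \<in> U" using p by (auto simp: U_def)
    qed
    then have "pl.dim {p \<in> polys_le d. ?f p = 0} \<le> pl.dim U"
      using polys_le_finite_span[of d, where 'a = 'a] by (intro pl.dim_mono_finite) (auto simp: U_def)
    finally show ?thesis by (simp add: dim_polys_le)
  qed
  define M where "M m = pl.span {p * q | p q. p \<in> U \<and> q \<in> polys_le m}" for m
  have M_le: "M m \<subseteq> polys_le (d + m)" for m
    unfolding M_def
    by (rule pl.span_minimal[OF _ subspace_polys_le])
      (auto simp: U_def polys_le_def intro: order_trans[OF degree_mult_le add_mono])
  have M_span: "M m \<subseteq> pl.span (monom 1 ` {..d + m})" for m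
    using M_le by (simp only: polys_le_span)
  have M_x: "monom 1 1 * r \<in> M (Suc m)" if "r \<in> M m" for r m
    using that unfolding M_def
  proof (induction r rule: pl.span_induct_alt)
    case base
    then show ?case using pl.span_zero by simp
  next
    case (step c r r')
    then obtain p q where pq: "r = p * q" "p \<in> U" "q \<in> polys_le m" by blast
    have "degree (monom 1 1 * q) \<le> 1 + degree q"
      by (rule order_trans[OF degree_mult_le]) (simp add: degree_monom_le)
    then have "monom 1 1 * q \<in> polys_le (Suc m)" using pq(3) by (auto simp: polys_le_def)
    then have "p * (monom 1 1 * q) \<in> pl.span {p * q | p q. p \<in> U \<and> q \<in> polys_le (Suc m)}"
      using pq(2) by (intro pl.span_base) blast
    then have "smult c (p * (monom 1 1 * q)) + monom 1 1 * r'
        \<in> pl.span {p * q | p q. p \<in> U \<and> q \<in> polys_le (Suc m)}"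
      by (intro pl.span_add pl.span_scale step.IH)
    then show ?case by (simp add: pq(1) algebra_simps)
  qed
  have M_mono: "M m \<subseteq> M (Suc m)" for m
  proof -
    have "polys_le m \<subseteq> (polys_le (Suc m) :: 'a poly set)" by (auto simp: polys_le_def)
    then show ?thesis unfolding M_def by (intro pl.span_mono) blast
  qed
  have U_M: "U \<subseteq> M m" for m
  proof
    fix p assume "p \<in> U"
    then have "p * 1 \<in> M m" unfolding M_def by (intro pl.span_base) (force simp: polys_le_def)
    then show "p \<in> M m" by simp
  qed
  obtain p0 where p0: "p0 \<in> U" "p0 \<noteq> 0"
    using pl.dim_pos_imp_nonzero[of U] dimU s(2) by force
  have M_step: "Suc (pl.dim (M m)) \<le> pl.dim (M (Suc m))" for m
  proof -
    define ok where "ok p \<longleftrightarrow> p \<in> M m \<and> p \<noteq> 0" for p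
    have "\<forall>p. ok p \<longrightarrow> degree p < Suc (d + m)"
      using M_le[of m] by (auto simp: ok_def polys_le_def less_Suc_eq_le)
    moreover have "ok p0" using p0 U_M by (auto simp: ok_def)
    ultimately obtain q where q: "ok q" "\<And>p. ok p \<Longrightarrow> degree p \<le> degree q"
      using ex_has_greatest_nat[of ok p0 degree "Suc (d + m)"] by blast
    have "degree (monom 1 1 * q) = Suc (degree q)" "monom 1 1 * q \<noteq> 0"
      using q(1) by (simp_all add: ok_def degree_mult_eq degree_monom_eq monom_eq_0_iff)
    \<comment> \<open>\<open>q\<close> has the largest degree in \<open>M m\<close>, so
      multiplication by the variable leads out of \<open>M m\<close>.\<close>
    then have "monom 1 1 * q \<notin> M m" using q(2)[of "monom 1 1 * q"] by (auto simp: ok_def)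
    then show ?thesis
      using M_x[of q m] q(1)
      by (intro pl.dim_Suc_le[OF _ M_mono _ _ M_span, of _ "monom 1 1 * q"]) (auto simp: ok_def M_def)
  qed
  have M_growth: "pl.dim (M 1) + k \<le> pl.dim (M (Suc k))" for k
  proof (induction k)
    case (Suc k)
    then show ?case using M_step[of "Suc k"] by linarith
  qed simp
  have M_section: "M (d * n) \<subseteq> section_polys d (proj_space W) (Suc n)" for n
    unfolding M_def
  proof (rule pl.span_minimal)
    interpret L: Vector_Spaces.linear mscale smult "poly_eval (curve d :: nat \<Rightarrow> 'a poly)"
      by (rule linear_poly_eval)
    show "pl.subspace (section_polys d (proj_space W) (Suc n))"
      unfolding section_polys_def
      by (intro L.subspace_image mp.subspace_inter subspace_intersection_ideal subspace_hpolys)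
    show "{p * q | p q. p \<in> U \<and> q \<in> polys_le (d * n)} \<subseteq> section_polys d (proj_space W) (Suc n)"
    proof clarify
      fix p q :: "'a poly" assume p: "p \<in> U" and q: "q \<in> polys_le (d * n)"
      obtain f where f: "f \<in> hpolys {0..d} n" "q = poly_eval (curve d) f"
        using q unfolding poly_eval_curve_image[symmetric] by blast
      \<comment> \<open>The linear form with restriction \<open>p\<close>; the division cancels the
        binomial coefficients in \<open>curve\<close>.\<close>
      define lf :: "(nat, 'a) mpoly" where "lf = (\<Sum>i\<le>d. single (single i 1) (coeff p i / of_nat (d choose i)))"
      have lf: "lf \<in> hpolys {0..d} 1"
        unfolding lf_def by (intro mp.subspace_sum[OF subspace_hpolys] hpolys_single) auto
      have "poly_eval (curve d) lf = (\<Sum>i\<le>d. monom (coeff p i) i)"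
        unfolding lf_def L.sum poly_eval_var curve_def by (intro sum.cong) (auto simp: smult_monom)
      also have "\<dots> = p" using p by (intro poly_as_sum_of_monoms') (simp add: U_def polys_le_def)
      finally have ev: "poly_eval (curve d) (lf * f) = p * q" by (simp add: poly_eval_mult f(2))
      have zero: "meval (form_coeff d w) lf = 0" if "w \<in> W" for w
      proof -
        have "meval (form_coeff d w) lf = pair p w"
          unfolding lf_def meval_sum pair_def by (intro sum.cong) (auto simp: meval_single dcoeff_def)
        then show ?thesis using that p by (simp add: U_def)
      qed
      have "lf * f \<in> vanishing_ideal d (proj_space W)"
        unfolding vanishing_ideal_def
      proof (intro CollectI conjI ballI)
        show "lf * f \<in> mpolys {0..d}" by (rule mpolys_mult[OF hpolys_mpolys[OF lf] hpolys_mpolys[OF f(1)]])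
        fix l v assume "l \<in> proj_space W" "v \<in> l"
        then obtain w where w: "w \<in> W" "v \<in> mp.span {w}" by (auto simp: proj_space_def)
        then have "v \<in> W" using mp.span_minimal[of "{w}" W] W'(1) by blast
        then show "meval (form_coeff d v) (lf * f) = 0" by (simp add: meval_mult zero)
      qed
      moreover have "0 \<in> vanishing_ideal d (rational_normal_curve d :: (nat, 'a) mpoly set set)"
        by (rule mp.subspace_0[OF subspace_vanishing_ideal])
      ultimately have "lf * f \<in> intersection_ideal d (rational_normal_curve d) (proj_space W)"
        unfolding intersection_ideal_def by force
      moreover have "lf * f \<in> hpolys {0..d} (Suc n)" using hpolys_mult[OF lf f(1)] by simp
      ultimately show "p * q \<in> section_polys d (proj_space W) (Suc n)"
        unfolding section_polys_def using ev by (metis IntI imageI)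
    qed
  qed
  let ?h = "hilbert_function d (intersection_ideal d (rational_normal_curve d) (proj_space W))"
  \<comment> \<open>A limit inferior of at least \<open>s\<close> is greater than
    \<open>s - 1\<close>, so the Hilbert function eventually exceeds \<open>s - 1\<close>.\<close>
  have "enat (s - 1) < enat s" using s(1) by simp
  then have "eventually (\<lambda>n. enat (s - 1) < enat (?h n)) sequentially"
    using len unfolding scheme_length_def le_Liminf_iff by blast
  then obtain n0 where n0: "\<forall>n\<ge>n0. enat (s - 1) < enat (?h n)"
    unfolding eventually_sequentially by (elim exE)
  \<comment> \<open>\<open>2 \<le> n\<close> makes the predecessor \<open>n'\<close> positive, so
    that the growth from \<open>M 1\<close> to \<open>M (d * n')\<close> can be used.\<close>
  obtain n where n: "2 \<le> n" "n0 \<le> n" by (rule that[of "max 2 n0"]) simp_all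
  have hn: "s \<le> ?h n" using n0[rule_format, OF n(2)] s(1) by simp
  obtain n' where n': "n = Suc n'" "0 < n'" using n(1) by (cases n) auto
  have "pl.dim (M (d * n')) \<le> pl.dim (section_polys d (proj_space W) n)"
    unfolding n'(1)
  proof (rule pl.dim_mono_finite[OF M_section])
    show "section_polys d (proj_space W) (Suc n') \<subseteq> pl.span (monom 1 ` {..d * Suc n'})"
      unfolding polys_le_span[symmetric] section_polys_def poly_eval_curve_image[symmetric] by blast
  qed simp
  then have "pl.dim (M (d * n')) + s \<le> Suc (d * n)"
    using hn s(1) by (simp add: hilbert_function_section)
  moreover have "pl.dim (M 1) + (d * n' - 1) \<le> pl.dim (M (d * n'))"
    using M_growth[of "d * n' - 1"] n'(2) s by simp
  moreover have "0 < d * n'" using n'(2) s by simp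
  ultimately have dimT: "pl.dim (M 1) \<le> Suc (Suc d - s)"
    using s(2) unfolding n'(1) by simp
  obtain g where g: "g \<noteq> 0" "degree g \<le> s" "\<And>i. i \<le> d - s \<Longrightarrow> monom 1 i * g \<in> U"
  proof (rule common_factor[OF subU _ dimU s(2)])
    show "U \<subseteq> polys_le d" by (auto simp: U_def)
    show "pl.subspace (M 1)" by (simp add: M_def)
    show "U \<subseteq> M 1" by (rule U_M)
    show "monom 1 1 * p \<in> M 1" if "p \<in> U" for p
      using M_x[of p 0] U_M[of 0] that by auto
    show "M 1 \<subseteq> polys_le (Suc d)" using M_le[of 1] by simp
    show "pl.dim (M 1) \<le> Suc (Suc d - s)" by (rule dimT)
  qed (rule that)
  have "W \<subseteq> apolar_space d s g"
    unfolding apolar_space_def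
  proof (intro subsetI CollectI conjI allI impI)
    show "w \<in> binary_forms d" if "w \<in> W" for w using that W'(2) by blast
    fix w i assume w: "w \<in> W" and i: "i \<le> d - s"
    have "0 = pair (monom 1 i * g) w" using g(3)[OF i] w by (simp add: U_def)
    also have "\<dots> = (\<Sum>k\<in>{i..i + s}. coeff g (k - i) * dcoeff d w k)"
      unfolding pair_def
      by (rule sum.mono_neutral_cong_right) (use i s g(2) in \<open>auto simp: coeff_monom_mult coeff_eq_0\<close>)
    also have "\<dots> = (\<Sum>l\<le>s. coeff g l * dcoeff d w (i + l))"
      by (rule sum.reindex_bij_witness[of _ "\<lambda>l. i + l" "\<lambda>k. k - i"]) auto
    finally show "(\<Sum>l\<le>s. coeff g l * dcoeff d w (i + l)) = 0" by simp
  qed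
  with g show thesis using that by blast
qed

lemma secant_locus_eq:
  assumes "0 < s" "s \<le> d"
  shows "secant_locus s t d = {\<Lambda> \<in> grassmannian t (binary_forms d :: (nat, 'a::field_char_0) mpoly set).
    \<exists>g. g \<noteq> 0 \<and> degree g \<le> s \<and> \<Lambda> \<subseteq> apolar_space d s g}"
proof (intro equalityI subsetI)
  fix \<Lambda> :: "(nat, 'a) mpoly set" assume "\<Lambda> \<in> secant_locus s t d"
  then obtain W where W: "\<Lambda> \<in> Gr t d" "W \<in> Gr s d"
      "enat s \<le> scheme_length d (intersection_ideal d (rational_normal_curve d) (proj_space W))"
      "proj_space \<Lambda> \<subseteq> proj_space W"
    using assms(1) by (auto simp: secant_locus_def secant_plane_def)
  obtain g where g: "g \<noteq> 0" "degree g \<le> s" "W \<subseteq> apolar_space d s g"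
    by (rule secant_imp_apolar[OF W(2) assms W(3)]) (rule that)
  have subW: "mp.subspace W" using W(2) by (simp add: grassmannian_def)
  have "\<Lambda> \<subseteq> W"
  proof
    fix v assume v: "v \<in> \<Lambda>"
    show "v \<in> W"
    proof (cases "v = 0")
      case True
      then show ?thesis using mp.subspace_0[OF subW] by simp
    next
      case False
      then have "mp.span {v} \<in> proj_space W" using v W(4) by (auto simp: proj_space_def)
      then obtain w where w: "w \<in> W" "mp.span {v} = mp.span {w}" by (auto simp: proj_space_def)
      then have "v \<in> mp.span {w}" using mp.span_base[of v "{v}"] by simp
      then show ?thesis using mp.span_minimal[of "{w}" W] subW w(1) by blast
    qed
  qed
  with g W(1) show "\<Lambda> \<in> {\<Lambda> \<in> Gr t d. \<exists>g. g \<noteq> 0 \<and> degree g \<le> s \<and> \<Lambda> \<subseteq> apolar_space d s g}"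
    by blast
next
  fix \<Lambda> :: "(nat, 'a) mpoly set"
  assume "\<Lambda> \<in> {\<Lambda> \<in> Gr t d. \<exists>g. g \<noteq> 0 \<and> degree g \<le> s \<and> \<Lambda> \<subseteq> apolar_space d s g}"
  then obtain g where "\<Lambda> \<in> Gr t d" "g \<noteq> 0" "degree g \<le> s" "\<Lambda> \<subseteq> apolar_space d s g"
    by blast
  then show "\<Lambda> \<in> secant_locus s t d"
    using secant_plane_apolar[of g s d] assms unfolding secant_locus_def proj_space_def by blast
qed

section \<open>The dimension of the secant locus\<close>

text \<open>Apolarity is a homogeneous system of \<open>card B * (d - s + 1)\<close> linear
  equations for the \<open>s + 1\<close> coefficients of \<open>g\<close>, hence has a nonzero
  solution.\<close>

lemma exists_apolar_poly:
  fixes B :: "(nat, 'a::field_char_0) mpoly set"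
  assumes "finite B" "B \<subseteq> binary_forms d" "card B * (d - s + 1) \<le> s"
  obtains g where "g \<noteq> 0" "degree g \<le> s" "mp.span B \<subseteq> apolar_space d s g"
proof -
  interpret plf: vector_space_pair "smult :: 'a \<Rightarrow> _" "fscale :: 'a \<Rightarrow> ((nat, 'a) mpoly \<times> nat \<Rightarrow> 'a) \<Rightarrow> _"
    by (rule pl_fs)
  let ?D = "B \<times> {..d - s}"
  let ?a = "\<lambda>g (w, i). \<Sum>l\<le>s. coeff g l * dcoeff d w (i + l)"
  let ?f = "\<lambda>g z. if z \<in> ?D then ?a g z else 0"
  let ?T = "(\<lambda>z' z. if z = z' then 1 else 0 :: 'a) ` ?D"
  have fin: "finite ?D" using assms(1) by simp
  have lin: "Vector_Spaces.linear smult fscale ?f"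
    by (rule linearI[OF pl.vector_space_axioms fs.vector_space_axioms])
      (auto simp: fscale_def fun_eq_iff algebra_simps sum.distrib sum_distrib_left)
  have span: "?f g \<in> fs.span ?T" for g
  proof -
    have "?f g = (\<Sum>z'\<in>?D. fscale (?a g z') (\<lambda>z. if z = z' then 1 else 0))"
    proof
      fix z
      have "(\<Sum>z'\<in>?D. fscale (?a g z') (\<lambda>z. if z = z' then 1 else 0)) z = (\<Sum>z'\<in>?D. if z' = z then ?a g z' else 0)"
        unfolding sum_fun_apply by (rule sum.cong) (auto simp: fscale_def)
      then show "?f g z = (\<Sum>z'\<in>?D. fscale (?a g z') (\<lambda>z. if z = z' then 1 else 0)) z"
        using fin by simp
    qed
    also have "\<dots> \<in> fs.span ?T"
      by (intro fs.span_sum fs.span_scale fs.span_base imageI)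
    finally show ?thesis .
  qed
  have "pl.dim (polys_le s :: 'a poly set) \<le> pl.dim {g \<in> polys_le s. ?f g = 0} + card ?T"
    by (rule plf.kernel_dim_ge[OF lin subspace_polys_le polys_le_finite_span]) (use span fin in auto)
  moreover have "card ?T \<le> s"
    using card_image_le[OF fin, of "\<lambda>z' z. if z = z' then 1 else 0 :: 'a"] assms(3) by (simp add: card_cartesian_product)
  ultimately have "0 < pl.dim {g \<in> polys_le s. ?f g = 0}" by (simp add: dim_polys_le)
  then obtain g where g: "g \<in> polys_le s" "?f g = 0" "g \<noteq> 0"
    using pl.dim_pos_imp_nonzero by blast
  have "B \<subseteq> apolar_space d s g"
    unfolding apolar_space_def
  proof (intro subsetI CollectI conjI allI impI)
    show "w \<in> binary_forms d" if "w \<in> B" for w using that assms(2) by blast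
    show "(\<Sum>l\<le>s. coeff g l * dcoeff d w (i + l)) = 0" if "w \<in> B" "i \<le> d - s" for w i
      using fun_cong[OF g(2), of "(w, i)"] that by simp
  qed
  then have "mp.span B \<subseteq> apolar_space d s g" by (rule mp.span_minimal[OF _ subspace_apolar_space])
  then show thesis using that g by (simp add: polys_le_def)
qed

lemma chart_var_form:
  assumes P: "P \<subseteq> {0..d} - {j..<j + m}" and w: "Inr (p, q) \<in> chart_vars d j m P"
  obtains F :: "(nat set \<Rightarrow> 'a::field_char_0) \<Rightarrow> 'a" where "form_fun (pluecker_index (card P) d) 1 F"
    "\<And>x. F (pluecker d (chart_basis d j m P x)) = x (Inr (p, q))"
proof -
  have pq: "p \<in> P" "q \<le> d" "q \<notin> P" "q \<notin> {j..<j + m}" using w by (auto simp: chart_vars_def)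
  obtain F :: "(nat set \<Rightarrow> 'a) \<Rightarrow> 'a" where F: "form_fun (pluecker_index (card P) d) 1 F"
    "\<And>x. F (pluecker d (chart_basis d j m P x)) = chart_row j m P x p q"
    by (rule chart_entry_form[OF P pq(1,2)]) (rule that)
  show thesis by (rule that[OF F(1)]) (simp add: F(2) chart_row_var[OF pq(3,4)])
qed

lemma krull_dim_ge_chart:
  fixes S :: "(nat, 'a::field_char_0) mpoly set set"
  assumes S: "S \<subseteq> Gr t d" and P: "P \<subseteq> {0..d} - {j..<j + m}" "card P = t"
    and in_S: "\<And>x. mp.span (set (chart_basis d j m P x)) \<in> S"
    and sep: "\<And>i. i < N \<Longrightarrow> \<exists>n F. form_fun (pluecker_index t d) n F \<and>
        (\<forall>x :: 'a chart_point. (\<forall>k. i \<le> k \<and> k < N \<longrightarrow> x (e k) = 0) \<longrightarrow> F (pluecker d (chart_basis d j m P x)) = 0) \<and>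
        (\<exists>x. (\<forall>k. i < k \<and> k < N \<longrightarrow> x (e k) = 0) \<and> F (pluecker d (chart_basis d j m P x)) \<noteq> 0)"
  shows "enat N \<le> krull_dim (subtopology (grassmann_zariski t d) S)"
proof (rule krull_dim_ge_param[where \<phi> = "\<lambda>x. mp.span (set (chart_basis d j m P x))"
      and bs = "chart_basis d j m P" and W = "chart_vars d j m P" and D = "t * Suc d" and e = e])
  show "ordered_basis (chart_basis d j m P x) (mp.span (set (chart_basis d j m P x)))" for x :: "'a chart_point"
    by (rule chart_basis_props(1)[OF P(1)])
  fix J assume "J \<in> pluecker_index t d"
  then have "P \<subseteq> {0..d}" "J \<in> pluecker_index (card P) d" using P by auto
  from chart_pluecker_poly[OF this, of j m]
  show "(\<lambda>x :: 'a chart_point. pluecker d (chart_basis d j m P x) J) \<in> poly_funs (chart_vars d j m P) (t * Suc d)"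
    by (simp add: P(2))
qed (fact S in_S sep)+

text \<open>With the empty window \<open>j = m = 0\<close> the charts impose no recurrence and are
  the affine charts of the whole Grassmannian.\<close>

lemma krull_dim_secant_locus_upper1:
  assumes "0 < t" "t \<le> d" "S \<subseteq> grassmannian t (binary_forms d :: (nat, 'a::field_char_0) mpoly set)"
  shows "krull_dim (subtopology (grassmann_zariski t d) S) \<le> enat (t * (d - t + 1))"
proof (rule krull_dim_le_param[OF assms(3), where C = "pluecker_index t d" and W = "chart_vars d 0 0"
      and y = "\<lambda>P x. pluecker d (chart_basis d 0 0 P x)" and D = "t * Suc d"])
  show "finite (pluecker_index t d)" by (rule finite_pluecker_index)
  fix P assume P: "P \<in> pluecker_index t d"
  then have "P \<subseteq> {0..d} - {0..<0 + 0}" "card P = t" by auto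
  then show "finite (chart_vars d 0 0 P)" "card (chart_vars d 0 0 P) \<le> t * (d - t + 1)"
    using card_chart_vars[of P d 0 0] assms(2) finite_subset[of P "{0..d}"]
    by (auto simp: finite_chart_vars Suc_diff_le)
  show "(\<lambda>x :: 'a chart_point. pluecker d (chart_basis d 0 0 P x) J) \<in> poly_funs (chart_vars d 0 0 P) (t * Suc d)"
    if "J \<in> pluecker_index t d" for J
    using chart_pluecker_poly[of P d J 0 0] P that by auto
next
  fix \<Lambda> :: "(nat, 'a) mpoly set" assume "\<Lambda> \<in> S"
  then have \<Lambda>: "\<Lambda> \<in> Gr t d" using assms(3) by blast
  obtain P x where P: "P \<subseteq> {0..d} - {0..<0 + 0}" "card P = t" "ordered_basis (chart_basis d 0 0 P x) \<Lambda>"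
    by (rule chart_cover[OF \<Lambda>, of 0 0 "\<lambda>_. 0"]) (simp, rule that)
  then show "\<exists>P\<in>pluecker_index t d. \<exists>x bs. ordered_basis bs \<Lambda> \<and> pluecker d bs = pluecker d (chart_basis d 0 0 P x)"
    by (intro bexI[of _ P] exI[of _ x] exI[of _ "chart_basis d 0 0 P x"]) auto
qed

text \<open>Charts are indexed by the degree \<open>j\<close> of \<open>g\<close> and by the pivots.
  A monic \<open>g\<close> has \<open>j \<le> s\<close> free coefficients, and the window has the
  same length for all \<open>j\<close>, so no chart has more than \<open>s + t * (s - t)\<close>
  variables.\<close>

lemma krull_dim_secant_locus_upper2:
  assumes "0 < s" "t \<le> s" "s \<le> d"
  shows "krull_dim (subtopology (grassmann_zariski t d) (secant_locus s t d :: (nat, 'a::field_char_0) mpoly set set))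
    \<le> enat (s + t * (s - t))"
proof -
  let ?m = "d - s + 1"
  define C where "C = {(j, P). j \<le> s \<and> P \<subseteq> {0..d} - {j..<j + ?m} \<and> card P = t}"
  show ?thesis
  proof (rule krull_dim_le_param[where C = C and W = "\<lambda>(j, P). chart_vars d j ?m P"
      and y = "\<lambda>(j, P) x. pluecker d (chart_basis d j ?m P x)" and D = "t * Suc d"])
    show "secant_locus s t d \<subseteq> (Gr t d :: (nat, 'a) mpoly set set)"
      by (auto simp: secant_locus_def)
    show "finite C"
      by (rule finite_subset[of _ "{..s} \<times> Pow {0..d}"]) (auto simp: C_def)
    fix c assume "c \<in> C"
    then obtain j P where c: "c = (j, P)" "j \<le> s" "P \<subseteq> {0..d} - {j..<j + ?m}" "card P = t"
      by (auto simp: C_def)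
    have "finite P" using c(3) finite_subset by blast
    then show "finite (case c of (j, P) \<Rightarrow> chart_vars d j ?m P)" by (simp add: c(1) finite_chart_vars)
    have "Suc d - ?m = s" "j + ?m \<le> Suc d" using assms(3) c(2) by auto
    then show "card (case c of (j, P) \<Rightarrow> chart_vars d j ?m P) \<le> s + t * (s - t)"
      using card_chart_vars[OF c(3)] c(2,4) by (simp add: c(1))
    show "(\<lambda>x :: 'a chart_point. (case c of (j, P) \<Rightarrow> \<lambda>x. pluecker d (chart_basis d j ?m P x)) x J)
        \<in> poly_funs (case c of (j, P) \<Rightarrow> chart_vars d j ?m P) (t * Suc d)" if J: "J \<in> pluecker_index t d" for J
    proof -
      have "P \<subseteq> {0..d}" "J \<in> pluecker_index (card P) d" using c(3,4) J by auto
      from chart_pluecker_poly[OF this, of j ?m] show ?thesis by (simp add: c(1,4))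
    qed
  next
    fix \<Lambda> :: "(nat, 'a) mpoly set" assume "\<Lambda> \<in> secant_locus s t d"
    then obtain g where \<Lambda>: "\<Lambda> \<in> Gr t d"
      and g: "g \<noteq> 0" "degree g \<le> s" "\<Lambda> \<subseteq> apolar_space d s g"
      unfolding secant_locus_eq[OF assms(1,3)] by blast
    define h where "h = smult (1 / lead_coeff g) g"
    have h: "degree h = degree g" "lead_coeff h = 1" "\<Lambda> \<subseteq> apolar_space d s h"
      using g by (simp_all add: h_def apolar_space_smult)
    have rec: "dcoeff d v (i + degree g) = - (\<Sum>l<degree g. coeff h l * dcoeff d v (i + l))"
      if "v \<in> \<Lambda>" "i < ?m" for v i
      using apolar_space_monic[OF h(1,2) g(2), of v d] h(3) that by blast
    obtain P x where P: "P \<subseteq> {0..d} - {degree g..<degree g + ?m}" "card P = t"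
        "ordered_basis (chart_basis d (degree g) ?m P x) \<Lambda>"
      by (rule chart_cover[OF \<Lambda> rec]) (assumption, assumption, rule that)
    then show "\<exists>c\<in>C. \<exists>x bs. ordered_basis bs \<Lambda> \<and>
        pluecker d bs = (case c of (j, P) \<Rightarrow> \<lambda>x. pluecker d (chart_basis d j ?m P x)) x"
      using g(2)
      by (intro bexI[of _ "(degree g, P)"] exI[of _ x]
          exI[of _ "chart_basis d (degree g) ?m P x"]) (auto simp: C_def)
  qed
qed

text \<open>By \<open>exists_apolar_poly\<close> all spaces of an affine chart belong to the locus
  here. Each chart variable is a linear form in the Pluecker coordinates of the normalized basis, so
  the variables in any order give a flag.\<close>

lemma krull_dim_secant_locus_lower_full:
  assumes "t \<le> s" "0 < s" "s \<le> d" "t * (d - s + 1) \<le> s"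
  shows "enat (t * (d - t + 1))
    \<le> krull_dim (subtopology (grassmann_zariski t d) (secant_locus s t d :: (nat, 'a::field_char_0) mpoly set set))"
proof -
  define P where "P = {..<t}"
  have P: "P \<subseteq> {0..d} - {0..<0 + 0}" "card P = t" "finite P" using assms by (auto simp: P_def)
  let ?W = "chart_vars d 0 0 P"
  let ?bs = "\<lambda>x :: 'a chart_point. chart_basis d 0 0 P x"
  have card: "card ?W = t * (d - t + 1)"
    using card_chart_vars[OF P(1)] assms by (simp add: P(2) Suc_diff_le)
  obtain e where e: "bij_betw e {0..<card ?W} ?W"
    using ex_bij_betw_nat_finite[OF finite_chart_vars[OF P(3)]] by blast
  show ?thesis
  proof (rule krull_dim_ge_chart[where e = e, OF _ P(1,2)])
    show "secant_locus s t d \<subseteq> (Gr t d :: (nat, 'a) mpoly set set)"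
      by (auto simp: secant_locus_def)
    show "mp.span (set (?bs x)) \<in> secant_locus s t d" for x
    proof -
      have "card (set (?bs x)) \<le> t"
        using card_length[of "?bs x"] P(2,3) by (simp add: chart_basis_def)
      then have "card (set (?bs x)) * (d - s + 1) \<le> s"
        using assms(4) by (meson le_trans mult_le_mono1)
      moreover have "set (?bs x) \<subseteq> binary_forms d"
        by (auto simp: chart_basis_def form_of_in_binary_forms)
      ultimately obtain g where "g \<noteq> 0" "degree g \<le> s" "mp.span (set (?bs x)) \<subseteq> apolar_space d s g"
        using exists_apolar_poly[of "set (?bs x)" d s] by auto
      then show ?thesis
        unfolding secant_locus_eq[OF assms(2,3)] using chart_basis_props(3)[OF P(1), of x] P(2) by auto
    qed
    fix i assume "i < t * (d - t + 1)"
    then have i: "i < card ?W" by (simp add: card)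
    then have "e i \<in> ?W" using e by (auto simp: bij_betw_def)
    then obtain p q where pq: "e i = Inr (p, q)" "Inr (p, q) \<in> ?W" by (auto simp: chart_vars_def)
    obtain F :: "(nat set \<Rightarrow> 'a) \<Rightarrow> 'a" where F: "form_fun (pluecker_index (card P) d) 1 F"
      "\<And>x. F (pluecker d (?bs x)) = x (Inr (p, q))"
      by (rule chart_var_form[OF P(1) pq(2)]) (rule that)
    have "e k \<noteq> e i" if "i < k" "k < card ?W" for k
      using inj_onD[OF bij_betw_imp_inj_on[OF e], of k i] i that by auto
    then show "\<exists>n F. form_fun (pluecker_index t d) n F \<and>
        (\<forall>x. (\<forall>k. i \<le> k \<and> k < t * (d - t + 1) \<longrightarrow> x (e k) = 0) \<longrightarrow> F (pluecker d (?bs x)) = 0) \<and>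
        (\<exists>x. (\<forall>k. i < k \<and> k < t * (d - t + 1) \<longrightarrow> x (e k) = 0) \<and> F (pluecker d (?bs x)) \<noteq> 0)"
      using F i pq(1) unfolding P(2) card[symmetric]
      by (intro exI[of _ 1] exI[of _ F] conjI exI[of _ "\<lambda>v. if v = e i then 1 else 0"]) auto
  qed
qed

text \<open>The flag frees the recurrence coefficients in the order \<open>Inl 0\<close>,
  \<open>Inl 1\<close>, ..., since \<open>chart_coefficient_form\<close> detects
  \<open>Inl i\<close> when the later coefficients vanish. The entries of the basis follow. The
  pivots come from \<open>exists_covering_pivots\<close>, as this detection needs one within
  distance \<open>d - s\<close> above every place.\<close>

lemma krull_dim_secant_locus_lower_generic:
  assumes "t \<le> s" "0 < s" "s \<le> d" "s \<le> t * (d - s + 1)"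
  shows "enat (s + t * (s - t))
    \<le> krull_dim (subtopology (grassmann_zariski t d) (secant_locus s t d :: (nat, 'a::field_char_0) mpoly set set))"
proof -
  obtain P where P: "P \<subseteq> {..<s}" "card P = t" "\<forall>q<s. \<exists>p\<in>P. q \<le> p \<and> p \<le> q + (d - s)"
    by (rule exists_covering_pivots[OF assms(4,1)]) (rule that)
  let ?m = "d - s + 1"
  have P': "P \<subseteq> {0..d} - {s..<s + ?m}" "finite P" using P(1) assms(3) finite_subset by auto
  let ?W = "chart_vars d s ?m P"
  let ?bs = "\<lambda>x :: 'a chart_point. chart_basis d s ?m P x"
  define Y where "Y = Inr ` (P \<times> ({0..d} - {s..<s + ?m} - P)) \<inter> ?W"
  have W: "?W = Inl ` {..<s} \<union> Y" "Inl ` {..<s} \<inter> Y = {}" by (auto simp: Y_def chart_vars_def)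
  have finY: "finite Y" using finite_chart_vars[OF P'(2)] by (simp add: Y_def)
  have "card ?W = s + t * (s - t)"
    using card_chart_vars[OF P'(1)] assms(3) by (simp add: P(2))
  moreover have "card ?W = s + card Y"
    unfolding W(1) using finY W(2) by (subst card_Un_disjoint) (auto simp: card_image)
  ultimately have cardY: "card Y = t * (s - t)" by simp
  obtain h where h: "bij_betw h {0..<card Y} Y" using ex_bij_betw_nat_finite[OF finY] by blast
  define e where "e k = (if k < s then Inl k else h (k - s))" for k
  have hY: "h k \<in> Y" if "k < card Y" for k using h that by (auto simp: bij_betw_def)
  have e_ne: "e k \<noteq> e i" if "i < k" "k < s + card Y" for i k
  proof (cases "s \<le> i")
    case True
    then have "k - s < card Y" "i - s < card Y" "k - s \<noteq> i - s" using that by linarith+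
    then show ?thesis
      using inj_onD[OF bij_betw_imp_inj_on[OF h], of "k - s" "i - s"] that True by (auto simp: e_def)
  next
    case False
    show ?thesis
    proof (cases "k < s")
      case False
      then have "h (k - s) \<in> Y" using hY that by simp
      then show ?thesis using \<open>\<not> s \<le> i\<close> False by (auto simp: e_def Y_def)
    qed (use that in \<open>auto simp: e_def\<close>)
  qed
  show ?thesis
  proof (rule krull_dim_ge_chart[where e = e, OF _ P'(1) P(2)])
    show "secant_locus s t d \<subseteq> (Gr t d :: (nat, 'a) mpoly set set)"
      by (auto simp: secant_locus_def)
    show "mp.span (set (?bs x)) \<in> secant_locus s t d" for x
    proof -
      obtain g where "g \<noteq> 0" "degree g \<le> s" "mp.span (set (?bs x)) \<subseteq> apolar_space d s g"
        by (rule chart_basis_apolar[OF assms(3), of P x]) (rule that)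
      then show ?thesis
        unfolding secant_locus_eq[OF assms(2,3)] using chart_basis_props(3)[OF P'(1), of x] P(2) by auto
    qed
    fix i assume "i < s + t * (s - t)"
    then have i: "i < s + card Y" by (simp add: cardY)
    let ?x = "\<lambda>v. if v = e i then 1 else 0 :: 'a"
    have x0: "\<forall>k. i < k \<and> k < s + card Y \<longrightarrow> ?x (e k) = 0" using e_ne by auto
    have "\<exists>n F. form_fun (pluecker_index t d) n F \<and>
        (\<forall>x. (\<forall>k. i \<le> k \<and> k < s + card Y \<longrightarrow> x (e k) = 0) \<longrightarrow> F (pluecker d (?bs x)) = 0) \<and>
        F (pluecker d (?bs ?x)) \<noteq> 0"
    proof (cases "i < s")
      case True
      obtain n F where F: "form_fun (pluecker_index (card P) d) n F"
          "\<forall>x :: 'a chart_point. (\<forall>h. i \<le> h \<and> h < s \<longrightarrow> x (Inl h) = 0) \<longrightarrow> F (pluecker d (?bs x)) = 0"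
          "F (pluecker d (?bs (\<lambda>v. if v = Inl i then 1 else 0))) \<noteq> 0"
        using chart_coefficient_form[OF P(1) assms(3) P(3) True, where 'a = 'a] by (elim exE conjE) (rule that)
      have "F (pluecker d (?bs x)) = 0" if x: "\<forall>k. i \<le> k \<and> k < s + card Y \<longrightarrow> x (e k) = 0" for x
      proof -
        have "x (Inl k) = 0" if "i \<le> k" "k < s" for k
          using x[rule_format, of k] that by (simp add: e_def)
        then show ?thesis using F(2) by blast
      qed
      moreover have "e i = Inl i" using True by (simp add: e_def)
      ultimately show ?thesis
        using F(1,3) by (intro exI[of _ n] exI[of _ F]) (simp add: P(2))
    next
      case False
      then have ei: "e i \<in> Y" using hY[of "i - s"] i by (simp add: e_def)
      then obtain p q where pq: "e i = Inr (p, q)" "Inr (p, q) \<in> ?W" by (auto simp: Y_def)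
      obtain F :: "(nat set \<Rightarrow> 'a) \<Rightarrow> 'a" where F: "form_fun (pluecker_index (card P) d) 1 F"
        "\<And>x. F (pluecker d (?bs x)) = x (Inr (p, q))"
        by (rule chart_var_form[OF P'(1) pq(2)]) (rule that)
      then show ?thesis
        using i by (intro exI[of _ 1] exI[of _ F]) (auto simp: P(2) pq(1)[symmetric])
    qed
    then obtain n F where "form_fun (pluecker_index t d) n F"
        "\<forall>x. (\<forall>k. i \<le> k \<and> k < s + card Y \<longrightarrow> x (e k) = 0) \<longrightarrow> F (pluecker d (?bs x)) = 0"
        "F (pluecker d (?bs ?x)) \<noteq> 0"
      by (elim exE conjE) (rule that)
    then show "\<exists>n F. form_fun (pluecker_index t d) n F \<and>
        (\<forall>x. (\<forall>k. i \<le> k \<and> k < s + t * (s - t) \<longrightarrow> x (e k) = 0) \<longrightarrow> F (pluecker d (?bs x)) = 0) \<and>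
        (\<exists>x. (\<forall>k. i < k \<and> k < s + t * (s - t) \<longrightarrow> x (e k) = 0) \<and> F (pluecker d (?bs x)) \<noteq> 0)"
      using x0 unfolding cardY by (intro exI[of _ n] exI[of _ F] exI[of _ ?x] conjI)
  qed
qed

theorem theorem3p17:
  fixes t d s :: nat
    and \<Sigma> :: "(nat, 'k::{alg_closed_field, field_char_0}) mpoly set set"
  assumes "0 < t" "0 < d" "0 < s"
    and "t \<le> s" "s < d + 1"
    and "\<Sigma> = secant_locus s t d"
  shows "krull_dim (subtopology (grassmann_zariski t d) \<Sigma>)
           = enat (min (s + t * (s - t)) (t * (d - t + 1)))"
proof (rule antisym)
  have sd: "s \<le> d" using assms(5) by simp
  have "\<Sigma> \<subseteq> Gr t d" using assms(6) by (auto simp: secant_locus_def)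
  then show "krull_dim (subtopology (grassmann_zariski t d) \<Sigma>) \<le> enat (min (s + t * (s - t)) (t * (d - t + 1)))"
    using krull_dim_secant_locus_upper1[of t d \<Sigma>] krull_dim_secant_locus_upper2[of s t d, where 'a = 'k] assms sd
    by (simp add: min_def)
  \<comment> \<open>Hence the first entry of the minimum is at most the second exactly if
    \<open>s \<le> t * (d - s + 1)\<close>.\<close>
  have eq: "t * (d - s + 1) + t * (s - t) = t * (d - t + 1)"
    using assms(4) sd by (simp add: distrib_left[symmetric])
  show "enat (min (s + t * (s - t)) (t * (d - t + 1))) \<le> krull_dim (subtopology (grassmann_zariski t d) \<Sigma>)"
  proof (cases "s \<le> t * (d - s + 1)")
    case True
    then show ?thesis
      using krull_dim_secant_locus_lower_generic[OF assms(4,3) sd True, where 'a = 'k] eq assms(6)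
      by (simp add: min_def)
  next
    case False
    then show ?thesis
      using krull_dim_secant_locus_lower_full[OF assms(4,3) sd, where 'a = 'k] eq assms(6)
      by (simp add: min_def)
  qed
qed

end
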